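(* Let $\mathcal{F}_2=\{\mathrm{A}_{k\times l},\mathrm{S}_{k\times l} : k,l\geq 2,\ kl>4\}$. Then $\mathcal{F}_2$ is $11$-ravenous, i.e. $\mathcal{G}(G)\leq 11\,b(G)$ for all $G\in\mathcal{F}_2$.
   Context: For integers $k,l\ge 2$, let $\Pi_{k,l}$ be the set of partitions of $[kl]=\{1,\dots,kl\}$ into exactly $k$ parts each of size $l$. $\mathrm{S}_{k\times l}$ and $\mathrm{A}_{k\times l}$ denote $\mathrm{S}_{kl}$ and $\mathrm{A}_{kl}$ in their natural actions on $\Pi_{k,l}$. For a finite permutation group $G$ on $\Omega$, a base is a subset of $\Omega$ with trivial pointwise stabiliser, and $b(G)$ is the minimum base size. The greedy algorithm builds $\beta_1,\beta_2,\dots$ where each $\beta_i$ lies in a largest orbit of the pointwise stabiliser of $\{\beta_1,\dots,\beta_{i-1}\}$, stopping when this stabiliser is trivial; $\mathcal{G}(G)$ is the maximum size of a base produced this way. A family is $c$-ravenous if $\mathcal{G}(G)\le c\,b(G)$ for every member $G$. *)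

theory Defs
  imports "HOL-Combinatorics.Permutations" "HOL-Library.Disjoint_Sets"
begin

definition pstab :: "('a \<Rightarrow> 'a) set \<Rightarrow> (('a \<Rightarrow> 'a) \<Rightarrow> 'x \<Rightarrow> 'x) \<Rightarrow> 'x set \<Rightarrow> ('a \<Rightarrow> 'a) set" where
  "pstab G act B = {g \<in> G. \<forall>x\<in>B. act g x = x}"

definition orbit_of :: "('a \<Rightarrow> 'a) set \<Rightarrow> (('a \<Rightarrow> 'a) \<Rightarrow> 'x \<Rightarrow> 'x) \<Rightarrow> 'x \<Rightarrow> 'x set" where
  "orbit_of H act x = {act h x | h. h \<in> H}"

definition is_base :: "('a \<Rightarrow> 'a) set \<Rightarrow> (('a \<Rightarrow> 'a) \<Rightarrow> 'x \<Rightarrow> 'x) \<Rightarrow> 'x set \<Rightarrow> 'x set \<Rightarrow> bool" where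
  "is_base G act \<Omega> B \<longleftrightarrow> B \<subseteq> \<Omega> \<and> pstab G act B = {id}"

definition base_size :: "('a \<Rightarrow> 'a) set \<Rightarrow> (('a \<Rightarrow> 'a) \<Rightarrow> 'x \<Rightarrow> 'x) \<Rightarrow> 'x set \<Rightarrow> nat" where
  "base_size G act \<Omega> = (LEAST n. \<exists>B. finite B \<and> is_base G act \<Omega> B \<and> card B = n)"

definition greedy_base :: "('a \<Rightarrow> 'a) set \<Rightarrow> (('a \<Rightarrow> 'a) \<Rightarrow> 'x \<Rightarrow> 'x) \<Rightarrow> 'x set \<Rightarrow> 'x list \<Rightarrow> bool" where
  "greedy_base G act \<Omega> bs \<longleftrightarrow>
     (\<forall>i < length bs.
        pstab G act (set (take i bs)) \<noteq> {id} \<and>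
        bs ! i \<in> \<Omega> \<and>
        (\<forall>y\<in>\<Omega>. card (orbit_of (pstab G act (set (take i bs))) act y)
                 \<le> card (orbit_of (pstab G act (set (take i bs))) act (bs ! i)))) \<and>
     pstab G act (set bs) = {id}"

definition greedy_num :: "('a \<Rightarrow> 'a) set \<Rightarrow> (('a \<Rightarrow> 'a) \<Rightarrow> 'x \<Rightarrow> 'x) \<Rightarrow> 'x set \<Rightarrow> nat" where
  "greedy_num G act \<Omega> = Max {length bs | bs. greedy_base G act \<Omega> bs}"

definition Pi_kl :: "nat \<Rightarrow> nat \<Rightarrow> nat set set set" where
  "Pi_kl k l = {P. partition_on {1..k*l} P \<and> card P = k \<and> (\<forall>B\<in>P. card B = l)}"

definition Sym :: "nat \<Rightarrow> (nat \<Rightarrow> nat) set" where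
  "Sym n = {p. p permutes {1..n}}"

definition Alt :: "nat \<Rightarrow> (nat \<Rightarrow> nat) set" where
  "Alt n = {p. p permutes {1..n} \<and> evenperm p}"

definition part_act :: "(nat \<Rightarrow> nat) \<Rightarrow> nat set set \<Rightarrow> nat set set" where
  "part_act p P = (\<lambda>B. p ` B) ` P"

end

theory Submission
  imports Defs Complex_Main "HOL-Library.FuncSet"
begin

text \<open>
  Let \<open>H\<^sub>i\<close> be the pointwise stabilizer of the first \<open>i\<close> points of a greedy run.  The greedy choice makes
  \<open>H\<^sub>i\<^sub>+\<^sub>1\<close> at most as large as the stabilizer in \<open>H\<^sub>i\<close> of any partition whatsoever, so every explicit or
  random candidate partition bounds the run.

  A base of size \<open>b\<close> separates points by labels, hence \<open>l \<le> k^(b-1)\<close>.  It also gives some orbit of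
  length at least \<open>|H\<^sub>i|^(1/b)\<close>, so \<open>11 b\<close> steps raise the order of the group to a power smaller than
  \<open>e^(-11)\<close>; this settles every case in which the stabilizer has at most about \<open>2^12900\<close> elements after
  roughly \<open>b\<close> steps.

  To reach that point, look at the cells (common refinement classes) of the first \<open>i\<close> partitions.  The
  elements of \<open>H\<^sub>i\<close> fixing all parts form the product of the symmetric groups on the cells.  If
  \<open>k \<le> l\<close>, a cyclic colouring with one defect per row refines all cells evenly up to a factor \<open>3^k\<close> and
  has almost no symmetries, and a potential function shows that the deficits of the greedy choices only add
  up: with \<open>l \<le> k^S\<close>, after \<open>S + 2\<close> steps \<open>log\<^sub>2 |H\<^sub>i|\<close> is \<open>O(S^2 k)\<close>.  If this is too large for the first
  argument, then some partition that refines the cells evenly is moved by (almost) every element that moves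
  a part of an earlier partition: such an element moves at least \<open>2l\<close> points, so it rarely fixes a random
  partition.
  For \<open>l < k\<close> the cyclic colouring itself leaves a stabilizer of order at most \<open>k^2\<close> (or \<open>k^2 2^k\<close> if
  \<open>l = k - 1\<close>), and a switching argument finishes.
\<close>

section \<open>Permutation groups\<close>

text \<open>An element of a stabilizer may permute parts, and counting cells does not see such
  elements. A step is therefore measured by \<open>\<delta> j\<close>, the excess of the logarithm
  of the whole stabilizer over the value for a perfectly even refinement of the cells. The excess is
  bounded for one suitable candidate, and optimality of the greedy choice transfers the bound. All
  counting is done in the symmetric group, where the part-fixing elements form a full product of
  symmetric groups; the detour from the alternating group costs a factor 2, the source of the
  summands 1 in the logarithmic bounds. Constants: a base of size b makes each step multiply the
  logarithm by at most 1 - 1/b. At most 3b/2 steps are spent on reaching 12900, so 19b/2 steps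
  remain, and 12900 < e^(19/2). The thresholds 850 and 3900 for k and 4000 for k (S + 1)^2 are low
  enough that the explicit bounds stay under 12900 below them, and high enough for the other
  arguments to work above them.\<close>

lemma card_le_fibers:
  assumes "finite A" "finite B" "f ` A \<subseteq> B" "\<And>y. y \<in> B \<Longrightarrow> card {x \<in> A. f x = y} \<le> m"
  shows "card A \<le> m * card B"
proof -
  have "card A = (\<Sum>x\<in>A. 1)" by simp
  also have "\<dots> = (\<Sum>y\<in>B. \<Sum>x\<in>{x \<in> A. f x = y}. 1)"
    using sum.group[OF assms(1,2,3), of "\<lambda>_. 1::nat"] by simp
  also have "\<dots> \<le> (\<Sum>y\<in>B. m)" by (intro sum_mono) (use assms(4) in auto)
  finally show ?thesis by (simp add: mult.commute)
qed

text \<open>The fibre of \<open>f\<close> through \<open>g\<close> lies in the translate of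
  \<open>K\<close> by \<open>g\<close>. Stated for plain sets, so that it also covers the
  permutations extending a prescribed partial map.\<close>

lemma card_le_cosets:
  assumes fin: "finite H" "finite K" "finite B" and bij: "\<And>h. h \<in> H \<Longrightarrow> bij h" and "f ` H \<subseteq> B"
    and K: "\<And>g h. g \<in> H \<Longrightarrow> h \<in> H \<Longrightarrow> f g = f h \<Longrightarrow> inv g \<circ> h \<in> K"
  shows "card H \<le> card K * card B"
proof (rule card_le_fibers[OF fin(1,3) assms(5)])
  fix y
  show "card {h \<in> H. f h = y} \<le> card K"
  proof (cases "{h \<in> H. f h = y} = {}")
    case True then show ?thesis by (simp only: card.empty)
  next
    case False
    then obtain g where g: "g \<in> H" "f g = y" by auto
    have eq: "g \<circ> (inv g \<circ> h) = h" for h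
      using bij[OF g(1)] by (auto simp: fun_eq_iff bij_is_surj surj_f_inv_f)
    show ?thesis
    proof (rule card_inj_on_le[where f = "\<lambda>h. inv g \<circ> h"])
      show "inj_on (\<lambda>h. inv g \<circ> h) {h \<in> H. f h = y}" by (rule inj_onI) (metis eq)
      show "(\<lambda>h. inv g \<circ> h) ` {h \<in> H. f h = y} \<subseteq> K" using K g by auto
    qed (use fin in auto)
  qed
qed

definition perm_group :: "'a set \<Rightarrow> ('a \<Rightarrow> 'a) set \<Rightarrow> bool" where
  "perm_group X H \<longleftrightarrow> id \<in> H \<and> (\<forall>g\<in>H. g permutes X) \<and> (\<forall>g\<in>H. \<forall>h\<in>H. g \<circ> h \<in> H) \<and> (\<forall>g\<in>H. inv g \<in> H)"

lemma perm_groupD: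
  assumes "perm_group X H"
  shows "id \<in> H" "g \<in> H \<Longrightarrow> g permutes X" "g \<in> H \<Longrightarrow> h \<in> H \<Longrightarrow> g \<circ> h \<in> H" "g \<in> H \<Longrightarrow> inv g \<in> H"
    "g \<in> H \<Longrightarrow> bij g"
  using assms by (auto simp: perm_group_def permutes_bij)

lemma finite_perm_group: "perm_group X H \<Longrightarrow> finite X \<Longrightarrow> finite H"
  by (rule finite_subset[OF _ finite_permutations[of X]]) (auto simp: perm_group_def)

lemma card_perm_group_pos: "perm_group X H \<Longrightarrow> finite X \<Longrightarrow> card H > 0"
  by (metis card_gt_0_iff empty_iff finite_perm_group perm_groupD(1))

lemma perm_group_eq_id:
  assumes "perm_group X H" "finite X" "card H < 2"
  shows "H = {id}"
proof -
  have "card H = 1" using assms card_perm_group_pos[of X H] by auto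
  then show ?thesis using perm_groupD(1)[OF assms(1)] by (auto simp: card_1_singleton_iff)
qed

text \<open>The product set of \<open>L\<close> and \<open>F\<close> has |L| |F| / |L \<inter> F|
  elements and lies in \<open>H\<close>. It serves to compare the indices of two part-fixing groups
  in \<open>\<delta>_Suc_le\<close>.\<close>

lemma card_mult_le_card_Int:
  assumes L: "perm_group X L" and F: "perm_group X F" and H: "perm_group X H" and fin: "finite X"
    and sub: "L \<subseteq> H" "F \<subseteq> H"
  shows "card L * card F \<le> card (L \<inter> F) * card H"
proof -
  note finL = finite_perm_group[OF L fin] and finF = finite_perm_group[OF F fin]
  have "card (L \<times> F) \<le> card (L \<inter> F) * card H"
  proof (rule card_le_fibers)
    show "finite (L \<times> F)" "finite H" using finL finF finite_perm_group[OF H fin] by auto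
    show "(\<lambda>(a, b). a \<circ> b) ` (L \<times> F) \<subseteq> H" using sub perm_groupD(3)[OF H] by auto
    fix y
    show "card {x \<in> L \<times> F. (case x of (a, b) \<Rightarrow> a \<circ> b) = y} \<le> card (L \<inter> F)"
    proof (cases "{x \<in> L \<times> F. (case x of (a, b) \<Rightarrow> a \<circ> b) = y} = {}")
      case True then show ?thesis by (simp only: card.empty)
    next
      case False
      then obtain a0 b0 where 0: "a0 \<in> L" "b0 \<in> F" "a0 \<circ> b0 = y" by auto
      \<comment> \<open>Two factorizations of the same element differ by a common element of
        \<open>L\<close> and \<open>F\<close>.\<close>
      have key: "inv a0 \<circ> a = b0 \<circ> inv b" if "a \<in> L" "b \<in> F" "a \<circ> b = y" for a b
      proof -
        have bj: "bij a0" "bij a" "bij b" using that 0 perm_groupD(5)[OF L] perm_groupD(5)[OF F] by auto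
        show ?thesis
        proof
          fix x
          have "a (b (inv b x)) = a0 (b0 (inv b x))" using that 0 by (metis comp_apply)
          then have "a x = a0 (b0 (inv b x))" using bj by (simp add: bij_is_surj surj_f_inv_f)
          then show "(inv a0 \<circ> a) x = (b0 \<circ> inv b) x" using bj by (simp add: bij_is_inj inv_f_f)
        qed
      qed
      show ?thesis
      proof (rule card_inj_on_le[where f = "\<lambda>(a, b). inv a0 \<circ> a"])
        show "inj_on (\<lambda>(a, b). inv a0 \<circ> a) {x \<in> L \<times> F. (case x of (a, b) \<Rightarrow> a \<circ> b) = y}"
        proof (rule inj_onI, clarsimp)
          fix a b a' b'
          assume as: "a \<in> L" "b \<in> F" "a' \<in> L" "b' \<in> F" "a' \<circ> b' = a \<circ> b" "inv a0 \<circ> a = inv a0 \<circ> a'"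
            "y = a \<circ> b"
          have "bij (inv a0)" using perm_groupD(5)[OF L 0(1)] by (simp add: bij_imp_bij_inv)
          then have "a = a'" using as(6) by (metis bij_is_inj fun.inj_map_strong comp_apply ext inj_eq)
          moreover have "b = b'"
            using as(5) \<open>a = a'\<close> perm_groupD(5)[OF L as(1)] by (metis bij_is_inj comp_apply ext inj_eq)
          ultimately show "a = a' \<and> b = b'" by simp
        qed
        show "(\<lambda>(a, b). inv a0 \<circ> a) ` {x \<in> L \<times> F. (case x of (a, b) \<Rightarrow> a \<circ> b) = y} \<subseteq> L \<inter> F"
        proof (clarify, intro IntI)
          fix a b assume ab: "a \<in> L" "b \<in> F" "y = a \<circ> b"
          show "inv a0 \<circ> a \<in> L" using 0 ab perm_groupD(3,4)[OF L] by auto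
          show "inv a0 \<circ> a \<in> F" using key[of a b] 0 ab perm_groupD(3,4)[OF F] by auto
        qed
      qed (use finL in auto)
    qed
  qed
  then show ?thesis by (simp add: card_cartesian_product)
qed

section \<open>Actions: orbits, stabilizers, bases\<close>

locale perm_action =
  fixes X :: "'a set" and act :: "('a \<Rightarrow> 'a) \<Rightarrow> 'x \<Rightarrow> 'x"
  assumes finX: "finite X" and act_id: "act id x = x"
    and act_comp: "act (g \<circ> h) x = act g (act h x)"
begin

lemma act_inv: "bij g \<Longrightarrow> act g x = y \<Longrightarrow> act (inv g) y = x"
  by (metis act_comp act_id bij_is_inj inv_o_cancel)

lemma perm_group_pstab: assumes "perm_group X H" shows "perm_group X (pstab H act B)"
  unfolding perm_group_def pstab_def
  using perm_groupD[OF assms] by (auto simp: act_id act_comp intro: act_inv)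

lemma pstab_insert: "pstab H act (insert y B) = pstab (pstab H act B) act {y}"
  by (auto simp: pstab_def)

lemma orbit_stabilizer:
  assumes H: "perm_group X H"
  shows "card (orbit_of H act x) * card (pstab H act {x}) = card H"
proof (rule antisym)
  note fH = finite_perm_group[OF H finX]
  have fO: "finite (orbit_of H act x)" using fH by (auto simp: orbit_of_def)
  have fS: "finite (pstab H act {x})" using fH by (auto simp: pstab_def)
  show "card H \<le> card (orbit_of H act x) * card (pstab H act {x})"
  proof (subst mult.commute, rule card_le_cosets[OF fH fS fO, where f = "\<lambda>h. act h x"])
    show "(\<lambda>h. act h x) ` H \<subseteq> orbit_of H act x" by (auto simp: orbit_of_def)
    show "\<And>g h. g \<in> H \<Longrightarrow> h \<in> H \<Longrightarrow> act g x = act h x \<Longrightarrow> inv g \<circ> h \<in> pstab H act {x}"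
      using perm_groupD[OF H] by (auto simp: pstab_def act_comp intro: act_inv)
  qed (use perm_groupD[OF H] in auto)
  define r where "r y = (SOME h. h \<in> H \<and> act h x = y)" for y
  have r: "r y \<in> H \<and> act (r y) x = y" if y: "y \<in> orbit_of H act x" for y
  proof -
    have "\<exists>h. h \<in> H \<and> act h x = y" using y unfolding orbit_of_def by blast
    then show ?thesis unfolding r_def by (rule someI_ex)
  qed
  have "card (orbit_of H act x \<times> pstab H act {x}) \<le> card H"
  proof (rule card_inj_on_le[where f = "\<lambda>(y, s). r y \<circ> s"])
    show "inj_on (\<lambda>(y, s). r y \<circ> s) (orbit_of H act x \<times> pstab H act {x})"
    proof (rule inj_onI, clarify)
      fix y s y' s'
      assume y: "y \<in> orbit_of H act x" "y' \<in> orbit_of H act x" and s: "s \<in> pstab H act {x}" "s' \<in> pstab H act {x}"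
        and eq: "r y \<circ> s = r y' \<circ> s'"
      have "act (r y \<circ> s) x = y" "act (r y' \<circ> s') x = y'" using r y s by (auto simp: act_comp pstab_def)
      then have yy: "y = y'" using eq by simp
      then have "s = s'" using eq r[OF y(1)] perm_groupD(5)[OF H]
        by (metis bij_is_inj comp_apply ext inj_eq)
      with yy show "y = y' \<and> s = s'" by simp
    qed
    show "(\<lambda>(y, s). r y \<circ> s) ` (orbit_of H act x \<times> pstab H act {x}) \<subseteq> H"
      using r perm_groupD(3)[OF H] by (auto simp: pstab_def)
  qed (rule fH)
  then show "card (orbit_of H act x) * card (pstab H act {x}) \<le> card H"
    by (simp add: card_cartesian_product)
qed

text \<open>The way the greedy rule enters: a largest orbit means a smallest stabilizer, so the
  chosen point can be compared with any other.\<close>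

lemma stabilizer_antimono_orbit:
  assumes H: "perm_group X H" and le: "card (orbit_of H act y) \<le> card (orbit_of H act x)"
  shows "card (pstab H act {x}) \<le> card (pstab H act {y})"
proof (rule ccontr)
  assume "\<not> ?thesis"
  then have lt: "card (pstab H act {y}) < card (pstab H act {x})" by simp
  have "0 < card (orbit_of H act x)"
    using orbit_stabilizer[OF H, of x] card_perm_group_pos[OF H finX] by (metis gr0I mult_0 nat_less_le)
  then have "card (orbit_of H act y) * card (pstab H act {y}) < card (orbit_of H act x) * card (pstab H act {x})"
    using le lt by (meson le_less_trans mult_le_mono1 mult_less_mono2)
  then show False using orbit_stabilizer[OF H] by simp
qed

text \<open>A base embeds the group into the product of the orbits of its points, so some orbit is large.\<close>

lemma card_le_orbit_power:
  assumes H: "perm_group X H" and fB: "finite B" and B: "pstab H act B \<subseteq> {id}"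
    and M: "\<And>y. y \<in> B \<Longrightarrow> card (orbit_of H act y) \<le> M"
  shows "card H \<le> M ^ card B"
proof -
  note fH = finite_perm_group[OF H finX]
  have "card H \<le> card (Pi\<^sub>E B (orbit_of H act))"
  proof (rule card_inj_on_le[where f = "\<lambda>h. restrict (act h) B"])
    show "inj_on (\<lambda>h. restrict (act h) B) H"
    proof (rule inj_onI)
      fix g h assume gh: "g \<in> H" "h \<in> H" and eq: "restrict (act g) B = restrict (act h) B"
      have "act g y = act h y" if "y \<in> B" for y using eq that by (metis restrict_apply')
      then have "inv g \<circ> h \<in> pstab H act B"
        using gh perm_groupD[OF H] by (auto simp: pstab_def act_comp intro: act_inv)
      then have id: "inv g \<circ> h = id" using B by auto
      have "h x = g x" for x
        using perm_groupD(5)[OF H gh(1)] id by (metis bij_inv_eq_iff comp_apply id_apply)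
      then show "g = h" by auto
    qed
    show "(\<lambda>h. restrict (act h) B) ` H \<subseteq> Pi\<^sub>E B (orbit_of H act)" by (auto simp: orbit_of_def)
    show "finite (Pi\<^sub>E B (orbit_of H act))" using fB fH by (intro finite_PiE) (auto simp: orbit_of_def)
  qed
  also have "\<dots> = (\<Prod>y\<in>B. card (orbit_of H act y))" using fB by (simp add: card_PiE)
  also have "\<dots> \<le> (\<Prod>y\<in>B. M)" by (intro prod_mono) (use M in auto)
  finally show ?thesis by simp
qed

end

section \<open>Cells and the potential\<close>

lemma permutes_restrict:
  assumes "r permutes X" "r ` A = A"
  shows "(\<lambda>x. if x \<in> A then r x else x) permutes A"
proof (rule bij_imp_permutes)
  have "inj r" using assms(1) permutes_inj by blast
  then show "bij_betw (\<lambda>x. if x \<in> A then r x else x) A A"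
    using assms(2) by (auto simp: bij_betw_def inj_on_def inj_def image_def)
qed auto

text \<open>Induction on the number of blocks: composing a permutation of one block with one of the
  remaining blocks is inverted by \<open>J\<close>, which restricts to the two sets.\<close>

lemma card_permutes_preserving:
  assumes "finite \<C>" "\<And>C. C \<in> \<C> \<Longrightarrow> finite C" "disjoint \<C>"
  shows "card {p. p permutes \<Union>\<C> \<and> (\<forall>C\<in>\<C>. p ` C = C)} = (\<Prod>C\<in>\<C>. fact (card C))"
  using assms
proof (induction \<C> rule: finite_induct)
  case empty
  have "{p. p permutes {}} = {id :: 'a \<Rightarrow> 'a}" by (auto simp: permutes_def fun_eq_iff)
  then show ?case by simp
next
  case (insert C \<C>)
  let ?S = "{p. p permutes \<Union>\<C> \<and> (\<forall>C\<in>\<C>. p ` C = C)}"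
  let ?T = "{p. p permutes \<Union>(insert C \<C>) \<and> (\<forall>D\<in>insert C \<C>. p ` D = D)}"
  have "C \<inter> D = {}" if "D \<in> \<C>" for D
    using insert.prems(2) insert.hyps(2) that unfolding disjoint_def by (metis insertI1 insertI2)
  then have dis: "C \<inter> \<Union>\<C> = {}" by blast
  define J where "J r = ((\<lambda>x. if x \<in> C then r x else x), (\<lambda>x. if x \<in> \<Union>\<C> then r x else x))" for r :: "'a \<Rightarrow> 'a"
  have pq: "(p \<circ> q) x = (if x \<in> C then p x else q x)" if "p permutes C" "q permutes \<Union>\<C>" for p q x
  proof -
    have "q y \<in> \<Union>\<C> \<longleftrightarrow> y \<in> \<Union>\<C>" for y by (rule permutes_in_image[OF that(2)])
    then show ?thesis
      using dis permutes_not_in[OF that(1)] permutes_not_in[OF that(2)]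
      by (cases "x \<in> C"; cases "x \<in> \<Union>\<C>") (simp_all del: Union_iff, blast+)
  qed
  have "bij_betw (\<lambda>(p, q). p \<circ> q) ({p. p permutes C} \<times> ?S) ?T"
  proof (rule bij_betw_byWitness[where f' = J])
    show "\<forall>a\<in>{p. p permutes C} \<times> ?S. J (case a of (p, q) \<Rightarrow> p \<circ> q) = a"
    proof
      fix a assume "a \<in> {p. p permutes C} \<times> ?S"
      then obtain p q where a: "a = (p, q)" and pq': "p permutes C" "q permutes \<Union>\<C>" by auto
      have "(\<lambda>x. if x \<in> C then (p \<circ> q) x else x) = p"
        using pq[OF pq'] permutes_not_in[OF pq'(1)] by (simp add: fun_eq_iff)
      moreover have "(\<lambda>x. if x \<in> \<Union>\<C> then (p \<circ> q) x else x) = q"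
      proof
        fix x show "(if x \<in> \<Union>\<C> then (p \<circ> q) x else x) = q x"
          using pq[OF pq', of x] permutes_not_in[OF pq'(2), of x] dis by (simp del: Union_iff) blast
      qed
      ultimately show "J (case a of (p, q) \<Rightarrow> p \<circ> q) = a" unfolding J_def a case_prod_conv by blast
    qed
    show "\<forall>r\<in>?T. (case J r of (p, q) \<Rightarrow> p \<circ> q) = r"
    proof
      fix r assume "r \<in> ?T"
      then have r: "r permutes \<Union>(insert C \<C>)" "r ` C = C" by auto
      have inC: "r y \<in> C \<longleftrightarrow> y \<in> C" for y using r by (metis inj_image_mem_iff permutes_inj)
      have out: "r y = y" if "y \<notin> C" "y \<notin> \<Union>\<C>" for y using permutes_not_in[OF r(1), of y] that by simp
      have "((\<lambda>x. if x \<in> C then r x else x) \<circ> (\<lambda>x. if x \<in> \<Union>\<C> then r x else x)) x = r x" for x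
        using inC[of x] out[of x] dis by (cases "x \<in> C"; cases "x \<in> \<Union>\<C>") (simp_all del: Union_iff, blast+)
      then show "(case J r of (p, q) \<Rightarrow> p \<circ> q) = r" unfolding J_def by (simp add: fun_eq_iff)
    qed
    show "(\<lambda>(p, q). p \<circ> q) ` ({p. p permutes C} \<times> ?S) \<subseteq> ?T"
    proof
      fix r assume "r \<in> (\<lambda>(p, q). p \<circ> q) ` ({p. p permutes C} \<times> ?S)"
      then obtain p q where r: "r = p \<circ> q" and pq': "p permutes C" "q permutes \<Union>\<C>" "\<forall>C\<in>\<C>. q ` C = C" by auto
      have 1: "(p \<circ> q) permutes \<Union>(insert C \<C>)"
        by (rule permutes_compose[OF permutes_subset[OF pq'(2)] permutes_subset[OF pq'(1)]]) auto
      have "(p \<circ> q) ` C = p ` C" using pq[OF pq'(1,2)] by (intro image_cong) auto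
      then have 2: "(p \<circ> q) ` C = C" using permutes_image[OF pq'(1)] by simp
      have 3: "(p \<circ> q) ` D = D" if "D \<in> \<C>" for D
      proof -
        have "(p \<circ> q) x = q x" if "x \<in> D" for x
        proof -
          have "x \<notin> C" using dis that \<open>D \<in> \<C>\<close> by blast
          then show ?thesis using pq[OF pq'(1,2), of x] by simp
        qed
        then have "(p \<circ> q) ` D = q ` D" by (intro image_cong) auto
        then show ?thesis using pq' that by simp
      qed
      show "r \<in> ?T" using 1 2 3 r by simp
    qed
    show "J ` ?T \<subseteq> {p. p permutes C} \<times> ?S"
    proof
      fix z assume "z \<in> J ` ?T"
      then obtain r where z: "z = J r" and r: "r permutes \<Union>(insert C \<C>)" "r ` C = C" "\<forall>D\<in>\<C>. r ` D = D" by auto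
      have U: "r ` \<Union>\<C> = \<Union>\<C>" using r(3) by (auto simp: image_Union)
      have "(\<lambda>x. if x \<in> \<Union>\<C> then r x else x) ` D = D" if "D \<in> \<C>" for D
      proof -
        have "(\<lambda>x. if x \<in> \<Union>\<C> then r x else x) ` D = r ` D" using that by (intro image_cong) auto
        then show ?thesis using r that by simp
      qed
      moreover note permutes_restrict[OF r(1) U] permutes_restrict[OF r(1,2)]
      ultimately show "z \<in> {p. p permutes C} \<times> ?S" unfolding z J_def by (simp del: Union_iff)
    qed
  qed
  then have "card ?T = card {p. p permutes C} * card ?S"
    by (simp add: bij_betw_same_card[symmetric] card_cartesian_product)
  also have "card {p. p permutes C} = fact (card C)"
    using card_permutations[of C] insert.prems by simp
  also have "card ?S = (\<Prod>C\<in>\<C>. fact (card C))"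
    by (rule insert.IH) (use insert.prems in \<open>auto simp: pairwise_insert disjoint_def\<close>)
  finally show ?case using insert.hyps by simp
qed

section \<open>Convexity: even splittings are extremal\<close>

lemma sum_div_blocks:
  fixes \<gamma> :: "nat \<Rightarrow> real"
  assumes "k > 0" "r \<le> k"
  shows "(\<Sum>y<k * q + r. \<gamma> (y div k)) = real k * (\<Sum>y<q. \<gamma> y) + real r * \<gamma> q"
  using assms(2)
proof (induction q arbitrary: r)
  case 0
  have "(\<Sum>y<r. \<gamma> (y div k)) = (\<Sum>y<r. \<gamma> 0)" 
  proof (rule sum.cong)
    fix y assume "y \<in> {..<r}" then have "y < k" using 0 by auto
    then show "\<gamma> (y div k) = \<gamma> 0" by simp
  qed simp
  then show ?case by simp
next
  case (Suc q)
  have base: "(\<Sum>y<k * Suc q. \<gamma> (y div k)) = real k * (\<Sum>y<Suc q. \<gamma> y)"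
    using Suc.IH[of k] by (simp add: algebra_simps)
  have "r' \<le> k \<Longrightarrow> (\<Sum>y<k * Suc q + r'. \<gamma> (y div k)) = real k * (\<Sum>y<Suc q. \<gamma> y) + real r' * \<gamma> (Suc q)" for r'
  proof (induction r')
    case 0 then show ?case using base by simp
  next
    case (Suc r')
    have "(k * Suc q + r') div k = Suc q" using Suc.prems assms(1) by (metis Suc_le_lessD add_0_right div_less div_mult_self4 less_numeral_extra(3))
    then show ?case using Suc by (simp add: algebra_simps)
  qed
  then show ?case using Suc.prems by blast
qed

text \<open>A sum with antitone increments is concave in its upper limit, so it lies below its
  tangent at \<open>q\<close>, of slope \<open>\<gamma> q\<close>.\<close>

lemma concave_tangent:
  fixes \<gamma> :: "nat \<Rightarrow> real"
  assumes "\<And>x y. x \<le> y \<Longrightarrow> \<gamma> y \<le> \<gamma> x"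
  shows "(\<Sum>y<a. \<gamma> y) \<le> (\<Sum>y<q. \<gamma> y) + (real a - real q) * \<gamma> q"
proof (cases "q \<le> a")
  case True
  have "(\<Sum>y<a. \<gamma> y) = (\<Sum>y<q. \<gamma> y) + (\<Sum>y=q..<a. \<gamma> y)"
    using sum.atLeastLessThan_concat[of 0 q a \<gamma>] True by (simp add: lessThan_atLeast0)
  also have "(\<Sum>y=q..<a. \<gamma> y) \<le> (\<Sum>y=q..<a. \<gamma> q)" by (intro sum_mono assms) auto
  finally show ?thesis using True by (simp add: of_nat_diff)
next
  case False
  have "(\<Sum>y<q. \<gamma> y) = (\<Sum>y<a. \<gamma> y) + (\<Sum>y=a..<q. \<gamma> y)"
    using sum.atLeastLessThan_concat[of 0 a q \<gamma>] False by (simp add: lessThan_atLeast0)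
  moreover have "(\<Sum>y=a..<q. \<gamma> q) \<le> (\<Sum>y=a..<q. \<gamma> y)" by (intro sum_mono assms) auto
  ultimately show ?thesis using False by (simp add: of_nat_diff algebra_simps)
qed

text \<open>Take the tangent at \<open>c div k\<close>. An even splitting uses only the sizes
  \<open>c div k\<close> and \<open>c div k + 1\<close>, where tangent and function agree, so it
  attains the tangent bound.\<close>

lemma concave_split_le_balanced:
  fixes \<gamma> :: "nat \<Rightarrow> real" and a :: "'i \<Rightarrow> nat"
  assumes "\<And>x y. x \<le> y \<Longrightarrow> \<gamma> y \<le> \<gamma> x" and "finite I" "card I = k" "k > 0" "sum a I = c"
  shows "(\<Sum>i\<in>I. \<Sum>y<a i. \<gamma> y) \<le> (\<Sum>y<c. \<gamma> (y div k))"
proof -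
  define q where "q = c div k"
  have "(\<Sum>i\<in>I. \<Sum>y<a i. \<gamma> y) \<le> (\<Sum>i\<in>I. (\<Sum>y<q. \<gamma> y) + (real (a i) - real q) * \<gamma> q)"
    by (intro sum_mono concave_tangent assms)
  also have "\<dots> = real k * (\<Sum>y<q. \<gamma> y) + (real (sum a I) - real k * real q) * \<gamma> q"
    by (simp add: sum.distrib sum_distrib_right[symmetric] sum_subtractf assms(3))
  also have "real (sum a I) - real k * real q = real (c mod k)"
    using assms(5) unfolding q_def by (simp add: of_nat_mult[symmetric] of_nat_diff[symmetric] minus_mult_div_eq_mod del: of_nat_mult)
  also have "real k * (\<Sum>y<q. \<gamma> y) + real (c mod k) * \<gamma> q = (\<Sum>y<c. \<gamma> (y div k))"
    using sum_div_blocks[of k "c mod k" \<gamma> q] assms(4) by (simp add: q_def mod_less_divisor less_imp_le)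
  finally show ?thesis .
qed

lemma log2_mono: "0 < x \<Longrightarrow> x \<le> y \<Longrightarrow> log 2 x \<le> log 2 (y :: real)" by simp

section \<open>Partitions into k parts of size l and their common refinements\<close>

definition same_part :: "'a set set \<Rightarrow> 'a \<Rightarrow> 'a set" where
  "same_part P x = \<Union>{B \<in> P. x \<in> B}"

locale kl_parts =
  fixes k l :: nat
  assumes k2: "2 \<le> k" and l2: "2 \<le> l"
begin

definition X :: "nat set" where "X = {1..k * l}"
abbreviation Om :: "nat set set set" where "Om \<equiv> Pi_kl k l"

lemma finite_X: "finite X" and card_X: "card X = k * l" by (auto simp: X_def)

lemma OmD:
  assumes "P \<in> Om"
  shows "partition_on X P" "card P = k" "B \<in> P \<Longrightarrow> card B = l" "finite P" "B \<in> P \<Longrightarrow> finite B"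
    "B \<in> P \<Longrightarrow> B \<subseteq> X" "B \<in> P \<Longrightarrow> C \<in> P \<Longrightarrow> x \<in> B \<Longrightarrow> x \<in> C \<Longrightarrow> B = C" "\<Union>P = X" "B \<in> P \<Longrightarrow> B \<noteq> {}"
proof -
  show p: "partition_on X P" and c: "card P = k" using assms by (auto simp: Pi_kl_def X_def)
  show cb: "B \<in> P \<Longrightarrow> card B = l" for B using assms by (auto simp: Pi_kl_def)
  show "finite P" using c k2 by (metis card.infinite not_numeral_le_zero)
  show "finite B" if "B \<in> P" using cb[OF that] l2 by (metis card.infinite not_numeral_le_zero)
  show "\<Union>P = X" using p by (simp add: partition_on_def)
  then show "B \<subseteq> X" if "B \<in> P" using that by auto
  show "B = C" if "B \<in> P" "C \<in> P" "x \<in> B" "x \<in> C"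
    using p that by (auto simp: partition_on_def disjoint_def)
  show "B \<noteq> {}" if "B \<in> P" using cb[OF that] l2 by auto
qed

lemma same_part_eq: "P \<in> Om \<Longrightarrow> B \<in> P \<Longrightarrow> x \<in> B \<Longrightarrow> same_part P x = B"
  using OmD(7)[of P] by (auto simp: same_part_def)

lemma same_part_in: "P \<in> Om \<Longrightarrow> x \<in> X \<Longrightarrow> same_part P x \<in> P \<and> x \<in> same_part P x"
  using OmD(8)[of P] same_part_eq by (metis UnionE)

lemma part_act_in_Om: assumes "p permutes X" "P \<in> Om" shows "part_act p P \<in> Om"
proof -
  have inj: "inj p" using assms(1) permutes_inj by blast
  have 1: "partition_on X (part_act p P)"
    unfolding part_act_def partition_on_def
  proof (intro conjI)
    show "\<Union>((`) p ` P) = X" using OmD(8)[OF assms(2)] permutes_image[OF assms(1)] by (auto simp: image_Union[symmetric])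
    show "disjoint ((`) p ` P)"
      unfolding disjoint_def using OmD(7)[OF assms(2)] inj by (auto simp: inj_def) blast+
    show "{} \<notin> (`) p ` P" using OmD(9)[OF assms(2)] by auto
  qed
  have 2: "card (part_act p P) = k" unfolding part_act_def
    using OmD(2)[OF assms(2)] inj by (metis card_image inj_image_eq_iff inj_onI)
  have 3: "card B = l" if "B \<in> part_act p P" for B
    using that OmD(3)[OF assms(2)] inj by (auto simp: part_act_def card_image inj_on_subset)
  show ?thesis using 1 2 3 by (auto simp: Pi_kl_def X_def)
qed

lemma part_act_id: "part_act id P = P" by (simp add: part_act_def)
lemma part_act_comp: "part_act (g \<circ> h) P = part_act g (part_act h P)" by (auto simp: part_act_def image_comp)

sublocale perm_action X part_act
  by unfold_locales (simp_all add: part_act_id part_act_comp finite_X)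

abbreviation St :: "nat set set set \<Rightarrow> (nat \<Rightarrow> nat) set" where "St Q \<equiv> pstab (Sym (k * l)) part_act Q"

lemma perm_group_Sym: "perm_group X (Sym (k * l))"
  by (simp add: perm_group_def Sym_def X_def permutes_id permutes_compose permutes_inv)

lemma perm_group_St: "perm_group X (St Q)" by (rule perm_group_pstab[OF perm_group_Sym])

lemma St_iff: "p \<in> St Q \<longleftrightarrow> p permutes X \<and> (\<forall>P\<in>Q. part_act p P = P)" by (auto simp: pstab_def Sym_def X_def)

lemma St_image: "p \<in> St Q \<Longrightarrow> P \<in> Q \<Longrightarrow> B \<in> P \<Longrightarrow> p ` B \<in> P" by (force simp: St_iff part_act_def)

lemma finite_Om: "finite Om"
proof -
  have "Om \<subseteq> Pow (Pow X)" using OmD(6) by auto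
  then show ?thesis by (rule finite_subset) (simp add: finite_X)
qed

definition cell :: "nat set set set \<Rightarrow> nat \<Rightarrow> nat set" where
  "cell Q x = {y \<in> X. \<forall>P\<in>Q. y \<in> same_part P x}"

definition cells :: "nat set set set \<Rightarrow> nat set set" where
  "cells Q = cell Q ` X"

lemma cell_subset: "cell Q x \<subseteq> X" by (auto simp: cell_def)
lemma finite_cell: "finite (cell Q x)" by (rule finite_subset[OF cell_subset finite_X])
lemma finite_cells: "finite (cells Q)" by (simp add: cells_def finite_X)
lemma cell_in_cells: "x \<in> X \<Longrightarrow> cell Q x \<in> cells Q" by (simp add: cells_def)
lemma finite_in_cells: "C \<in> cells Q \<Longrightarrow> finite C" by (auto simp: cells_def finite_cell)
lemma in_cells_subset: "C \<in> cells Q \<Longrightarrow> C \<subseteq> X" using cell_subset by (auto simp: cells_def)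

lemma mem_cell: "Q \<subseteq> Om \<Longrightarrow> x \<in> X \<Longrightarrow> x \<in> cell Q x" using same_part_in by (auto simp: cell_def)

lemma cell_eq: assumes "Q \<subseteq> Om" "x \<in> X" "y \<in> cell Q x" shows "cell Q y = cell Q x"
proof -
  have "same_part P y = same_part P x" if "P \<in> Q" for P
    using assms that same_part_in[of P x] same_part_eq[of P "same_part P x" y] by (auto simp: cell_def)
  then show ?thesis by (auto simp: cell_def)
qed

lemma cells_eqI: "Q \<subseteq> Om \<Longrightarrow> C \<in> cells Q \<Longrightarrow> x \<in> C \<Longrightarrow> C = cell Q x"
  using cell_eq by (auto simp: cells_def)

lemma disjoint_cells: "Q \<subseteq> Om \<Longrightarrow> disjoint (cells Q)"
  unfolding disjoint_def using cells_eqI by blast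

lemma Union_cells: "Q \<subseteq> Om \<Longrightarrow> \<Union>(cells Q) = X"
  unfolding cells_def using mem_cell[of Q] cell_subset[of Q] by blast

lemma cells_nonempty: "Q \<subseteq> Om \<Longrightarrow> C \<in> cells Q \<Longrightarrow> C \<noteq> {}" using mem_cell by (auto simp: cells_def)

lemma cell_insert: "cell (insert P Q) x = cell Q x \<inter> same_part P x" by (auto simp: cell_def)

lemma cell_subset_part: "P \<in> Q \<Longrightarrow> cell Q x \<subseteq> same_part P x" by (auto simp: cell_def)

lemma card_cell_le: assumes "P \<in> Q" "Q \<subseteq> Om" "C \<in> cells Q" shows "card C \<le> l"
proof -
  obtain x where x: "x \<in> X" "C = cell Q x" using assms by (auto simp: cells_def)
  have "same_part P x \<in> P" using assms x same_part_in by blast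
  then show ?thesis using cell_subset_part[OF assms(1), of x] x assms OmD(3,5)[of P] card_mono by (metis subsetD)
qed

lemma cells_mono_subset: assumes "Q \<subseteq> Q'" "Q' \<subseteq> Om" "D \<in> cells Q'" shows "\<exists>C\<in>cells Q. D \<subseteq> C"
proof -
  obtain x where "x \<in> X" "D = cell Q' x" using assms by (auto simp: cells_def)
  then have "D \<subseteq> cell Q x" "cell Q x \<in> cells Q" using assms by (auto simp: cell_def cells_def)
  then show ?thesis by blast
qed

definition V :: "(nat \<Rightarrow> real) \<Rightarrow> nat set set set \<Rightarrow> real" where
  "V w Q = (\<Sum>C\<in>cells Q. w (card C))"

lemma V_mono: "(\<And>C. C \<in> cells Q \<Longrightarrow> w (card C) \<le> w' (card C)) \<Longrightarrow> V w Q \<le> V w' Q"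
  unfolding V_def by (rule sum_mono)

text \<open>The new cells are the nonempty intersections, and each determines its cell and its part.
  \<open>w 0 = 0\<close> lets the sum run over all pairs.\<close>

lemma V_insert:
  assumes Q: "Q \<subseteq> Om" and P: "P \<in> Om" and w0: "w 0 = 0"
  shows "V w (insert P Q) = (\<Sum>C\<in>cells Q. \<Sum>B\<in>P. w (card (C \<inter> B)))"
proof -
  let ?N = "{(C, B). C \<in> cells Q \<and> B \<in> P \<and> C \<inter> B \<noteq> {}}"
  have fin: "finite (cells Q \<times> P)" using finite_cells OmD(4)[OF P] by simp
  have "(\<Sum>C\<in>cells Q. \<Sum>B\<in>P. w (card (C \<inter> B))) = (\<Sum>(C, B)\<in>cells Q \<times> P. w (card (C \<inter> B)))"
    by (simp add: sum.cartesian_product)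
  also have "\<dots> = (\<Sum>(C, B)\<in>?N. w (card (C \<inter> B)))"
    by (rule sum.mono_neutral_right[OF fin]) (auto simp: w0)
  also have "\<dots> = (\<Sum>D\<in>(\<lambda>(C, B). C \<inter> B) ` ?N. w (card D))"
  proof (subst sum.reindex)
    show "inj_on (\<lambda>(C, B). C \<inter> B) ?N"
    proof (rule inj_onI, clarify)
      fix C B C' B' x
      assume as: "C \<in> cells Q" "B \<in> P" "C' \<in> cells Q" "B' \<in> P" "C \<inter> B = C' \<inter> B'" "C \<inter> B \<noteq> {}"
      then obtain x where "x \<in> C" "x \<in> B" "x \<in> C'" "x \<in> B'" by blast
      then show "C = C' \<and> B = B'" using as cells_eqI[OF Q] OmD(7)[OF P] by metis
    qed
  qed (auto intro: sum.cong)
  also have "(\<lambda>(C, B). C \<inter> B) ` ?N = cells (insert P Q)"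
  proof (intro equalityI subsetI)
    fix D assume "D \<in> (\<lambda>(C, B). C \<inter> B) ` ?N"
    then obtain C B x where *: "C \<in> cells Q" "B \<in> P" "D = C \<inter> B" "x \<in> C" "x \<in> B" by auto
    then have "x \<in> X" "C = cell Q x" "B = same_part P x"
      using in_cells_subset cells_eqI[OF Q] same_part_eq[OF P] by auto
    then show "D \<in> cells (insert P Q)" using * cell_insert by (auto simp: cells_def)
  next
    fix D assume "D \<in> cells (insert P Q)"
    then obtain x where x: "x \<in> X" "D = cell Q x \<inter> same_part P x" by (auto simp: cells_def cell_insert)
    then have "(cell Q x, same_part P x) \<in> ?N" using mem_cell[OF Q x(1)] same_part_in[OF P x(1)] cell_in_cells by blast
    then show "D \<in> (\<lambda>(C, B). C \<inter> B) ` ?N" using x by (metis (mono_tags, lifting) case_prod_conv image_eqI)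
  qed
  finally show ?thesis by (simp add: V_def)
qed

lemma sum_card_Int_parts: assumes "P \<in> Om" "C \<subseteq> X" shows "(\<Sum>B\<in>P. card (C \<inter> B)) = card C"
proof -
  have "card (\<Union>B\<in>P. C \<inter> B) = (\<Sum>B\<in>P. card (C \<inter> B))"
  proof (rule card_UN_disjoint)
    show "finite P" using OmD(4)[OF assms(1)] .
    show "\<forall>B\<in>P. finite (C \<inter> B)" using OmD(5)[OF assms(1)] by auto
    show "\<forall>B\<in>P. \<forall>B'\<in>P. B \<noteq> B' \<longrightarrow> C \<inter> B \<inter> (C \<inter> B') = {}" using OmD(7)[OF assms(1)] by blast
  qed
  moreover have "(\<Union>B\<in>P. C \<inter> B) = C" using assms OmD(8)[OF assms(1)] by auto
  ultimately show ?thesis by simp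
qed

definition Fx :: "nat set set set \<Rightarrow> (nat \<Rightarrow> nat) set" where
  "Fx Q = {p. p permutes X \<and> (\<forall>P\<in>Q. \<forall>B\<in>P. p ` B = B)}"

lemma perm_group_Fx: "perm_group X (Fx Q)"
proof -
  have "inv g ` B = B" if "g permutes X" "g ` B = B" for g B
    using that by (metis inj_imp_inv_eq image_inv_f_f permutes_inj)
  moreover have "(g \<circ> h) ` B = B" if "g ` B = B" "h ` B = B" for g h :: "nat \<Rightarrow> nat" and B
    using that by (metis image_comp)
  ultimately show ?thesis unfolding perm_group_def Fx_def
    by (auto simp: permutes_id permutes_compose permutes_inv simp del: comp_apply)
qed

lemma Fx_subset_St: "Fx Q \<subseteq> St Q" by (auto simp: Fx_def St_iff part_act_def)

text \<open>\<open>lf c\<close> is the binary logarithm of \<open>c!\<close>, and \<open>wbal c\<close> that of the product of the factorials of the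
  sizes of \<open>k\<close> pieces into which a set of size \<open>c\<close> is divided as evenly as possible.\<close>

definition lf :: "nat \<Rightarrow> real" where "lf c = (\<Sum>y<c. log 2 (1 + real y))"
definition wbal :: "nat \<Rightarrow> real" where "wbal c = (\<Sum>y<c. log 2 (1 + real (y div k)))"

lemma lf_eq: "lf c = log 2 (fact c)"
  by (induction c) (auto simp: lf_def log_mult add.commute)

lemma card_Fx: assumes "Q \<subseteq> Om" shows "real (card (Fx Q)) = 2 powr V lf Q"
proof -
  have "Fx Q = {p. p permutes \<Union>(cells Q) \<and> (\<forall>C\<in>cells Q. p ` C = C)}"
  proof (intro equalityI subsetI)
    fix p assume p: "p \<in> Fx Q"
    have px: "p permutes X" using p by (simp add: Fx_def)
    have "p ` cell Q x = cell Q x" if x: "x \<in> X" for x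
    proof -
      have "p ` same_part P x = same_part P x" if "P \<in> Q" for P
        using p same_part_in[of P x] assms that x unfolding Fx_def by blast
      then have "p y \<in> cell Q x" if "y \<in> cell Q x" for y
        using that permutes_in_image[OF px] unfolding cell_def by blast
      then have "p ` cell Q x \<subseteq> cell Q x" by auto
      moreover have "card (p ` cell Q x) = card (cell Q x)"
        using permutes_inj_on[OF px] by (rule card_image)
      ultimately show ?thesis using finite_cell card_subset_eq by metis
    qed
    then show "p \<in> {p. p permutes \<Union>(cells Q) \<and> (\<forall>C\<in>cells Q. p ` C = C)}"
      using px Union_cells[OF assms] by (auto simp: cells_def)
  next
    fix p assume p: "p \<in> {p. p permutes \<Union>(cells Q) \<and> (\<forall>C\<in>cells Q. p ` C = C)}"
    then have px: "p permutes X" using Union_cells[OF assms] by simp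
    have "p ` B = B" if PB: "P \<in> Q" "B \<in> P" for P B
    proof -
      have "p x \<in> B" if "x \<in> B" for x
      proof -
        have xX: "x \<in> X" using that PB assms OmD(6) by blast
        have "p x \<in> p ` cell Q x" using mem_cell[OF assms xX] by simp
        also have "\<dots> = cell Q x" using p xX cell_in_cells by blast
        finally have "p x \<in> same_part P x" using cell_subset_part[OF PB(1)] by blast
        then show ?thesis using same_part_eq[of P B x] that PB assms by auto
      qed
      then have "p ` B \<subseteq> B" by auto
      moreover have "card (p ` B) = card B" using permutes_inj_on[OF px] by (rule card_image)
      moreover have "finite B" using PB assms OmD(5) by blast
      ultimately show ?thesis using card_subset_eq by metis
    qed
    then show "p \<in> Fx Q" using px by (auto simp: Fx_def)
  qed
  then have "card (Fx Q) = (\<Prod>C\<in>cells Q. fact (card C))"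
    using card_permutes_preserving[OF finite_cells finite_in_cells disjoint_cells[OF assms]] by simp
  then have "real (card (Fx Q)) = (\<Prod>C\<in>cells Q. 2 powr lf (card C))"
    by (simp add: lf_eq)
  also have "\<dots> = 2 powr V lf Q" by (simp add: V_def powr_sum)
  finally show ?thesis .
qed

lemma log_card_St_ge: assumes "Q \<subseteq> Om" shows "V lf Q \<le> log 2 (card (St Q))"
proof -
  have "card (Fx Q) \<le> card (St Q)" by (rule card_mono[OF finite_perm_group[OF perm_group_St finite_X] Fx_subset_St])
  then have "2 powr V lf Q \<le> real (card (St Q))" using card_Fx[OF assms] by linarith
  moreover have "real (card (St Q)) > 0" using card_perm_group_pos[OF perm_group_St finite_X] by simp
  ultimately show ?thesis by (simp add: le_log_iff)
qed

text \<open>A substitute for the logarithm of a floor: the jumps of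
  \<open>log 2 (1 + y div k)\<close> would break the antitonicity shown in
  \<open>u_step_mono\<close>, while truncating the quotient at 1 still makes \<open>u s\<close>
  vanish up to k^s.\<close>

definition u :: "nat \<Rightarrow> nat \<Rightarrow> real" where "u s y = log 2 (max 1 (real y / real k ^ s))"
definition U :: "nat \<Rightarrow> nat \<Rightarrow> real" where "U s c = (\<Sum>y<c. u s y)"

text \<open>Convexity of the log-factorial: no partition splits a cell more cheaply than an even
  splitting does.\<close>

lemma V_wbal_le: assumes "Q \<subseteq> Om" "P \<in> Om" shows "V wbal Q \<le> V lf (insert P Q)"
proof -
  have "wbal (card C) \<le> (\<Sum>B\<in>P. lf (card (C \<inter> B)))" if "C \<in> cells Q" for C
  proof -
    have "(\<Sum>B\<in>P. \<Sum>y<card (C \<inter> B). - log 2 (1 + real y)) \<le> (\<Sum>y<card C. - log 2 (1 + real (y div k)))"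
      by (rule concave_split_le_balanced[where \<gamma> = "\<lambda>y. - log 2 (1 + real y)"])
        (use OmD[OF assms(2)] k2 sum_card_Int_parts[OF assms(2) in_cells_subset[OF that]] in auto)
    then show ?thesis by (simp add: wbal_def lf_def sum_negf)
  qed
  then show ?thesis
    using V_insert[OF assms, of lf] by (simp add: V_def lf_def sum_mono)
qed

text \<open>For y \<ge> 1, \<open>u s\<close> gains at most log2 ((y + 1) / y) per step and twice
  the logarithm gains 2 log2 ((y + 2) / (y + 1)), so (1 + y)^3 \<le> y (2 + y)^2 suffices. With
  coefficient 1 it would be (1 + y)^2 \<le> y (2 + y), which is false; hence the factor 2 in
  \<open>V_U_step\<close>.\<close>

lemma u_step_mono:
  assumes "x \<le> y" shows "u s y - 2 * log 2 (1 + real y) \<le> u s x - 2 * log 2 (1 + real x)"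
proof -
  have step: "u s (Suc y) - 2 * log 2 (1 + real (Suc y)) \<le> u s y - 2 * log 2 (1 + real y)" for y
  proof -
    define K where "K = real k ^ s"
    have K1: "K \<ge> 1" unfolding K_def using k2 by simp
    have "max 1 (real (Suc y) / K) * (1 + real y)\<^sup>2 \<le> max 1 (real y / K) * (1 + real (Suc y))\<^sup>2"
    proof (cases "real (Suc y) / K \<le> 1")
      case True
      have "1 * (1 + real y)\<^sup>2 \<le> max 1 (real y / K) * (1 + real (Suc y))\<^sup>2"
        by (intro mult_mono power_mono) auto
      then show ?thesis using max_absorb1[OF True] by simp
    next
      case False
      have y1: "y \<ge> 1" using False K1 by (cases y) auto
      have "real (Suc y) / K \<le> (real (Suc y) / real y) * max 1 (real y / K)"
      proof (cases "real y / K \<le> 1")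
        case True
        then have "real y \<le> K" using K1 by (simp add: divide_le_eq)
        then have "real (Suc y) / K \<le> real (Suc y) / real y" using y1 by (intro divide_left_mono) auto
        then show ?thesis using True by (simp add: max_def)
      next
        case False
        then show ?thesis using y1 K1 by (simp add: max_def)
      qed
      then have "real (Suc y) / K * (1 + real y)\<^sup>2 \<le> (real (Suc y) / real y) * max 1 (real y / K) * (1 + real y)\<^sup>2"
        by (intro mult_right_mono) auto
      also have "\<dots> = max 1 (real y / K) * ((real (Suc y) / real y) * (1 + real y)\<^sup>2)" by simp
      also have "\<dots> \<le> max 1 (real y / K) * (1 + real (Suc y))\<^sup>2"
      proof (intro mult_left_mono)
        have "1 \<le> real y" using y1 by simp
        then have "(1 + real y)^3 \<le> real y * (2 + real y)\<^sup>2"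
          using mult_mono[of 1 "real y" 1 "real y"] by (simp add: power3_eq_cube power2_eq_square algebra_simps)
        then have "(1 + real y) ^ 3 / real y \<le> (2 + real y)\<^sup>2" using y1 by (simp add: divide_le_eq mult.commute)
        moreover have "(real (Suc y) / real y) * (1 + real y)\<^sup>2 = (1 + real y) ^ 3 / real y" by (simp add: power3_eq_cube power2_eq_square)
        ultimately show "(real (Suc y) / real y) * (1 + real y)\<^sup>2 \<le> (1 + real (Suc y))\<^sup>2"
          by (metis (no_types, lifting) add.assoc add.commute of_nat_Suc one_add_one)
      qed auto
      finally show ?thesis using False by (simp add: max_def)
    qed
    then have "log 2 (max 1 (real (Suc y) / K) * (1 + real y)\<^sup>2) \<le> log 2 (max 1 (real y / K) * (1 + real (Suc y))\<^sup>2)"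
      by (intro log2_mono) (auto intro!: mult_pos_pos)
    then show ?thesis unfolding u_def K_def[symmetric]
      by (subst (asm) (1 2) log_mult_pos) (auto simp: log_nat_power max_def split: if_splits)
  qed
  show ?thesis by (rule lift_Suc_antimono_le[where f = "\<lambda>y. u s y - 2 * log 2 (1 + real y)", OF step assms])
qed

lemma u_div_le: "u s (y div k) \<le> u (Suc s) y"
proof -
  have "real (y div k) / real k ^ s \<le> real y / real k / real k ^ s"
    by (intro divide_right_mono of_nat_div_le_of_nat) auto
  also have "\<dots> = real y / real k ^ Suc s" by simp
  finally show ?thesis unfolding u_def by (intro log2_mono) auto
qed

text \<open>The weight \<^term>\<open>U s\<close> majorizes the logarithm of the stabilizer that would survive \<open>s\<close> further
  perfectly balanced refinements.  A refinement that is not balanced loses at most twice its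
  deficit, because \<open>u s y - 2 log (1 + y)\<close> is antitone.\<close>

lemma V_U_step:
  assumes "Q \<subseteq> Om" "P \<in> Om"
  shows "V (U s) (insert P Q) \<le> V (U (Suc s)) Q + 2 * (V lf (insert P Q) - V wbal Q)"
proof -
  let ?\<gamma> = "\<lambda>y. u s y - 2 * log 2 (1 + real y)"
  have "(\<Sum>B\<in>P. U s (card (C \<inter> B)) - 2 * lf (card (C \<inter> B))) \<le> U (Suc s) (card C) - 2 * wbal (card C)"
    if "C \<in> cells Q" for C
  proof -
    have "(\<Sum>B\<in>P. \<Sum>y<card (C \<inter> B). ?\<gamma> y) \<le> (\<Sum>y<card C. ?\<gamma> (y div k))"
      by (rule concave_split_le_balanced[where \<gamma> = ?\<gamma>])
        (use OmD[OF assms(2)] k2 sum_card_Int_parts[OF assms(2) in_cells_subset[OF that]] u_step_mono in auto)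
    also have "\<dots> \<le> (\<Sum>y<card C. u (Suc s) y - 2 * log 2 (1 + real (y div k)))"
      by (intro sum_mono diff_right_mono u_div_le)
    finally show ?thesis by (simp add: U_def lf_def wbal_def sum_subtractf sum_distrib_left)
  qed
  then have "(\<Sum>C\<in>cells Q. \<Sum>B\<in>P. U s (card (C \<inter> B)) - 2 * lf (card (C \<inter> B))) \<le>
      (\<Sum>C\<in>cells Q. U (Suc s) (card C) - 2 * wbal (card C))" by (rule sum_mono)
  moreover have "(\<Sum>C\<in>cells Q. \<Sum>B\<in>P. U s (card (C \<inter> B)) - 2 * lf (card (C \<inter> B))) =
      V (\<lambda>c. U s c - 2 * lf c) (insert P Q)"
    by (rule V_insert[OF assms, symmetric]) (simp add: U_def lf_def)
  ultimately show ?thesis by (simp add: V_def sum_subtractf sum_distrib_left)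
qed

lemma wbal_le_U0: "wbal c \<le> U 0 c"
proof -
  have "1 + real (y div k) \<le> max 1 (real y)" for y
  proof (cases "y < 2")
    case True then have "y div k = 0" using k2 by auto
    then show ?thesis by simp
  next
    case False
    have "y div k \<le> y div 2" using k2 by (intro div_le_mono2) auto
    also have "\<dots> \<le> y - 1" using False by auto
    finally show ?thesis using False by auto
  qed
  then show ?thesis unfolding wbal_def U_def u_def
    by (intro sum_mono log2_mono) auto
qed

lemma U_eq_0: "c \<le> k ^ s \<Longrightarrow> U s c = 0"
proof -
  assume c: "c \<le> k ^ s"
  have "max 1 (real y / real k ^ s) = 1" if "y < c" for y
  proof -
    have "real y \<le> real (k ^ s)" using c that by (simp del: of_nat_power)
    then show ?thesis using k2 by (simp add: max_def divide_le_eq)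
  qed
  then show ?thesis unfolding U_def u_def by simp
qed

lemma wbal_eq_0: "c \<le> k \<Longrightarrow> wbal c = 0"
  unfolding wbal_def by (intro sum.neutral) auto

lemma lf_nonneg: "lf c \<ge> 0" unfolding lf_def by (intro sum_nonneg) simp
lemma wbal_nonneg: "wbal c \<ge> 0" unfolding wbal_def by (intro sum_nonneg) simp

end

section \<open>Colourings\<close>

lemma rank_bij:
  fixes key :: "'a \<Rightarrow> nat"
  assumes "finite A" "inj_on key A"
  shows "bij_betw (\<lambda>x. card {y \<in> A. key y < key x}) A {..<card A}"
proof -
  let ?r = "\<lambda>x. card {y \<in> A. key y < key x}"
  have mono: "?r x < ?r y" if "x \<in> A" "y \<in> A" "key x < key y" for x y
    by (rule psubset_card_mono) (use assms that in auto)
  have inj: "inj_on ?r A"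
  proof (rule inj_onI)
    fix x y assume "x \<in> A" "y \<in> A" "?r x = ?r y"
    then show "x = y" using mono[of x y] mono[of y x] assms(2) by (metis inj_onD linorder_neqE_nat nat_less_le)
  qed
  have "?r x < card A" if "x \<in> A" for x
    by (rule psubset_card_mono) (use assms that in auto)
  then have "?r ` A \<subseteq> {..<card A}" by auto
  moreover have "card (?r ` A) = card {..<card A}" using inj by (simp add: card_image)
  ultimately have "?r ` A = {..<card A}" using card_subset_eq by blast
  then show ?thesis using inj by (simp add: bij_betw_def)
qed

text \<open>By convexity every element of \<open>A\<close> outside \<open>C\<close> has its key
  below all of \<open>C\<close> or above all of \<open>C\<close>; the interval starts at the number
  of the former.\<close>

lemma rank_convex:
  fixes key :: "'a \<Rightarrow> nat"
  assumes A: "finite A" "inj_on key A" and C: "C \<subseteq> A"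
    and conv: "\<And>x y z. x \<in> C \<Longrightarrow> z \<in> C \<Longrightarrow> y \<in> A \<Longrightarrow> key x < key y \<Longrightarrow> key y < key z \<Longrightarrow> y \<in> C"
  shows "\<exists>r. (\<lambda>x. card {y \<in> A. key y < key x}) ` C = {r..<r + card C}"
proof -
  define r where "r = card {y \<in> A - C. \<forall>c\<in>C. key y < key c}"
  have eq: "card {y \<in> A. key y < key x} = r + card {y \<in> C. key y < key x}" if x: "x \<in> C" for x
  proof -
    have "{y \<in> A - C. key y < key x} = {y \<in> A - C. \<forall>c\<in>C. key y < key c}"
    proof (intro equalityI subsetI)
      fix y assume y: "y \<in> {y \<in> A - C. key y < key x}"
      have "key y < key c" if "c \<in> C" for c
      proof (rule ccontr)
        assume "\<not> key y < key c"
        moreover have "key y \<noteq> key c" using y that C A(2) by (auto dest: inj_onD)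
        ultimately have "key c < key y" by simp
        then show False using conv[OF that x, of y] y by auto
      qed
      then show "y \<in> {y \<in> A - C. \<forall>c\<in>C. key y < key c}" using y by auto
    qed (use x in auto)
    moreover have "{y \<in> A. key y < key x} = {y \<in> A - C. key y < key x} \<union> {y \<in> C. key y < key x}" using C by auto
    moreover have "card ({y \<in> A - C. key y < key x} \<union> {y \<in> C. key y < key x}) =
        card {y \<in> A - C. key y < key x} + card {y \<in> C. key y < key x}"
      by (rule card_Un_disjoint) (use A(1) finite_subset[OF C A(1)] in auto)
    ultimately show ?thesis by (simp add: r_def)
  qed
  have "(\<lambda>x. card {y \<in> C. key y < key x}) ` C = {..<card C}"
    by (rule bij_betw_imp_surj_on[OF rank_bij[OF finite_subset[OF C A(1)] inj_on_subset[OF A(2) C]]])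
  then have "(\<lambda>x. r + card {y \<in> C. key y < key x}) ` C = (+) r ` {..<card C}" by (metis image_image)
  also have "(+) r ` {..<card C} = {r..<r + card C}"
    unfolding lessThan_atLeast0 by (simp only: image_add_atLeastLessThan add.commute add_0)
  finally have "(\<lambda>x. card {y \<in> A. key y < key x}) ` C = {r..<r + card C}" using eq by simp
  then show ?thesis by blast
qed

text \<open>Level sets of \<open>key\<close> receive consecutive positions. With a key that
  identifies cells, every cell becomes an interval, and colouring by position modulo
  \<open>k\<close> splits an interval evenly.\<close>

lemma contiguous_enumeration:
  fixes A :: "nat set" and key :: "nat \<Rightarrow> nat"
  assumes "finite A"
  shows "\<exists>pos. bij_betw pos A {..<card A} \<and> (\<forall>v. \<exists>r. pos ` {x \<in> A. key x = v} = {r..<r + card {x \<in> A. key x = v}}) \<and>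
    (\<forall>x\<in>A. \<forall>y\<in>A. key x < key y \<longrightarrow> pos x < pos y)"
proof -
  define N where "N = Suc (Max (insert 0 A))"
  \<comment> \<open>\<open>N\<close> exceeds every element of \<open>A\<close>, so
    \<open>\<kappa>\<close> orders by \<open>key\<close> first and breaks ties by the element
    itself.\<close>
  define \<kappa> where "\<kappa> x = key x * N + x" for x
  have lt: "x < N" if "x \<in> A" for x using that assms by (simp add: N_def less_Suc_eq_le)
  have mono: "\<kappa> x < \<kappa> y" if "x \<in> A" "key x < key y" for x y
  proof -
    have "\<kappa> x < Suc (key x) * N" using lt[OF that(1)] by (simp add: \<kappa>_def)
    also have "\<dots> \<le> key y * N" using that(2) by (intro mult_le_mono1) simp
    finally show ?thesis by (simp add: \<kappa>_def)
  qed
  have inj: "inj_on \<kappa> A"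
  proof (rule inj_onI)
    fix x y assume xy: "x \<in> A" "y \<in> A" "\<kappa> x = \<kappa> y"
    then have "key x = key y" using mono[of x y] mono[of y x] by (metis less_irrefl linorder_neqE_nat)
    then show "x = y" using xy(3) by (simp add: \<kappa>_def)
  qed
  define pos where "pos x = card {y \<in> A. \<kappa> y < \<kappa> x}" for x
  have "\<exists>r. pos ` {x \<in> A. key x = v} = {r..<r + card {x \<in> A. key x = v}}" for v
    unfolding pos_def
  proof (rule rank_convex[OF assms inj])
    fix x y z assume "x \<in> {x \<in> A. key x = v}" "z \<in> {x \<in> A. key x = v}" "y \<in> A" "\<kappa> x < \<kappa> y" "\<kappa> y < \<kappa> z"
    then show "y \<in> {x \<in> A. key x = v}" using mono[of y x] mono[of z y]
      by simp (metis less_asym linorder_neqE_nat)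
  qed auto
  moreover have "bij_betw pos A {..<card A}" unfolding pos_def by (rule rank_bij[OF assms inj])
  moreover have "pos x < pos y" if "x \<in> A" "y \<in> A" "key x < key y" for x y
    unfolding pos_def by (rule psubset_card_mono) (use assms that mono[of x y] in auto)
  ultimately show ?thesis by blast
qed

lemma card_residue_below: "0 < k \<Longrightarrow> card {y. y < c \<and> y mod k = c mod k} = c div (k :: nat)"
proof -
  assume k: "0 < k"
  have "{y. y < c \<and> y mod k = c mod k} = (\<lambda>i. c mod k + i * k) ` {..<c div k}"
  proof (intro equalityI subsetI)
    fix y assume y: "y \<in> {y. y < c \<and> y mod k = c mod k}"
    have "y div k < c div k"
    proof (rule ccontr)
      assume "\<not> ?thesis"
      then have "c div k * k \<le> y div k * k" by (intro mult_le_mono1) simp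
      moreover have "y < c" "y mod k = c mod k" using y by auto
      ultimately show False using div_mult_mod_eq[of c k] div_mult_mod_eq[of y k] by linarith
    qed
    moreover have "y mod k = c mod k" using y by simp
    then have "y = c mod k + (y div k) * k" using div_mult_mod_eq[of y k] by linarith
    ultimately show "y \<in> (\<lambda>i. c mod k + i * k) ` {..<c div k}" by blast
  next
    fix y assume "y \<in> (\<lambda>i. c mod k + i * k) ` {..<c div k}"
    then obtain i where i: "i < c div k" "y = c mod k + i * k" by auto
    have "i * k < c div k * k" using i k by simp
    then have "y < c" using i div_mult_mod_eq[of c k] by linarith
    then show "y \<in> {y. y < c \<and> y mod k = c mod k}" using i by simp
  qed
  moreover have "inj_on (\<lambda>i. c mod k + i * k) {..<c div k}" using k by (auto simp: inj_on_def)
  ultimately show ?thesis by (simp add: card_image)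
qed

lemma add_mod_eq_iff: "(w + y) mod k = (w + z) mod k \<longleftrightarrow> y mod k = z mod (k :: nat)"
proof
  assume "(w + y) mod k = (w + z) mod k"
  then have "int (w + y) mod int k = int (w + z) mod int k" by (simp only: zmod_int[symmetric])
  then have "(int (w + y) - int w) mod int k = (int (w + z) - int w) mod int k" by (rule mod_diff_cong) simp
  then have "int y mod int k = int z mod int k" by simp
  then show "y mod k = z mod k" by (simp only: zmod_int[symmetric] of_nat_eq_iff)
next
  assume "y mod k = z mod k" then show "(w + y) mod k = (w + z) mod k" by (rule mod_add_cong[OF refl])
qed

lemma card_residue_bounds:
  assumes "0 < k" "s < (k::nat)"
  shows "c div k \<le> card {y. y < c \<and> (w + y) mod k = s}" "card {y. y < c \<and> (w + y) mod k = s} \<le> c div k + 1"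
proof -
  let ?S = "{y. y < c \<and> (w + y) mod k = s}"
  have fin: "finite ?S" by (rule finite_subset[of _ "{..<c}"]) auto
  have "inj_on (\<lambda>y. y div k) ?S"
  proof (rule inj_onI)
    fix y z assume yz: "y \<in> ?S" "z \<in> ?S" "y div k = z div k"
    then have "y mod k = z mod k" by (metis (mono_tags, lifting) add_mod_eq_iff mem_Collect_eq)
    then show "y = z" using yz(3) by (metis div_mult_mod_eq)
  qed
  moreover have "(\<lambda>y. y div k) ` ?S \<subseteq> {..c div k}" by (auto intro: div_le_mono)
  ultimately have "card ?S \<le> card {..c div k}" by (rule card_inj_on_le) auto
  then show "card ?S \<le> c div k + 1" by simp
  define d where "d = (s + (k - w mod k)) mod k"
  have d: "(w + (i * k + d)) mod k = s" for i
  proof -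
    have "(w + (i * k + d)) mod k = ((w + d) + i * k) mod k" by (simp add: ac_simps)
    also have "\<dots> = (w + d) mod k" by (rule mod_mult_self1)
    also have "\<dots> = (w mod k + (s + (k - w mod k))) mod k" unfolding d_def by (simp only: mod_add_right_eq mod_add_left_eq)
    also have "w mod k + (s + (k - w mod k)) = s + k" using mod_less_divisor[OF assms(1), of w] by linarith
    finally show ?thesis using assms by simp
  qed
  have dk: "d < k" using assms by (simp add: d_def)
  have "{..<c div k} \<subseteq> (\<lambda>y. y div k) ` ?S"
  proof
    fix i assume "i \<in> {..<c div k}"
    then have "Suc i * k \<le> c div k * k" by (intro mult_le_mono1) auto
    also have "\<dots> \<le> c" by simp
    finally have "i * k + d < c" using dk by simp
    then show "i \<in> (\<lambda>y. y div k) ` ?S" using d[of i] dk by (intro image_eqI[of _ _ "i * k + d"]) auto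
  qed
  then have "card {..<c div k} \<le> card ((\<lambda>y. y div k) ` ?S)" using fin by (intro card_mono) auto
  also have "\<dots> \<le> card ?S" by (rule card_image_le[OF fin])
  finally show "c div k \<le> card ?S" by simp
qed

section \<open>Colour classes as partitions\<close>

context kl_parts
begin

text \<open>Point c joins a class that already holds \<open>c div k\<close> earlier points, whatever
  the offset \<open>w\<close>; it adds log2 (1 + c div k), the increment of
  \<open>wbal\<close>.\<close>

lemma sum_lf_residues: "(\<Sum>s<k. lf (card {y. y < c \<and> (w + y) mod k = s})) = wbal c"
proof (induction c)
  case 0 then show ?case by (simp add: lf_def wbal_def)
next
  case (Suc c)
  have k0: "0 < k" using k2 by simp
  let ?s0 = "(w + c) mod k"
  let ?a = "\<lambda>s. card {y. y < c \<and> (w + y) mod k = s}"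
  have cnt: "?a ?s0 = c div k" using card_residue_below[OF k0, of c] by (simp add: add_mod_eq_iff)
  have "card {y. y < Suc c \<and> (w + y) mod k = s} = (if s = ?s0 then Suc (?a s) else ?a s)" for s
  proof (cases "s = ?s0")
    case True
    have "{y. y < Suc c \<and> (w + y) mod k = s} = insert c {y. y < c \<and> (w + y) mod k = s}"
      using True by (auto simp: less_Suc_eq)
    moreover have "finite {y. y < c \<and> (w + y) mod k = s}" by (rule finite_subset[of _ "{..<c}"]) auto
    ultimately show ?thesis using True by simp
  next
    case False
    then have "{y. y < Suc c \<and> (w + y) mod k = s} = {y. y < c \<and> (w + y) mod k = s}" by (auto simp: less_Suc_eq)
    then show ?thesis using False by simp
  qed
  then have "(\<Sum>s<k. lf (card {y. y < Suc c \<and> (w + y) mod k = s})) =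
      (\<Sum>s<k. lf (?a s) + (if s = ?s0 then log 2 (1 + real (?a s)) else 0))"
    by (intro sum.cong) (auto simp: lf_def)
  also have "\<dots> = wbal c + log 2 (1 + real (c div k))"
    using Suc.IH cnt k0 by (simp add: sum.distrib sum.delta)
  finally show ?case by (simp add: wbal_def)
qed

definition cls :: "(nat \<Rightarrow> nat) \<Rightarrow> nat \<Rightarrow> nat set" where "cls \<phi> s = {x \<in> X. \<phi> x = s}"
definition Pcol :: "(nat \<Rightarrow> nat) \<Rightarrow> nat set set" where "Pcol \<phi> = cls \<phi> ` {..<k}"

definition colouring :: "(nat \<Rightarrow> nat) \<Rightarrow> bool" where
  "colouring \<phi> \<longleftrightarrow> (\<forall>x\<in>X. \<phi> x < k) \<and> (\<forall>s<k. card (cls \<phi> s) = l)"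

lemma inj_cls: assumes "colouring \<phi>" shows "inj_on (cls \<phi>) {..<k}"
proof (rule inj_onI)
  fix s t assume st: "s \<in> {..<k}" "t \<in> {..<k}" "cls \<phi> s = cls \<phi> t"
  have "cls \<phi> s \<noteq> {}" using assms st l2 by (metis card.empty colouring_def lessThan_iff not_numeral_le_zero)
  then show "s = t" using st by (auto simp: cls_def)
qed

lemma Pcol_in_Om: assumes "colouring \<phi>" shows "Pcol \<phi> \<in> Om"
proof -
  have "cls \<phi> s \<noteq> {}" if "s < k" for s
    using assms that l2 by (metis card.empty colouring_def not_numeral_le_zero)
  then have "partition_on X (Pcol \<phi>)"
    using assms unfolding partition_on_def Pcol_def disjoint_def colouring_def by (auto simp: cls_def)
  moreover have "card (Pcol \<phi>) = k" using inj_cls[OF assms] by (simp add: Pcol_def card_image)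
  moreover have "\<forall>B\<in>Pcol \<phi>. card B = l" using assms by (auto simp: Pcol_def colouring_def)
  ultimately show ?thesis by (simp add: Pi_kl_def X_def)
qed

lemma sum_Pcol: "colouring \<phi> \<Longrightarrow> (\<Sum>B\<in>Pcol \<phi>. g B) = (\<Sum>s<k. g (cls \<phi> s))"
  unfolding Pcol_def by (subst sum.reindex[OF inj_cls]) auto

lemma V_insert_Pcol:
  assumes "Q \<subseteq> Om" "colouring \<phi>" "w 0 = 0"
  shows "V w (insert (Pcol \<phi>) Q) = (\<Sum>C\<in>cells Q. \<Sum>s<k. w (card (C \<inter> cls \<phi> s)))"
  using V_insert[of Q "Pcol \<phi>" w, OF assms(1) Pcol_in_Om[OF assms(2)] assms(3)] by (simp add: sum_Pcol[OF assms(2)])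

lemma sum_lf_interval:
  assumes "inj_on pos C" "pos ` C = {r..<r + card C}" "\<And>x. x \<in> C \<Longrightarrow> \<phi> x = (w + pos x) mod k" "C \<subseteq> X"
  shows "card (C \<inter> cls \<phi> s) = card {y. y < card C \<and> (w + r + y) mod k = s}"
    "(\<Sum>s<k. lf (card (C \<inter> cls \<phi> s))) = wbal (card C)"
proof -
  have 1: "card (C \<inter> cls \<phi> s) = card {y. y < card C \<and> (w + r + y) mod k = s}" for s
  proof -
    have "bij_betw (\<lambda>x. pos x - r) (C \<inter> cls \<phi> s) {y. y < card C \<and> (w + r + y) mod k = s}"
    proof (rule bij_betw_imageI)
      have ge: "pos x \<in> {r..<r + card C}" if "x \<in> C" for x using assms(2) that by blast
      show "inj_on (\<lambda>x. pos x - r) (C \<inter> cls \<phi> s)"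
      proof (rule inj_onI)
        fix x y assume xy: "x \<in> C \<inter> cls \<phi> s" "y \<in> C \<inter> cls \<phi> s" "pos x - r = pos y - r"
        then have "pos x = pos y" using ge[of x] ge[of y] by auto
        then show "x = y" using xy assms(1) by (auto dest: inj_onD)
      qed
      show "(\<lambda>x. pos x - r) ` (C \<inter> cls \<phi> s) = {y. y < card C \<and> (w + r + y) mod k = s}"
      proof (intro equalityI subsetI)
        fix y assume "y \<in> (\<lambda>x. pos x - r) ` (C \<inter> cls \<phi> s)"
        then obtain x where x: "x \<in> C" "\<phi> x = s" "y = pos x - r" by (auto simp: cls_def)
        then show "y \<in> {y. y < card C \<and> (w + r + y) mod k = s}" using ge[of x] assms(3)[of x] by auto
      next
        fix y assume y: "y \<in> {y. y < card C \<and> (w + r + y) mod k = s}"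
        then have "r + y \<in> pos ` C" using assms(2) by simp
        then obtain x where x: "x \<in> C" "pos x = r + y" by auto
        then have "x \<in> C \<inter> cls \<phi> s" using y assms(3)[of x] assms(4) by (auto simp: cls_def add.assoc)
        then show "y \<in> (\<lambda>x. pos x - r) ` (C \<inter> cls \<phi> s)" using x by (intro image_eqI[of _ _ x]) auto
      qed
    qed
    then show ?thesis by (rule bij_betw_same_card)
  qed
  then show "card (C \<inter> cls \<phi> s) = card {y. y < card C \<and> (w + r + y) mod k = s}" .
  show "(\<Sum>s<k. lf (card (C \<inter> cls \<phi> s))) = wbal (card C)" using sum_lf_residues[of "card C" "w + r"] by (simp add: 1)
qed

text \<open>Arranges \<open>X\<close> as a \<open>k\<close> by \<open>l\<close> array with the parts
  of \<open>P\<close> as rows and every cell of \<open>Q\<close> an interval within one row.\<close>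

lemma rows:
  assumes PQ: "P \<in> Q" "Q \<subseteq> Om"
  obtains A pos idx where "bij_betw A {..<k} P" "\<And>i. i < k \<Longrightarrow> bij_betw pos (A i) {..<l}"
    "\<And>C. C \<in> cells Q \<Longrightarrow> inj_on pos C \<and> (\<exists>r. pos ` C = {r..<r + card C})"
    "\<And>x. x \<in> X \<Longrightarrow> idx x < k \<and> x \<in> A (idx x)" "\<And>i x. i < k \<Longrightarrow> x \<in> A i \<Longrightarrow> idx x = i \<and> x \<in> X"
    "\<And>C. C \<in> cells Q \<Longrightarrow> \<exists>i<k. C \<subseteq> A i"
proof -
  have P: "P \<in> Om" using PQ by auto
  obtain A where A: "bij_betw A {..<k} P" using ex_bij_betw_nat_finite[OF OmD(4)[OF P]] OmD(2)[OF P] by (auto simp: lessThan_atLeast0)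
  define idx where "idx x = the_inv_into {..<k} A (same_part P x)" for x
  have idx1: "idx x < k \<and> A (idx x) = same_part P x" if "x \<in> X" for x
  proof -
    have "same_part P x \<in> A ` {..<k}" using A same_part_in[OF P that] by (simp add: bij_betw_def)
    then show ?thesis unfolding idx_def using A
      by (metis bij_betw_def f_the_inv_into_f lessThan_iff order_refl the_inv_into_into)
  qed
  have idx2: "idx x = i \<and> x \<in> X" if "i < k" "x \<in> A i" for i x
  proof -
    have "A i \<in> P" using A that by (auto simp: bij_betw_def)
    then have "same_part P x = A i" "x \<in> X" using same_part_eq[OF P] OmD(6)[OF P] that by blast+
    then show ?thesis unfolding idx_def using A that by (simp add: bij_betw_def the_inv_into_f_f)
  qed
  \<comment> \<open>Cells are disjoint, so their least elements identify them.\<close>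
  define key where "key x = Min (cell Q x)" for x
  have ex: "\<forall>B. \<exists>pos. finite B \<longrightarrow> (bij_betw pos B {..<card B} \<and>
      (\<forall>v. \<exists>r. pos ` {x \<in> B. key x = v} = {r..<r + card {x \<in> B. key x = v}}))"
  proof
    fix B :: "nat set"
    show "\<exists>pos. finite B \<longrightarrow> (bij_betw pos B {..<card B} \<and>
      (\<forall>v. \<exists>r. pos ` {x \<in> B. key x = v} = {r..<r + card {x \<in> B. key x = v}}))"
    proof (cases "finite B")
      case True
      from contiguous_enumeration[OF True, of key] show ?thesis by (elim exE conjE) (intro exI impI conjI)
    qed simp
  qed
  obtain f where f': "\<forall>B. finite B \<longrightarrow> (bij_betw (f B) B {..<card B} \<and>
      (\<forall>v. \<exists>r. f B ` {x \<in> B. key x = v} = {r..<r + card {x \<in> B. key x = v}}))"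
    using choice[OF ex] by (elim exE)
  have f: "bij_betw (f B) B {..<card B}"
      "\<exists>r. f B ` {x \<in> B. key x = v} = {r..<r + card {x \<in> B. key x = v}}" if "finite B" for B v
    using f'[rule_format, OF that] by simp_all
  define pos where "pos x = f (same_part P x) x" for x
  have pos: "pos x = f B x" if "B \<in> P" "x \<in> B" for B x using same_part_eq[OF P that] by (simp add: pos_def)
  have b: "bij_betw pos B {..<l}" if "B \<in> P" for B
    using f(1)[of B] OmD(3,5)[OF P that] bij_betw_cong[of B pos "f B"] pos[OF that] by simp
  have c: "\<exists>i<k. C \<subseteq> A i" and c2: "inj_on pos C \<and> (\<exists>r. pos ` C = {r..<r + card C})" if C: "C \<in> cells Q" for C
  proof -
    obtain x where x: "x \<in> X" "C = cell Q x" using C by (auto simp: cells_def)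
    let ?B = "same_part P x"
    have B: "?B \<in> P" "C \<subseteq> ?B" using same_part_in[OF P x(1)] cell_subset_part[OF PQ(1)] x by auto
    have bX: "?B \<subseteq> X" using OmD(6)[OF P B(1)] .
    show "\<exists>i<k. C \<subseteq> A i" using idx1[OF x(1)] B by metis
    have "C = {y \<in> ?B. key y = key x}"
    proof (intro equalityI subsetI)
      fix y assume "y \<in> C" then show "y \<in> {y \<in> ?B. key y = key x}"
        using B x cell_eq[OF PQ(2) x(1), of y] by (auto simp: key_def)
    next
      fix y assume y: "y \<in> {y \<in> ?B. key y = key x}"
      then have yX: "y \<in> X" using bX by auto
      have "Min (cell Q y) \<in> cell Q y" "Min (cell Q x) \<in> cell Q x"
        using finite_cell mem_cell[OF PQ(2)] yX x by (metis Min_in empty_iff)+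
      then have "cell Q y = cell Q x" using y cell_eq[OF PQ(2)] yX x by (metis (mono_tags, lifting) key_def mem_Collect_eq)
      then show "y \<in> C" using mem_cell[OF PQ(2) yX] x by simp
    qed
    then obtain r where "f ?B ` C = {r..<r + card C}" using f(2)[OF OmD(5)[OF P B(1)], of "key x"] by auto
    moreover have "pos ` C = f ?B ` C" using pos[OF B(1)] B(2) by (intro image_cong) auto
    moreover have "inj_on pos C" using b[OF B(1)] B(2) by (meson bij_betw_def inj_on_subset)
    ultimately show "inj_on pos C \<and> (\<exists>r. pos ` C = {r..<r + card C})" by auto
  qed
  show ?thesis
  proof (rule that[OF A _ c2 _ idx2 c])
    show "bij_betw pos (A i) {..<l}" if "i < k" for i using b A that by (auto simp: bij_betw_def)
    show "idx x < k \<and> x \<in> A (idx x)" if "x \<in> X" for x using idx1[OF that] same_part_in[OF P that] by simp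
  qed auto
qed

end

text \<open>A colouring of the rows \<open>A 0, \<dots>, A (k-1)\<close> of a partition in which the points of a given
  position receive pairwise distinct colours, so that all colour classes have the same size.\<close>

locale row_colouring = kl_parts +
  fixes P :: "nat set set" and A :: "nat \<Rightarrow> nat set" and pos idx :: "nat \<Rightarrow> nat" and \<kappa> :: "nat \<Rightarrow> nat \<Rightarrow> nat"
  assumes P: "P \<in> Pi_kl k l" and A: "bij_betw A {..<k} P" and pos: "\<And>i. i < k \<Longrightarrow> bij_betw pos (A i) {..<l}"
    and idx1: "\<And>x. x \<in> X \<Longrightarrow> idx x < k \<and> x \<in> A (idx x)" and idx2: "\<And>i x. i < k \<Longrightarrow> x \<in> A i \<Longrightarrow> idx x = i \<and> x \<in> X"
    and \<kappa>: "\<And>t. t < l \<Longrightarrow> bij_betw (\<kappa> t) {..<k} {..<k}"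
begin

definition \<phi> :: "nat \<Rightarrow> nat" where "\<phi> x = \<kappa> (pos x) (idx x)"
text \<open>The intersection matrix of rows and classes (see \<open>card_A_cls\<close>), computed
  from positions alone.\<close>

definition N :: "nat \<Rightarrow> nat \<Rightarrow> nat" where "N i s = card {t. t < l \<and> \<kappa> t i = s}"

lemma A_in: "i < k \<Longrightarrow> A i \<in> P" using A by (auto simp: bij_betw_def)
lemma A_inj: "i < k \<Longrightarrow> j < k \<Longrightarrow> A i = A j \<Longrightarrow> i = j" using A by (auto simp: bij_betw_def inj_on_def)
lemma A_ex: "B \<in> P \<Longrightarrow> \<exists>i<k. B = A i" using A by (auto simp: bij_betw_def)

lemma pos_lt: "i < k \<Longrightarrow> x \<in> A i \<Longrightarrow> pos x < l" using pos[of i] by (auto simp: bij_betw_def)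

lemma card_A_cls: assumes i: "i < k" shows "card (A i \<inter> cls \<phi> s) = N i s"
proof -
  have "bij_betw pos (A i \<inter> cls \<phi> s) {t. t < l \<and> \<kappa> t i = s}"
  proof (rule bij_betw_imageI)
    show "inj_on pos (A i \<inter> cls \<phi> s)" using pos[OF i] by (auto simp: bij_betw_def intro: inj_on_subset)
    show "pos ` (A i \<inter> cls \<phi> s) = {t. t < l \<and> \<kappa> t i = s}"
    proof (intro equalityI subsetI)
      fix t assume "t \<in> pos ` (A i \<inter> cls \<phi> s)"
      then show "t \<in> {t. t < l \<and> \<kappa> t i = s}" using idx2[OF i] pos_lt[OF i] by (auto simp: cls_def \<phi>_def)
    next
      fix t assume t: "t \<in> {t. t < l \<and> \<kappa> t i = s}"
      then have "t \<in> pos ` A i" using pos[OF i] by (simp add: bij_betw_def)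
      then obtain x where x: "x \<in> A i" "pos x = t" by auto
      then have "x \<in> cls \<phi> s" using t idx2[OF i x(1)] by (auto simp: cls_def \<phi>_def)
      then show "t \<in> pos ` (A i \<inter> cls \<phi> s)" using x by auto
    qed
  qed
  then show ?thesis unfolding N_def by (rule bij_betw_same_card)
qed

lemma colouring_\<phi>: "colouring \<phi>"
  unfolding colouring_def
proof (intro conjI ballI allI impI)
  fix x assume x: "x \<in> X"
  then show "\<phi> x < k" using idx1[OF x] \<kappa>[of "pos x"] pos_lt[of "idx x" x] by (auto simp: \<phi>_def bij_betw_def)
next
  fix s assume s: "s < k"
  have "bij_betw pos (cls \<phi> s) {..<l}"
  proof (rule bij_betw_imageI)
    show "inj_on pos (cls \<phi> s)"
    proof (rule inj_onI)
      fix x y assume xy: "x \<in> cls \<phi> s" "y \<in> cls \<phi> s" "pos x = pos y"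
      then have X: "x \<in> X" "y \<in> X" by (auto simp: cls_def)
      have "\<kappa> (pos x) (idx x) = \<kappa> (pos x) (idx y)" using xy by (auto simp: cls_def \<phi>_def)
      then have "idx x = idx y" using \<kappa>[of "pos x"] pos_lt[of "idx x" x] idx1[OF X(1)] idx1[OF X(2)]
        by (auto simp: bij_betw_def dest: inj_onD)
      then show "x = y" using xy(3) pos[of "idx x"] idx1[OF X(1)] idx1[OF X(2)] by (auto simp: bij_betw_def dest: inj_onD)
    qed
    show "pos ` cls \<phi> s = {..<l}"
    proof (intro equalityI subsetI)
      fix t assume "t \<in> pos ` cls \<phi> s" then show "t \<in> {..<l}" using idx1 pos_lt by (auto simp: cls_def)
    next
      fix t assume t: "t \<in> {..<l}"
      then have "s \<in> \<kappa> t ` {..<k}" using \<kappa>[of t] s by (auto simp: bij_betw_def)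
      then obtain i where i: "i < k" "\<kappa> t i = s" by auto
      have "t \<in> pos ` A i" using pos[OF i(1)] t by (simp add: bij_betw_def)
      then obtain x where x: "x \<in> A i" "pos x = t" by auto
      then have "x \<in> cls \<phi> s" using i idx2[OF i(1) x(1)] by (auto simp: cls_def \<phi>_def)
      then show "t \<in> pos ` cls \<phi> s" using x by auto
    qed
  qed
  then show "card (cls \<phi> s) = l" using bij_betw_same_card by fastforce
qed

abbreviation \<beta> where "\<beta> \<equiv> Pcol \<phi>"

lemma \<beta>: "\<beta> \<in> Pi_kl k l" by (rule Pcol_in_Om[OF colouring_\<phi>])

lemma St_A: assumes "h \<in> St Q" "P \<in> Q" "i < k" shows "\<exists>j<k. h ` A i = A j"
  using St_image[OF assms(1,2) A_in[OF assms(3)]] A_ex by blast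

lemma St_cls: assumes "h \<in> St Q" "\<beta> \<in> Q" "s < k" shows "\<exists>t<k. h ` cls \<phi> s = cls \<phi> t"
  using St_image[OF assms(1,2), of "cls \<phi> s"] assms(3) by (auto simp: Pcol_def)

text \<open>Elements of the stabilizer permute rows and classes and preserve the matrix
  \<open>N\<close>. The rigidity arguments for all explicit candidates rest on this.\<close>

lemma N_invariant:
  assumes "h \<in> St Q" "i < k" "j < k" "h ` A i = A j" "h ` cls \<phi> s = cls \<phi> t"
  shows "N j t = N i s"
proof -
  have inj: "inj h" using assms(1) permutes_inj by (auto simp: St_iff)
  have "A j \<inter> cls \<phi> t = h ` (A i \<inter> cls \<phi> s)" using assms(4,5) inj by (simp add: image_Int)
  then have "card (A j \<inter> cls \<phi> t) = card (A i \<inter> cls \<phi> s)" using inj by (simp add: card_image inj_on_subset)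
  then show ?thesis using card_A_cls assms by simp
qed

text \<open>Two elements agreeing on the first two rows lie in one coset of the part-fixing group,
  and these rows have at most k^2 pairs of images. Two rows fix both origin and direction of a
  cyclic arrangement.\<close>

lemma card_St_le:
  assumes rigid: "\<And>h. h \<in> St {P, \<beta>} \<Longrightarrow> h ` A 0 = A 0 \<Longrightarrow> h ` A 1 = A 1 \<Longrightarrow> h \<in> Fx {P, \<beta>}"
  shows "card (St {P, \<beta>}) \<le> k\<^sup>2 * card (Fx {P, \<beta>})"
proof -
  have k: "0 < k" "1 < k" using k2 by auto
  have "card (St {P, \<beta>}) \<le> card (Fx {P, \<beta>}) * card (P \<times> P)"
  proof (rule card_le_cosets[where f = "\<lambda>h. (h ` A 0, h ` A 1)"])
    show "finite (St {P, \<beta>})" "finite (Fx {P, \<beta>})" "finite (P \<times> P)"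
      using finite_perm_group[OF perm_group_St finite_X] finite_perm_group[OF perm_group_Fx finite_X] OmD(4)[OF P] by auto
    show "(\<lambda>h. (h ` A 0, h ` A 1)) ` St {P, \<beta>} \<subseteq> P \<times> P"
      using St_image[of _ "{P, \<beta>}" P] A_in k by auto
    show "bij h" if "h \<in> St {P, \<beta>}" for h using perm_groupD(5)[OF perm_group_St that] .
    fix g h assume gh: "g \<in> St {P, \<beta>}" "h \<in> St {P, \<beta>}" "(g ` A 0, g ` A 1) = (h ` A 0, h ` A 1)"
    have inv: "inv g ` g ` B = B" for B using perm_groupD(5)[OF perm_group_St gh(1)] by (simp add: bij_is_inj image_inv_f_f)
    show "inv g \<circ> h \<in> Fx {P, \<beta>}"
    proof (rule rigid)
      show "inv g \<circ> h \<in> St {P, \<beta>}"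
        by (rule perm_groupD(3)[OF perm_group_St perm_groupD(4)[OF perm_group_St gh(1)] gh(2)])
      have eq: "h ` A 0 = g ` A 0" "h ` A 1 = g ` A 1" using gh(3) by simp_all
      show "(inv g \<circ> h) ` A 0 = A 0" "(inv g \<circ> h) ` A 1 = A 1" 
        by (simp_all only: image_comp[symmetric] eq inv)
    qed
  qed
  then show ?thesis using OmD(2)[OF P] by (simp add: card_cartesian_product power2_eq_square mult.commute)
qed

lemma Fx_P\<beta>I: 
  assumes "h \<in> St Q" "\<And>i. i < k \<Longrightarrow> h ` A i = A i" "\<And>s. s < k \<Longrightarrow> h ` cls \<phi> s = cls \<phi> s"
  shows "h \<in> Fx {P, \<beta>}"
proof -
  have "h permutes X" using assms(1) by (simp add: St_iff)
  moreover have "h ` B = B" if "B \<in> P" for B using assms(2) A_ex[OF that] by auto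
  ultimately show ?thesis using assms(3) by (auto simp: Fx_def Pcol_def)
qed

lemma cells_singleton: "cells {P} = P"
proof -
  have "cell {P} x = same_part P x" if "x \<in> X" for x
    using OmD(6)[OF P] same_part_in[OF P that] by (auto simp: cell_def)
  then have "cells {P} = same_part P ` X" by (simp add: cells_def)
  also have "\<dots> = P"
  proof (intro equalityI subsetI)
    fix B assume B: "B \<in> P"
    then obtain x where "x \<in> B" using OmD(9)[OF P] by blast
    then show "B \<in> same_part P ` X" using same_part_eq[OF P B] OmD(6)[OF P B] by blast
  qed (use same_part_in[OF P] in auto)
  finally show ?thesis .
qed

lemma V_lf_N: "V lf {P, \<beta>} = (\<Sum>i<k. \<Sum>s<k. lf (N i s))"
proof -
  have "V lf {P, \<beta>} = V lf (insert \<beta> {P})" by (simp add: insert_commute)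
  also have "\<dots> = (\<Sum>C\<in>P. \<Sum>s<k. lf (card (C \<inter> cls \<phi> s)))"
    by (subst V_insert_Pcol) (use P colouring_\<phi> in \<open>auto simp: cells_singleton lf_def\<close>)
  also have "\<dots> = (\<Sum>i<k. \<Sum>s<k. lf (card (A i \<inter> cls \<phi> s)))"
    using sum.reindex_bij_betw[OF A, of "\<lambda>C. \<Sum>s<k. lf (card (C \<inter> cls \<phi> s))"] by simp
  finally show ?thesis by (simp add: card_A_cls)
qed

end

section \<open>Explicit candidates\<close>

lemma bij_betw_add_mod: assumes "0 < (k::nat)" shows "bij_betw (\<lambda>i. (i + t) mod k) {..<k} {..<k}"
proof -
  have inj: "inj_on (\<lambda>i. (i + t) mod k) {..<k}"
  proof (rule inj_onI)
    fix i j assume ij: "i \<in> {..<k}" "j \<in> {..<k}" "(i + t) mod k = (j + t) mod k"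
    then have "i mod k = j mod k" by (simp only: add.commute[of _ t] add_mod_eq_iff)
    then show "i = j" using ij by simp
  qed
  have "(\<lambda>i. (i + t) mod k) ` {..<k} \<subseteq> {..<k}" using assms by auto
  then have "(\<lambda>i. (i + t) mod k) ` {..<k} = {..<k}" by (rule endo_inj_surj[OF finite_lessThan _ inj])
  then show ?thesis using inj by (simp add: bij_betw_def)
qed

lemma add_mod_if: "i < k \<Longrightarrow> t < k \<Longrightarrow> (i + t) mod k = (if i + t < k then i + t else i + t - (k::nat))"
  by (simp add: mod_if)

context kl_parts
begin

lemma lf_small: "lf 0 = 0" "lf (Suc 0) = 0" "lf 2 = 1" by (simp_all add: lf_eq)

lemma lf_Suc: "lf (Suc a) = lf a + log 2 (1 + real a)" by (simp add: lf_def)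

lemma upward_induct:
  assumes "Pr (0::nat)" "Pr 1" "\<And>i. Suc (Suc i) < k \<Longrightarrow> Pr i \<Longrightarrow> Pr (Suc i) \<Longrightarrow> Pr (Suc (Suc i))" "i < k"
  shows "Pr i"
proof -
  have "(i < k \<longrightarrow> Pr i) \<and> (Suc i < k \<longrightarrow> Pr (Suc i))" by (induction i) (use assms in auto)
  then show ?thesis using assms(4) by blast
qed

text \<open>Cyclic intervals of length \<open>l \<le> k - 2\<close>: two rows meet all but one of the same colour classes iff
  they are neighbours.\<close>

lemma sparse_candidate:
  assumes P: "P \<in> Om" and lk: "l + 2 \<le> k"
  shows "\<exists>b\<in>Om. card (St {P, b}) \<le> k\<^sup>2"
proof -
  obtain A pos idx where r: "bij_betw A {..<k} P" "\<And>i. i < k \<Longrightarrow> bij_betw pos (A i) {..<l}"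
    "\<And>x. x \<in> X \<Longrightarrow> idx x < k \<and> x \<in> A (idx x)" "\<And>i x. i < k \<Longrightarrow> x \<in> A i \<Longrightarrow> idx x = i \<and> x \<in> X"
    by (rule rows[of P "{P}"]) (use P in auto)
  interpret row_colouring k l P A pos idx "\<lambda>t i. (i + t) mod k"
    by unfold_locales (use P r k2 bij_betw_add_mod in auto)
  \<comment> \<open>Cyclic distance from \<open>i\<close> to \<open>s\<close>.\<close>
  define cd where "cd i s = (if i \<le> s then s - i else s + k - i)" for i s
  have N: "N i s = (if cd i s < l then 1 else 0)" if "i < k" "s < k" for i s
  proof -
    have "{t. t < l \<and> (i + t) mod k = s} = (if cd i s < l then {cd i s} else {})"
    proof (rule set_eqI)
      fix t
      have "t < l \<Longrightarrow> (i + t) mod k = (if i + t < k then i + t else i + t - k)"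
        using add_mod_if[OF that(1), of t] lk by auto
      then show "t \<in> {t. t < l \<and> (i + t) mod k = s} \<longleftrightarrow> t \<in> (if cd i s < l then {cd i s} else {})"
        using that lk by (auto simp: cd_def)
    qed
    then show ?thesis by (simp add: N_def)
  qed
  have step: "h ` A (Suc (Suc i)) = A (Suc (Suc i))"
    if h: "h \<in> St {P, \<beta>}" and i: "Suc (Suc i) < k" and f0: "h ` A i = A i" and f1: "h ` A (Suc i) = A (Suc i)" for h i
  proof -
    have inj: "inj h" using h permutes_inj by (auto simp: St_iff)
    obtain j where j: "j < k" "h ` A (Suc (Suc i)) = A j" using St_A[OF h _ i] by auto
    have jne: "j \<noteq> i" "j \<noteq> Suc i"
      using j f0 f1 i A_inj[of i "Suc (Suc i)"] A_inj[of "Suc i" "Suc (Suc i)"] inj_image_eq_iff[OF inj] by (metis Suc_lessD n_not_Suc_n less_Suc_eq_le not_less_eq_eq order_refl)+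
    have "j = Suc (Suc i)"
    proof (rule ccontr)
      assume jn: "j \<noteq> Suc (Suc i)"
      \<comment> \<open>A row at cyclic distance between 2 and k - 2 from row i + 1 misses two of
        its classes, while row i + 2 misses only class i + 1 of them. Pulling the two classes back
        along \<open>h\<close> makes them equal.\<close>
      have "\<exists>s s'. s < k \<and> s' < k \<and> s \<noteq> s' \<and> N (Suc i) s \<noteq> 0 \<and> N j s = 0 \<and> N (Suc i) s' \<noteq> 0 \<and> N j s' = 0"
      proof -
        define d where "d = (if Suc i \<le> j then j - Suc i else j + k - Suc i)"
        have d: "2 \<le> d" "d \<le> k - 2" using i j(1) jne jn unfolding d_def by auto
        have main: "\<exists>s<k. cd (Suc i) s = t \<and> cd j s = (if d \<le> t then t - d else t + k - d)"
          if t: "t < k" for t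
        proof -
          define s where "s = (if Suc i + t < k then Suc i + t else Suc i + t - k)"
          have "s < k" using t i by (auto simp: s_def)
          moreover have "cd (Suc i) s = t" using t i by (auto simp: s_def cd_def)
          moreover have "cd j s = (if d \<le> t then t - d else t + k - d)"
            using t i j(1) by (auto simp: s_def d_def cd_def split: if_splits)
          ultimately show ?thesis by blast
        qed
        have two: "\<exists>t t'. t < l \<and> t' < l \<and> t \<noteq> t' \<and> l \<le> (if d \<le> t then t - d else t + k - d) \<and> l \<le> (if d \<le> t' then t' - d else t' + k - d)"
        proof (cases "l + d \<le> k")
          case True
          then show ?thesis using d l2 by (intro exI[of _ 0] exI[of _ 1]) auto
        next
          case False
          then show ?thesis using d l2 lk by (intro exI[of _ "l + d - k"] exI[of _ "Suc (l + d - k)"]) auto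
        qed
        then obtain t t' where t: "t < l" "t' < l" "t \<noteq> t'" "l \<le> (if d \<le> t then t - d else t + k - d)" "l \<le> (if d \<le> t' then t' - d else t' + k - d)" by blast
        have tk: "t < k" "t' < k" using t lk by auto
        obtain s where s: "s < k" "cd (Suc i) s = t" "cd j s = (if d \<le> t then t - d else t + k - d)"
          using main[OF tk(1)] by blast
        obtain s' where s': "s' < k" "cd (Suc i) s' = t'" "cd j s' = (if d \<le> t' then t' - d else t' + k - d)"
          using main[OF tk(2)] by blast
        have "N (Suc i) s \<noteq> 0" "N (Suc i) s' \<noteq> 0" "N j s = 0" "N j s' = 0"
          using N[of "Suc i" s] N[of "Suc i" s'] N[of j s] N[of j s'] s s' t i j(1) by simp_all
        moreover have "s \<noteq> s'" using s(2) s'(2) t(3) by blast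
        ultimately show ?thesis using s(1) s'(1) by blast
      qed
      then obtain s s' where s: "s < k" "s' < k" "s \<noteq> s'" "N (Suc i) s \<noteq> 0" "N j s = 0" "N (Suc i) s' \<noteq> 0" "N j s' = 0" by blast
      have pull: "h ` cls \<phi> (Suc i) = cls \<phi> s" if ss: "s < k" "N (Suc i) s \<noteq> 0" "N j s = 0" for s
      proof -
        have "cls \<phi> s \<in> part_act h \<beta>" using h ss(1) by (auto simp: St_iff Pcol_def)
        then obtain s0 where s0: "s0 < k" "cls \<phi> s = h ` cls \<phi> s0" by (auto simp: part_act_def Pcol_def)
        have "N (Suc i) s0 \<noteq> 0" using N_invariant[OF h _ _ f1 s0(2)[symmetric]] i ss by simp
        moreover have "N (Suc (Suc i)) s0 = 0" using N_invariant[OF h i j(1) j(2) s0(2)[symmetric]] ss by simp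
        ultimately have "s0 = Suc i" using N[of "Suc i" s0] N[of "Suc (Suc i)" s0] i s0(1) lk by (auto simp: cd_def split: if_splits)
        then show ?thesis using s0 by simp
      qed
      have "cls \<phi> s = cls \<phi> s'" using pull[of s] pull[of s'] s by simp
      then show False using inj_cls[OF colouring_\<phi>] s by (auto dest: inj_onD)
    qed
    then show ?thesis using j by simp
  qed
  have rigid: "h \<in> Fx {P, \<beta>}" if h: "h \<in> St {P, \<beta>}" "h ` A 0 = A 0" "h ` A 1 = A 1" for h
  proof -
    have fixA: "h ` A i = A i" if "i < k" for i
      by (rule upward_induct[where Pr = "\<lambda>i. h ` A i = A i"]) (use h step[OF h(1)] that in auto)
    have "h ` cls \<phi> s = cls \<phi> s" if s: "s < k" for s
    proof -
      obtain s' where s': "s' < k" "h ` cls \<phi> s = cls \<phi> s'" using St_cls[OF h(1) _ s] by auto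
      have eq: "N i s' = N i s" if "i < k" for i using N_invariant[OF h(1) that that fixA[OF that] s'(2)] .
      have "s' = s"
      proof (rule ccontr)
        assume ne: "s' \<noteq> s"
        define d where "d = (if s \<le> s' then s' - s else s' + k - s)"
        have d: "1 \<le> d" "d < k" using ne s s'(1) by (auto simp: d_def)
        have "\<exists>i<k. N i s \<noteq> 0 \<and> N i s' = 0"
        proof (cases "l \<le> d")
          case True
          have "cd s s < l" "cd s s' = d" using l2 by (auto simp: cd_def d_def)
          then have "N s s \<noteq> 0 \<and> N s s' = 0" using N[OF s s] N[OF s s'(1)] True by simp
          then show ?thesis using s by blast
        next
          case False
          \<comment> \<open>The row for which \<open>s'\<close> is the first class behind its
            interval while \<open>s\<close> still lies inside.\<close>
          define i where "i = (if l - d \<le> s then s - (l - d) else s + k - (l - d))"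
          have "i < k" using s d False lk by (auto simp: i_def)
          moreover have "cd i s = l - d" using s d False lk by (auto simp: i_def cd_def)
          then have "N i s \<noteq> 0" using N[OF \<open>i < k\<close> s] d(1) l2 by simp
          moreover have "cd i s' = l" using s s'(1) d False lk unfolding i_def d_def cd_def by (simp split: if_splits) arith+
          then have "N i s' = 0" using N[OF \<open>i < k\<close> s'(1)] by simp
          ultimately show ?thesis by blast
        qed
        then show False using eq by metis
      qed
      then show ?thesis using s' by simp
    qed
    then show ?thesis using Fx_P\<beta>I[OF h(1)] fixA by blast
  qed
  have "V lf {P, \<beta>} = 0"
    unfolding V_lf_N by (intro sum.neutral ballI) (auto simp: N lf_small)
  then have "real (card (Fx {P, \<beta>})) = 1" using card_Fx[of "{P, \<beta>}"] P \<beta> by simp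
  then have "card (Fx {P, \<beta>}) = 1" by simp
  then have "card (St {P, \<beta>}) \<le> k\<^sup>2" using card_St_le[OF rigid] by simp
  then show ?thesis using \<beta> by blast
qed

text \<open>Plain cyclic intervals of length k - 1 miss one class each, so \<open>N\<close> would
  admit every permutation of the rows. Letting position 1 repeat the row's own colour puts 2 on the
  diagonal of \<open>N\<close>, 0 at the cyclic neighbours and 1 elsewhere: the 2 ties class i to
  row i, and the 0s recover the cycle. The diagonal entries cause the factor 2^k.\<close>

lemma critical_candidate:
  assumes P: "P \<in> Om" and lk: "l + 1 = k"
  shows "\<exists>b\<in>Om. card (St {P, b}) \<le> k\<^sup>2 * 2 ^ k"
proof -
  obtain A pos idx where r: "bij_betw A {..<k} P" "\<And>i. i < k \<Longrightarrow> bij_betw pos (A i) {..<l}"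
    "\<And>x. x \<in> X \<Longrightarrow> idx x < k \<and> x \<in> A (idx x)" "\<And>i x. i < k \<Longrightarrow> x \<in> A i \<Longrightarrow> idx x = i \<and> x \<in> X"
    by (rule rows[of P "{P}"]) (use P in auto)
  have "bij_betw (\<lambda>i. if t = Suc 0 then i else (i + t) mod k) {..<k} {..<k}" for t
    using bij_betw_add_mod[of k t] k2 bij_betw_id[of "{..<k}"] by (cases "t = Suc 0") (auto simp: id_def)
  then interpret row_colouring k l P A pos idx "\<lambda>t i. if t = Suc 0 then i else (i + t) mod k"
    by unfold_locales (use P r in auto)
  have N: "N i s = (if s = i then 2 else if (if i \<le> s then s - i else s + k - i) = Suc 0 \<or> (if i \<le> s then s - i else s + k - i) = k - Suc 0 then 0 else 1)"
    if "i < k" "s < k" for i s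
  proof (cases "s = i")
    case True
    have "{t. t < l \<and> (if t = Suc 0 then i else (i + t) mod k) = s} = {0, Suc 0}"
    proof (rule set_eqI)
      fix t show "t \<in> {t. t < l \<and> (if t = Suc 0 then i else (i + t) mod k) = s} \<longleftrightarrow> t \<in> {0, Suc 0}"
        using add_mod_if[OF that(1), of t] True that lk l2 by (auto split: if_splits)
    qed
    then show ?thesis using True unfolding N_def by simp
  next
    case False
    define d where "d = (if i \<le> s then s - i else s + k - i)"
    have "{t. t < l \<and> (if t = Suc 0 then i else (i + t) mod k) = s} = (if d = Suc 0 \<or> d = k - Suc 0 then {} else {d})"
    proof (rule set_eqI)
      fix t show "t \<in> {t. t < l \<and> (if t = Suc 0 then i else (i + t) mod k) = s} \<longleftrightarrow> t \<in> (if d = Suc 0 \<or> d = k - Suc 0 then {} else {d})"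
        using add_mod_if[OF that(1), of t] False that lk l2 by (auto simp: d_def split: if_splits)
    qed
    then show ?thesis using False unfolding N_def d_def by simp
  qed
  have N2: "N i s = 2 \<longleftrightarrow> s = i" if "i < k" "s < k" for i s using N[OF that] by auto
  have fixcls: "h ` cls \<phi> i = cls \<phi> i" if h: "h \<in> St {P, \<beta>}" and i: "i < k" and f: "h ` A i = A i" for h i
  proof -
    obtain s' where s': "s' < k" "h ` cls \<phi> i = cls \<phi> s'" using St_cls[OF h _ i] by auto
    have "N i s' = N i i" using N_invariant[OF h i i f s'(2)] .
    then have "s' = i" using N2[OF i s'(1)] N2[OF i i] by simp
    then show ?thesis using s' by simp
  qed
  have step: "h ` A (Suc (Suc i)) = A (Suc (Suc i))"
    if h: "h \<in> St {P, \<beta>}" and i: "Suc (Suc i) < k" and f0: "h ` A i = A i" and f1: "h ` A (Suc i) = A (Suc i)" for h i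
  proof -
    have inj: "inj h" using h permutes_inj by (auto simp: St_iff)
    obtain j where j: "j < k" "h ` A (Suc (Suc i)) = A j" using St_A[OF h _ i] by auto
    have "j \<noteq> i"
    proof
      assume "j = i"
      then have "A (Suc (Suc i)) = A i" using j f0 inj_image_eq_iff[OF inj] by metis
      then show False using A_inj[of "Suc (Suc i)" i] i by simp
    qed
    moreover have "N j (Suc i) = N (Suc (Suc i)) (Suc i)"
      using N_invariant[OF h i j(1) j(2) fixcls[OF h _ f1]] i by simp
    moreover have "N (Suc (Suc i)) (Suc i) = 0" using N[of "Suc (Suc i)" "Suc i"] i by simp
    moreover have "j \<noteq> Suc i" using N2[of j "Suc i"] calculation i j(1) by auto
    ultimately have "j = Suc (Suc i)"
      using N[of j "Suc i"] i j(1) by (simp split: if_splits) arith+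
    then show ?thesis using j by simp
  qed
  have rigid: "h \<in> Fx {P, \<beta>}" if h: "h \<in> St {P, \<beta>}" "h ` A 0 = A 0" "h ` A 1 = A 1" for h
  proof -
    have fixA: "h ` A i = A i" if "i < k" for i
      by (rule upward_induct[where Pr = "\<lambda>i. h ` A i = A i"]) (use h step[OF h(1)] that in auto)
    then show ?thesis using Fx_P\<beta>I[OF h(1)] fixcls[OF h(1)] by blast
  qed
  have "(\<Sum>s<k. lf (N i s)) = 1" if "i < k" for i
  proof -
    have "(\<Sum>s<k. lf (N i s)) = (\<Sum>s<k. if s = i then 1 else 0)"
      by (intro sum.cong) (auto simp: N[OF that] lf_small)
    then show ?thesis using that by (simp add: sum.delta)
  qed
  then have "V lf {P, \<beta>} = real k" unfolding V_lf_N by simp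
  then have "real (card (Fx {P, \<beta>})) = real (2 ^ k)" using card_Fx[of "{P, \<beta>}"] P \<beta> by (simp add: powr_realpow)
  then have "card (Fx {P, \<beta>}) = 2 ^ k" by (simp only: of_nat_eq_iff)
  then have "card (St {P, \<beta>}) \<le> k\<^sup>2 * 2 ^ k" using card_St_le[OF rigid] by simp
  then show ?thesis using \<beta> by blast
qed

text \<open>If \<open>k\<close> divides \<open>l\<close>, an undisturbed cyclic shift makes all
  entries of \<open>N\<close> equal. Position k - 1 therefore repeats the row's own colour. This
  defect makes the rows rigid and touches at most one cell per row, hence the cost of
  \<open>log 2 3\<close> for each of the \<open>k\<close> rows.\<close>

lemma dense_candidate:
  assumes PQ: "P \<in> Q" "Q \<subseteq> Om" and lk: "k \<le> l"
  shows "\<exists>b\<in>Om. V lf (insert b Q) \<le> V wbal Q + real k * log 2 3 \<and> Fx Q \<inter> St {b} \<subseteq> Fx (insert b Q) \<and>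
    card (St {P, b}) \<le> k\<^sup>2 * card (Fx {P, b})"
proof -
  have P: "P \<in> Om" using PQ by auto
  obtain A pos idx where r: "bij_betw A {..<k} P" "\<And>i. i < k \<Longrightarrow> bij_betw pos (A i) {..<l}"
    "\<And>C. C \<in> cells Q \<Longrightarrow> inj_on pos C \<and> (\<exists>r. pos ` C = {r..<r + card C})"
    "\<And>x. x \<in> X \<Longrightarrow> idx x < k \<and> x \<in> A (idx x)" "\<And>i x. i < k \<Longrightarrow> x \<in> A i \<Longrightarrow> idx x = i \<and> x \<in> X"
    "\<And>C. C \<in> cells Q \<Longrightarrow> \<exists>i<k. C \<subseteq> A i"
    by (rule rows[OF PQ]) blast
  have "bij_betw (\<lambda>i. if t = k - Suc 0 then i else (i + t) mod k) {..<k} {..<k}" for t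
    using bij_betw_add_mod[of k t] k2 bij_betw_id[of "{..<k}"] by (cases "t = k - Suc 0") (auto simp: id_def)
  then interpret row_colouring k l P A pos idx "\<lambda>t i. if t = k - Suc 0 then i else (i + t) mod k"
    by unfold_locales (use P r in auto)
  define c0 where "c0 = card {t. t < l \<and> t mod k = 0}"
  define cm where "cm = card {t. t < l \<and> t mod k = k - Suc 0}"
  have fin: "finite {t. t < l \<and> R t}" for R by (rule finite_subset[of _ "{..<l}"]) auto
  have k1: "0 < k" "0 < k - Suc 0" "k - Suc 0 < k" using k2 by auto
  have self: "(i + t) mod k = i \<longleftrightarrow> t mod k = 0" if "i < k" for i t
    using add_mod_eq_iff[of i t k 0] that by simp
  \<comment> \<open>\<open>F1\<close> and \<open>F2\<close>: class \<open>i\<close> is strictly most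
    frequent in row \<open>i\<close>, so fixing the row fixes the class. \<open>F3\<close> and
    \<open>F4\<close>: row i + 1 is the only row with fewer than \<open>cm\<close> points of class
    \<open>i\<close>, so fixing class \<open>i\<close> fixes row i + 1.\<close>
  have F1: "N i i = Suc c0" if i: "i < k" for i
  proof -
    have "{t. t < l \<and> (if t = k - Suc 0 then i else (i + t) mod k) = i} = insert (k - Suc 0) {t. t < l \<and> t mod k = 0}"
      using self[OF i] lk k1 by auto
    moreover have "k - Suc 0 \<notin> {t. t < l \<and> t mod k = 0}" using k1 by auto
    ultimately show ?thesis using fin unfolding N_def c0_def by simp
  qed
  have F2: "N i s \<le> c0" if "i < k" "s < k" "s \<noteq> i" for i s
    unfolding N_def c0_def
  proof (rule card_inj_on_le[where f = "\<lambda>t. t - t mod k"])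
    show "inj_on (\<lambda>t. t - t mod k) {t. t < l \<and> (if t = k - Suc 0 then i else (i + t) mod k) = s}"
    proof (rule inj_onI)
      fix t t' assume as: "t \<in> {t. t < l \<and> (if t = k - Suc 0 then i else (i + t) mod k) = s}"
        "t' \<in> {t. t < l \<and> (if t = k - Suc 0 then i else (i + t) mod k) = s}" "t - t mod k = t' - t' mod k"
      then have "(i + t) mod k = (i + t') mod k" using that by (auto split: if_splits)
      then have "t mod k = t' mod k" by (simp add: add_mod_eq_iff)
      then show "t = t'" using as(3) mod_less_eq_dividend[of t k] mod_less_eq_dividend[of t' k] by linarith
    qed
    show "(\<lambda>t. t - t mod k) ` {t. t < l \<and> (if t = k - Suc 0 then i else (i + t) mod k) = s} \<subseteq> {t. t < l \<and> t mod k = 0}"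
    proof -
      have "t - t mod k < l \<and> (t - t mod k) mod k = 0" if "t < l" for t
        using that by (simp add: minus_mod_eq_mult_div less_imp_diff_less) (metis le_less_trans times_div_less_eq_dividend)
      then show ?thesis by (intro image_subsetI) (simp only: mem_Collect_eq)
    qed
  qed (rule fin)
  have F4: "cm \<le> N i s" if "i < k" "s < k" "(i + (k - Suc 0)) mod k \<noteq> s" for i s
    unfolding N_def cm_def
  proof (rule card_inj_on_le[where f = "\<lambda>t. t - (k - Suc 0) + (s + k - i) mod k"])
    define d where "d = (s + k - i) mod k"
    have id: "(i + d) mod k = s"
    proof -
      have "(i + d) mod k = (i + (s + k - i)) mod k" unfolding d_def by (simp only: mod_add_right_eq)
      also have "i + (s + k - i) = s + k" using that by simp
      finally show ?thesis using that by simp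
    qed
    have "d < k" using k1 by (simp add: d_def)
    moreover have "d \<noteq> k - Suc 0" using id that(3) by auto
    ultimately have dk: "d < k - Suc 0" by simp
    have ge: "k - Suc 0 \<le> t" if "t mod k = k - Suc 0" for t using that mod_less_eq_dividend[of t k] by linarith
    show "inj_on (\<lambda>t. t - (k - Suc 0) + (s + k - i) mod k) {t. t < l \<and> t mod k = k - Suc 0}"
    proof (rule inj_onI)
      fix t t' assume "t \<in> {t. t < l \<and> t mod k = k - Suc 0}" "t' \<in> {t. t < l \<and> t mod k = k - Suc 0}"
        "t - (k - Suc 0) + (s + k - i) mod k = t' - (k - Suc 0) + (s + k - i) mod k"
      then show "t = t'" using ge[of t] ge[of t'] by simp
    qed
    show "(\<lambda>t. t - (k - Suc 0) + (s + k - i) mod k) ` {t. t < l \<and> t mod k = k - Suc 0} \<subseteq> {t. t < l \<and> (if t = k - Suc 0 then i else (i + t) mod k) = s}"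
    proof (rule image_subsetI)
      fix t assume t: "t \<in> {t. t < l \<and> t mod k = k - Suc 0}"
      have t1: "k - Suc 0 \<le> t" "t < l" "t mod k = k - Suc 0" using t ge by auto
      define q where "q = t div k"
      have tq: "t = q * k + (k - Suc 0)" using t1(3) div_mult_mod_eq[of t k] by (simp add: q_def)
      have e: "t - (k - Suc 0) + d = d + q * k" using tq by simp
      have m: "(t - (k - Suc 0) + d) mod k = d" unfolding e using dk by simp
      have "t - (k - Suc 0) + d \<noteq> k - Suc 0"
      proof
        assume "t - (k - Suc 0) + d = k - Suc 0"
        then have "(k - Suc 0) mod k = d" using m by simp
        then show False using dk k1 by simp
      qed
      moreover have "(i + (t - (k - Suc 0) + d)) mod k = s"
        using m id mod_add_right_eq[of i "t - (k - Suc 0) + d" k] by simp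
      moreover have "t - (k - Suc 0) + d < l" using t1 dk by simp
      ultimately show "t - (k - Suc 0) + (s + k - i) mod k \<in> {t. t < l \<and> (if t = k - Suc 0 then i else (i + t) mod k) = s}"
        by (simp add: d_def[symmetric])
    qed
  qed (rule fin)
  have F3: "N (Suc i) i < cm" if "Suc i < k" for i
    unfolding N_def cm_def
  proof (rule psubset_card_mono[OF fin])
    have "(Suc i + t) mod k = i \<longleftrightarrow> t mod k = k - Suc 0" for t
    proof -
      have "(Suc i + (k - Suc 0)) mod k = i" using that by simp
      then show ?thesis using add_mod_eq_iff[of "Suc i" t k "k - Suc 0"] k1 by simp
    qed
    then have "{t. t < l \<and> (if t = k - Suc 0 then Suc i else (Suc i + t) mod k) = i} \<subseteq> {t. t < l \<and> t mod k = k - Suc 0}"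
      by (auto split: if_splits)
    moreover have "k - Suc 0 \<in> {t. t < l \<and> t mod k = k - Suc 0}" using lk k1 by auto
    moreover have "k - Suc 0 \<notin> {t. t < l \<and> (if t = k - Suc 0 then Suc i else (Suc i + t) mod k) = i}" by auto
    ultimately show "{t. t < l \<and> (if t = k - Suc 0 then Suc i else (Suc i + t) mod k) = i} \<subset> {t. t < l \<and> t mod k = k - Suc 0}" by blast
  qed
  have fixcls: "h ` cls \<phi> i = cls \<phi> i" if h: "h \<in> St Q'" "\<beta> \<in> Q'" and i: "i < k" and f: "h ` A i = A i" for h i Q'
  proof -
    obtain s' where s': "s' < k" "h ` cls \<phi> i = cls \<phi> s'" using St_cls[OF h i] by auto
    have "N i s' = N i i" using N_invariant[OF h(1) i i f s'(2)] .
    then have "s' = i" using F1[OF i] F2[OF i s'(1)] by auto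
    then show ?thesis using s' by simp
  qed
  have step: "h ` A (Suc i) = A (Suc i)"
    if h: "h \<in> St {P, \<beta>}" and i: "Suc i < k" and f0: "h ` A i = A i" for h i
  proof -
    obtain j where j: "j < k" "h ` A (Suc i) = A j" using St_A[OF h _ i] by auto
    have "N j i = N (Suc i) i" using N_invariant[OF h i j(1) j(2) fixcls[OF h _ _ f0]] i by simp
    then have "\<not> cm \<le> N j i" using F3[OF i] by simp
    then have ji: "(j + (k - Suc 0)) mod k = i" using F4[of j i] i j(1) by auto
    have "j = Suc i"
    proof (cases j)
      case 0 then show ?thesis using ji i k1 by simp
    next
      case (Suc j')
      then have "j + (k - Suc 0) = j' + k" using k1 by simp
      then show ?thesis using ji j(1) Suc by simp
    qed
    then show ?thesis using j by simp
  qed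
  have rigid: "h \<in> Fx {P, \<beta>}" if h: "h \<in> St {P, \<beta>}" "h ` A 0 = A 0" "h ` A 1 = A 1" for h
  proof -
    have fixA: "h ` A i = A i" if "i < k" for i
      by (rule upward_induct[where Pr = "\<lambda>i. h ` A i = A i"]) (use h step[OF h(1)] that in auto)
    then show ?thesis using Fx_P\<beta>I[OF h(1)] fixcls[OF h(1)] by blast
  qed
  have FxSt: "Fx Q \<inter> St {\<beta>} \<subseteq> Fx (insert \<beta> Q)"
  proof
    fix h assume h: "h \<in> Fx Q \<inter> St {\<beta>}"
    have "h ` A i = A i" if "i < k" for i using h A_in[OF that] PQ(1) by (auto simp: Fx_def)
    then have "h ` cls \<phi> i = cls \<phi> i" if "i < k" for i using fixcls[of h "{\<beta>}" i] h that by auto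
    then show "h \<in> Fx (insert \<beta> Q)" using h by (auto simp: Fx_def Pcol_def)
  qed
  \<comment> \<open>The cells hit by the defect of their row; all others are split evenly.\<close>
  define spec where "spec C \<longleftrightarrow> (\<exists>x\<in>C. pos x = k - Suc 0)" for C
  have cost: "(\<Sum>s<k. lf (card (C \<inter> cls \<phi> s))) \<le> wbal (card C) + (if spec C then log 2 3 else 0)" if C: "C \<in> cells Q" for C
  proof -
    obtain i where i: "i < k" "C \<subseteq> A i" using r(6)[OF C] by auto
    obtain rr where rr: "inj_on pos C" "pos ` C = {rr..<rr + card C}" using r(3)[OF C] by auto
    define \<phi>0 where "\<phi>0 x = (i + pos x) mod k" for x
    note CX = in_cells_subset[OF C]
    note int = sum_lf_interval[OF rr, of \<phi>0 i, OF _ CX, unfolded \<phi>0_def, OF refl, folded \<phi>0_def]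
    have \<phi>: "\<phi> x = (if pos x = k - Suc 0 then i else \<phi>0 x)" if "x \<in> C" for x
      using r(5)[OF i(1), of x] i(2) that by (auto simp: \<phi>_def \<phi>0_def)
    show ?thesis
    proof (cases "spec C")
      case False
      then have "C \<inter> cls \<phi> s = C \<inter> cls \<phi>0 s" for s using \<phi> by (auto simp: cls_def spec_def)
      then show ?thesis using int(2) False by simp
    next
      case True
      then obtain x0 where x0: "x0 \<in> C" "pos x0 = k - Suc 0" by (auto simp: spec_def)
      have uniq: "x = x0" if "x \<in> C" "pos x = k - Suc 0" for x by (rule inj_onD[OF rr(1)]) (use that x0 in auto)
      define j where "j = (i + (k - Suc 0)) mod k"
      have j: "j < k" "j \<noteq> i" using k1 self[OF i(1), of "k - Suc 0"] by (auto simp: j_def)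
      define a where "a s = card (C \<inter> cls \<phi>0 s)" for s
      have finC: "finite C" by (rule finite_in_cells[OF C])
      have x0X: "x0 \<in> X" using x0 CX by auto
      have ne: "C \<inter> cls \<phi> s = C \<inter> cls \<phi>0 s" if "s \<noteq> i" "s \<noteq> j" for s
      proof -
        have "\<phi> x = s \<longleftrightarrow> \<phi>0 x = s" if "x \<in> C" for x
          using \<phi>[OF that] uniq[OF that] x0 \<open>s \<noteq> i\<close> \<open>s \<noteq> j\<close> by (auto simp: \<phi>0_def j_def)
        then show ?thesis by (auto simp: cls_def)
      qed
      have ei: "C \<inter> cls \<phi> i = insert x0 (C \<inter> cls \<phi>0 i)"
      proof -
        have "\<phi> x = i \<longleftrightarrow> x = x0 \<or> \<phi>0 x = i" if "x \<in> C" for x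
          using \<phi>[OF that] uniq[OF that] x0 by auto
        then show ?thesis using x0 x0X by (auto simp: cls_def)
      qed
      have ni: "x0 \<notin> C \<inter> cls \<phi>0 i" using j x0 by (auto simp: cls_def \<phi>0_def j_def)
      have ej: "insert x0 (C \<inter> cls \<phi> j) = C \<inter> cls \<phi>0 j"
      proof -
        have "\<phi>0 x = j \<longleftrightarrow> x = x0 \<or> \<phi> x = j" if "x \<in> C" for x
          using \<phi>[OF that] uniq[OF that] x0 j by (auto simp: \<phi>0_def j_def)
        then show ?thesis using x0 x0X by (auto simp: cls_def)
      qed
      have nj: "x0 \<notin> C \<inter> cls \<phi> j" using \<phi>[OF x0(1)] x0 j by (auto simp: cls_def)
      have ci: "card (C \<inter> cls \<phi> i) = Suc (a i)" unfolding ei a_def using ni finC by simp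
      have cj: "a j = Suc (card (C \<inter> cls \<phi> j))" unfolding a_def ej[symmetric] using nj finC by simp
      have "lf (card (C \<inter> cls \<phi> s)) = lf (a s) + (if s = i then log 2 (1 + real (a i)) else 0) - (if s = j then log 2 (real (a j)) else 0)" for s
      proof -
        consider "s = i" | "s = j" | "s \<noteq> i" "s \<noteq> j" by blast
        then show ?thesis
        proof cases
          case 1 then show ?thesis using j ci by (simp add: lf_Suc)
        next
          case 2 then show ?thesis using j cj by (simp add: lf_Suc add.commute)
        next
          case 3 then show ?thesis using ne[of s] by (simp add: a_def)
        qed
      qed
      then have "(\<Sum>s<k. lf (card (C \<inter> cls \<phi> s))) = wbal (card C) + log 2 (1 + real (a i)) - log 2 (real (a j))"
        using int(2) i j by (simp add: sum.distrib sum_subtractf sum.delta a_def)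
      \<comment> \<open>The defect moves one point from class \<open>j\<close> to class
        \<open>i\<close>. With q = \<open>card C div k\<close> the quotient is at most (q + 2) / max
        1 q, hence at most 3.\<close>
      moreover have "log 2 (1 + real (a i)) \<le> log 2 (3 * real (a j))"
      proof (rule log2_mono)
        have "a i \<le> card C div k + 1" "card C div k \<le> a j"
          using card_residue_bounds[OF k1(1) i(1), of "card C" "i + rr"] card_residue_bounds[OF k1(1) j(1), of "card C" "i + rr"]
            int(1) by (auto simp: a_def)
        then show "1 + real (a i) \<le> 3 * real (a j)" using cj by linarith
      qed simp
      moreover have "log 2 (3 * real (a j)) = log 2 3 + log 2 (real (a j))"
        using cj by (intro log_mult_pos) auto
      ultimately show ?thesis using True by simp
    qed
  qed
  have "{C \<in> cells Q. spec C} \<subseteq> (\<lambda>i. cell Q (inv_into (A i) pos (k - Suc 0))) ` {..<k}"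
  proof
    fix C assume "C \<in> {C \<in> cells Q. spec C}"
    then have C: "C \<in> cells Q" "spec C" by auto
    obtain i where i: "i < k" "C \<subseteq> A i" using r(6)[OF C(1)] by auto
    obtain x where x: "x \<in> C" "pos x = k - Suc 0" using C(2) by (auto simp: spec_def)
    have "inv_into (A i) pos (k - Suc 0) = x"
      using r(2)[OF i(1)] x i(2) by (metis bij_betw_def inv_into_f_f subsetD)
    then have "C = cell Q (inv_into (A i) pos (k - Suc 0))" using cells_eqI[OF PQ(2) C(1) x(1)] by simp
    then show "C \<in> (\<lambda>i. cell Q (inv_into (A i) pos (k - Suc 0))) ` {..<k}" using i by blast
  qed
  then have "card {C \<in> cells Q. spec C} \<le> k" using surj_card_le[OF finite_lessThan[of k]] by simp
  then have "real (card {C \<in> cells Q. spec C}) * log 2 3 \<le> real k * log 2 3" by (intro mult_right_mono) auto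
  moreover have "V lf (insert \<beta> Q) \<le> (\<Sum>C\<in>cells Q. wbal (card C) + (if spec C then log 2 3 else 0))"
    by (subst V_insert_Pcol[OF PQ(2) colouring_\<phi>]) (auto intro!: sum_mono cost simp: lf_small)
  moreover have "(\<Sum>C\<in>cells Q. wbal (card C) + (if spec C then log 2 3 else 0)) = V wbal Q + real (card {C \<in> cells Q. spec C}) * log 2 3"
    using finite_cells by (simp add: sum.distrib V_def sum.If_cases Int_def)
  ultimately have "V lf (insert \<beta> Q) \<le> V wbal Q + real k * log 2 3" by linarith
  then show ?thesis using \<beta> FxSt card_St_le[OF rigid] by blast
qed

end

section \<open>Random candidates\<close>

lemma card_permutes_extending:
  assumes R: "finite R" and Z: "Z \<subseteq> R"
  shows "card {g. g permutes R \<and> (\<forall>x\<in>Z. g x = e x)} \<le> fact (card R - card Z)"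
proof -
  let ?H = "{g. g permutes R \<and> (\<forall>x\<in>Z. g x = e x)}"
  have "card ?H \<le> card {q. q permutes R - Z} * card {()}"
  proof (rule card_le_cosets[where f = "\<lambda>_. ()"])
    show "finite ?H" by (rule finite_subset[OF _ finite_permutations[OF R]]) auto
    show "finite {q. q permutes R - Z}" using R by (intro finite_permutations) auto
    fix g h assume gh: "g \<in> ?H" "h \<in> ?H"
    have perm: "inv g \<circ> h permutes R" using gh by (intro permutes_compose permutes_inv) auto
    have "(inv g \<circ> h) x = x" if "x \<in> Z" for x
    proof -
      have "h x = g x" using gh that by simp
      then show ?thesis using gh(1) permutes_inverses(2)[of g R] by simp
    qed
    then show "inv g \<circ> h \<in> {q. q permutes R - Z}" using permutes_superset[OF perm] by blast
  qed (auto intro: permutes_bij)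
  also have "\<dots> = fact (card R - card Z)"
    using R Z card_permutations[of "R - Z" "card R - card Z"] finite_subset[OF Z R] by (simp add: card_Diff_subset)
  finally show ?thesis .
qed

text \<open>Permutations whose induced partition of \<open>A\<close> matches the one of its copy \<open>h ` A\<close>: once the colours on
  \<open>A\<close> are known, the colours on \<open>h ` A\<close> are determined up to an injective renaming.\<close>

lemma card_matching_permutations:
  fixes \<phi> :: "'a \<Rightarrow> nat" and R :: "'a set"
  assumes R: "finite R" and A: "A \<subseteq> R" and hA: "h ` A \<subseteq> R" and inj: "inj_on h A" and dis: "A \<inter> h ` A = {}"
    and \<phi>k: "\<And>x. x \<in> R \<Longrightarrow> \<phi> x < k" and cl: "\<And>s. card {x \<in> R. \<phi> x = s} \<le> l"
    and K: "\<And>d. d \<le> card A \<Longrightarrow> d \<le> k \<Longrightarrow> (\<Prod>i<d. k - i) \<le> K"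
  shows "card {g. g permutes R \<and> (\<forall>x\<in>A. \<forall>y\<in>A. \<phi> (g x) = \<phi> (g y) \<longleftrightarrow> \<phi> (g (h x)) = \<phi> (g (h y)))} *
      (card R - 2 * card A) ^ card A \<le> fact (card R) * K * l ^ card A"
proof -
  define S where "S = {g. g permutes R \<and> (\<forall>x\<in>A. \<forall>y\<in>A. \<phi> (g x) = \<phi> (g y) \<longleftrightarrow> \<phi> (g (h x)) = \<phi> (g (h y)))}"
  define N where "N = card R"
  define p where "p = card A"
  define B where "B = h ` A"
  define I where "I = {u \<in> A \<rightarrow>\<^sub>E R. inj_on u A}"
  have finA: "finite A" using A R finite_subset by blast
  have finB: "finite B" and cB: "card B = p" using finA inj by (auto simp: B_def p_def card_image)
  have finS: "finite S" unfolding S_def by (rule finite_subset[OF _ finite_permutations[OF R]]) auto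
  have finI: "finite I" unfolding I_def using finA R by (simp add: finite_PiE)
  have cAB: "card (A \<union> B) = 2 * p" using dis finA finB cB by (simp add: card_Un_disjoint p_def B_def)
  have ABR: "A \<union> B \<subseteq> R" using A hA by (auto simp: B_def)
  have N2p: "2 * p \<le> N" using card_mono[OF R ABR] cAB by (simp add: N_def)
  have gR: "g x \<in> R" if "g \<in> S" "x \<in> R" for g x using that permutes_in_image[of g R x] by (auto simp: S_def)
  \<comment> \<open>Given \<open>g\<close> on \<open>A\<close>, one of \<open>card I\<close>
    choices, there are at most \<open>K\<close> colourings of the image of \<open>A\<close> under
    \<open>h\<close>, at most l^p placements of its points in these colours, and at most (N - 2p)!
    completions.\<close>
  have fib: "card {g \<in> S. restrict g A = v} \<le> (fact (N - 2 * p) * l ^ p) * K" if v: "v \<in> I" for v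
  proof -
    define Cu where "Cu = {c \<in> B \<rightarrow>\<^sub>E {..<k}. \<forall>x\<in>A. \<forall>y\<in>A. \<phi> (v x) = \<phi> (v y) \<longleftrightarrow> c (h x) = c (h y)}"
    have finCu: "finite Cu" unfolding Cu_def using finB by (simp add: finite_PiE)
    have cardCu: "card Cu \<le> K"
    proof -
      define D where "D = (\<lambda>x. \<phi> (v x)) ` A"
      define sel where "sel s = (SOME x. x \<in> A \<and> \<phi> (v x) = s)" for s
      have sel: "sel s \<in> A \<and> \<phi> (v (sel s)) = s" if "s \<in> D" for s
      proof -
        have "\<exists>x. x \<in> A \<and> \<phi> (v x) = s" using that by (auto simp: D_def)
        then show ?thesis unfolding sel_def by (rule someI_ex)
      qed
      have finD: "finite D" using finA by (simp add: D_def)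
      have dp: "card D \<le> card A" using finA by (simp add: D_def card_image_le)
      have vR: "v x \<in> R" if "x \<in> A" for x using v that by (auto simp: I_def)
      have "D \<subseteq> {..<k}" using \<phi>k vR by (auto simp: D_def)
      then have dk: "card D \<le> k" using card_mono[of "{..<k}" D] by simp
      have "card Cu \<le> card {\<rho> \<in> D \<rightarrow>\<^sub>E {..<k}. inj_on \<rho> D}"
      proof (rule card_inj_on_le[where f = "\<lambda>c. restrict (\<lambda>s. c (h (sel s))) D"])
        show "inj_on (\<lambda>c. restrict (\<lambda>s. c (h (sel s))) D) Cu"
        proof (rule inj_onI)
          fix c c' assume cc: "c \<in> Cu" "c' \<in> Cu" and eq: "restrict (\<lambda>s. c (h (sel s))) D = restrict (\<lambda>s. c' (h (sel s))) D"
          have "c y = c' y" for y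
          proof (cases "y \<in> B")
            case False then show ?thesis using cc by (auto simp: Cu_def PiE_def extensional_def)
          next
            case True
            then obtain x where x: "x \<in> A" "y = h x" by (auto simp: B_def)
            have s: "\<phi> (v x) \<in> D" using x by (auto simp: D_def)
            have "c (h (sel (\<phi> (v x)))) = c' (h (sel (\<phi> (v x))))" using fun_cong[OF eq, of "\<phi> (v x)"] s by simp
            moreover have "c (h (sel (\<phi> (v x)))) = c (h x)" "c' (h (sel (\<phi> (v x)))) = c' (h x)"
              using cc x sel[OF s] by (auto simp: Cu_def)
            ultimately show ?thesis using x by simp
          qed
          then show "c = c'" by (rule ext)
        qed
        show "(\<lambda>c. restrict (\<lambda>s. c (h (sel s))) D) ` Cu \<subseteq> {\<rho> \<in> D \<rightarrow>\<^sub>E {..<k}. inj_on \<rho> D}"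
        proof (rule image_subsetI)
          fix c assume c: "c \<in> Cu"
          have 1: "c (h (sel s)) \<in> {..<k}" if "s \<in> D" for s using c sel[OF that] by (auto simp: Cu_def B_def)
          have 2: "s = t" if st: "s \<in> D" "t \<in> D" "c (h (sel s)) = c (h (sel t))" for s t
          proof -
            have "\<phi> (v (sel s)) = \<phi> (v (sel t))" using c sel[OF st(1)] sel[OF st(2)] st(3) unfolding Cu_def by blast
            then show ?thesis using sel[OF st(1)] sel[OF st(2)] by simp
          qed
          show "restrict (\<lambda>s. c (h (sel s))) D \<in> {\<rho> \<in> D \<rightarrow>\<^sub>E {..<k}. inj_on \<rho> D}"
            using 1 2 by (auto simp: inj_on_def)
        qed
        show "finite {\<rho> \<in> D \<rightarrow>\<^sub>E {..<k}. inj_on \<rho> D}" using finD by (simp add: finite_PiE)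
      qed
      also have "\<dots> = (\<Prod>i<card D. k - i)"
        using card_inj_on_subset_funcset[OF finD, of "{..<k}" D] by (simp add: lessThan_atLeast0)
      also have "\<dots> \<le> K" using K dp dk by simp
      finally show ?thesis .
    qed
    have "card {g \<in> S. restrict g A = v} \<le> (fact (N - 2 * p) * l ^ p) * card Cu"
    proof (rule card_le_fibers[where f = "\<lambda>g. restrict (\<lambda>y. \<phi> (g y)) B"])
      show "finite {g \<in> S. restrict g A = v}" using finS by simp
      show "finite Cu" by (rule finCu)
      show "(\<lambda>g. restrict (\<lambda>y. \<phi> (g y)) B) ` {g \<in> S. restrict g A = v} \<subseteq> Cu"
      proof (rule image_subsetI)
        fix g assume "g \<in> {g \<in> S. restrict g A = v}"
        then have g: "g \<in> S" "restrict g A = v" by auto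
        have "v x = g x" if "x \<in> A" for x using g(2) that by auto
        then show "restrict (\<lambda>y. \<phi> (g y)) B \<in> Cu"
          using g(1) \<phi>k gR ABR unfolding Cu_def B_def S_def by auto
      qed
      fix c
      show "card {g \<in> {g \<in> S. restrict g A = v}. restrict (\<lambda>y. \<phi> (g y)) B = c} \<le> fact (N - 2 * p) * l ^ p"
      proof -
        let ?T = "{g \<in> {g \<in> S. restrict g A = v}. restrict (\<lambda>y. \<phi> (g y)) B = c}"
        have "card ?T \<le> fact (N - 2 * p) * card (Pi\<^sub>E B (\<lambda>y. {z \<in> R. \<phi> z = c y}))"
        proof (rule card_le_fibers[where f = "\<lambda>g. restrict g B"])
          show "finite ?T" using finS by simp
          show "finite (Pi\<^sub>E B (\<lambda>y. {z \<in> R. \<phi> z = c y}))" using finB R by (intro finite_PiE) auto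
          show "(\<lambda>g. restrict g B) ` ?T \<subseteq> Pi\<^sub>E B (\<lambda>y. {z \<in> R. \<phi> z = c y})"
            using gR ABR by auto
          fix w
          have "{g \<in> ?T. restrict g B = w} \<subseteq> {g. g permutes R \<and> (\<forall>x\<in>A \<union> B. g x = (if x \<in> A then v x else w x))}"
            using dis by (auto simp: S_def B_def)
          then have "card {g \<in> ?T. restrict g B = w} \<le> card {g. g permutes R \<and> (\<forall>x\<in>A \<union> B. g x = (if x \<in> A then v x else w x))}"
            by (rule card_mono[rotated]) (rule finite_subset[OF _ finite_permutations[OF R]], auto)
          also have "\<dots> \<le> fact (card R - card (A \<union> B))" by (rule card_permutes_extending[OF R ABR])
          finally show "card {g \<in> ?T. restrict g B = w} \<le> fact (N - 2 * p)" using cAB by (simp add: N_def)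
        qed
        also have "\<dots> \<le> fact (N - 2 * p) * l ^ p"
        proof (rule mult_le_mono2)
          have "card (Pi\<^sub>E B (\<lambda>y. {z \<in> R. \<phi> z = c y})) = (\<Prod>y\<in>B. card {z \<in> R. \<phi> z = c y})" by (rule card_PiE[OF finB])
          also have "\<dots> \<le> (\<Prod>y\<in>B. l)" by (intro prod_mono) (use cl in auto)
          also have "\<dots> = l ^ p" using cB by simp
          finally show "card (Pi\<^sub>E B (\<lambda>y. {z \<in> R. \<phi> z = c y})) \<le> l ^ p" .
        qed
        finally show ?thesis .
      qed
    qed
    also have "\<dots> \<le> (fact (N - 2 * p) * l ^ p) * K" using cardCu by simp
    finally show ?thesis .
  qed
  have "card S \<le> (fact (N - 2 * p) * l ^ p) * K * card I"
  proof (rule card_le_fibers[OF finS finI _ fib])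
    show "(\<lambda>g. restrict g A) ` S \<subseteq> I"
    proof (rule image_subsetI)
      fix g assume g: "g \<in> S"
      then have "inj g" by (auto simp: S_def permutes_inj)
      then show "restrict g A \<in> I" using gR[OF g] A by (auto simp: I_def inj_on_def inj_def)
    qed
  qed
  moreover have "card I = (\<Prod>i<p. N - i)"
    unfolding I_def using card_inj_on_subset_funcset[OF finA R, of A] by (simp add: p_def N_def lessThan_atLeast0)
  moreover have fac: "q \<le> M \<Longrightarrow> (\<Prod>i<q. M - i) * fact (M - q) = (fact M :: nat)" for q M
  proof (induction q)
    case (Suc q)
    then have "fact (M - q) = (M - q) * fact (M - Suc q)" by (metis Suc_diff_Suc Suc_le_lessD fact_Suc of_nat_id)
    then show ?case using Suc by (simp add: ac_simps)
  qed simp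
  moreover have "fact (N - 2 * p) * (N - 2 * p) ^ p \<le> (fact (N - p) :: nat)"
  proof -
    have "(N - 2 * p) ^ p = (\<Prod>i<p. N - 2 * p)" by simp
    also have "\<dots> \<le> (\<Prod>i<p. N - p - i)" by (intro prod_mono) auto
    finally have "(N - 2 * p) ^ p * fact (N - p - p) \<le> (\<Prod>i<p. N - p - i) * fact (N - p - p)" by simp
    also have "\<dots> = fact (N - p)" by (rule fac) (use N2p in simp)
    finally have "(N - 2 * p) ^ p * fact (N - p - p) \<le> (fact (N - p) :: nat)" .
    moreover have "N - p - p = N - 2 * p" by simp
    ultimately show ?thesis by (simp only: mult.commute)
  qed
  moreover have "(\<Prod>i<p. N - i) * fact (N - p) = (fact N :: nat)" by (rule fac) (use N2p in simp)
  ultimately have "card S * (N - 2 * p) ^ p \<le> fact N * K * l ^ p"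
  proof -
    assume cs: "card S \<le> fact (N - 2 * p) * l ^ p * K * card I" and cI: "card I = (\<Prod>i<p. N - i)"
      and f1: "fact (N - 2 * p) * (N - 2 * p) ^ p \<le> (fact (N - p) :: nat)" and f2: "(\<Prod>i<p. N - i) * fact (N - p) = (fact N :: nat)"
    have "card S * (N - 2 * p) ^ p \<le> (fact (N - 2 * p) * (N - 2 * p) ^ p) * (l ^ p * K * (\<Prod>i<p. N - i))"
      using mult_le_mono1[OF cs, of "(N - 2 * p) ^ p"] cI by (simp add: ac_simps)
    also have "\<dots> \<le> fact (N - p) * (l ^ p * K * (\<Prod>i<p. N - i))" using f1 by (rule mult_le_mono1)
    also have "\<dots> = fact N * K * l ^ p" using f2 by (simp add: ac_simps)
    finally show ?thesis .
  qed
  then show ?thesis by (simp add: S_def N_def p_def)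
qed

lemma sum_card_swap:
  assumes "finite G" "finite T"
  shows "(\<Sum>g\<in>G. card {h \<in> T. R g h}) = (\<Sum>h\<in>T. card {g \<in> G. R g h})"
proof -
  have "(\<Sum>g\<in>G. card {h \<in> T. R g h}) = (\<Sum>g\<in>G. \<Sum>h\<in>T. if R g h then 1 else 0)"
    using assms by (intro sum.cong) (auto simp: sum.If_cases Int_def)
  also have "\<dots> = (\<Sum>h\<in>T. \<Sum>g\<in>G. if R g h then 1 else 0)" by (rule sum.swap)
  also have "\<dots> = (\<Sum>h\<in>T. card {g \<in> G. R g h})" using assms by (intro sum.cong) (auto simp: sum.If_cases Int_def)
  finally show ?thesis .
qed

section \<open>Singleton cells and the first moment method\<close>

context kl_parts
begin

lemma St_same_part: assumes "h \<in> St Q" "P \<in> Q" "Q \<subseteq> Om" "x \<in> X"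
  shows "same_part P (h x) = h ` same_part P x"
proof -
  have P: "P \<in> Om" using assms by auto
  have "h ` same_part P x \<in> P" "h x \<in> h ` same_part P x"
    using same_part_in[OF P assms(4)] St_image[OF assms(1,2)] by auto
  then show ?thesis using same_part_eq[OF P] by blast
qed

lemma St_cell: assumes "h \<in> St Q" "Q \<subseteq> Om" "x \<in> X" shows "cell Q (h x) = h ` cell Q x"
proof -
  have hp: "h permutes X" using assms(1) by (simp add: St_iff)
  have inj: "inj h" by (rule permutes_inj[OF hp])
  have "y \<in> cell Q (h x) \<longleftrightarrow> y \<in> h ` cell Q x" for y
  proof -
    obtain z where z: "y = h z" using permutes_surj[OF hp] by (metis surjD)
    have "h z \<in> cell Q (h x) \<longleftrightarrow> z \<in> cell Q x"
      using St_same_part[OF assms(1) _ assms(2,3)] permutes_in_image[OF hp] inj by (auto simp: cell_def inj_image_mem_iff)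
    then show ?thesis using z inj by (simp add: inj_image_mem_iff)
  qed
  then show ?thesis by blast
qed

definition sing :: "nat set set set \<Rightarrow> nat set" where "sing Q = {x \<in> X. cell Q x = {x}}"

lemma sing_sub: "sing Q \<subseteq> X" by (auto simp: sing_def)

lemma finite_sing: "finite (sing Q)" by (rule finite_subset[OF sing_sub finite_X])

lemma St_sing: assumes "h \<in> St Q" "Q \<subseteq> Om" shows "h ` sing Q = sing Q"
proof -
  have hp: "h permutes X" using assms(1) by (simp add: St_iff)
  have "h x \<in> sing Q" if "x \<in> sing Q" for x
    using that St_cell[OF assms, of x] permutes_in_image[OF hp] by (auto simp: sing_def)
  then have "h ` sing Q \<subseteq> sing Q" by auto
  moreover have "card (h ` sing Q) = card (sing Q)" using permutes_inj_on[OF hp] by (rule card_image)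
  ultimately show ?thesis using finite_sing card_subset_eq by metis
qed

lemma two_le_lf: "2 \<le> c \<Longrightarrow> real c \<le> 2 * lf c"
proof (induction c rule: dec_induct)
  case base then show ?case by (simp add: lf_small)
next
  case (step n)
  define L where "L = log 2 (1 + real n)"
  have "1 \<le> L" using step.hyps unfolding L_def by simp
  then show ?case using step.IH unfolding lf_Suc L_def[symmetric] by simp
qed

text \<open>A cell with c \<ge> 2 points contributes log2 c! \<ge> c / 2. So a small stabilizer
  leaves few points outside singleton cells, and nearly all points may be permuted at random without
  changing the cell sizes.\<close>

lemma card_nonsing_le: assumes "Q \<subseteq> Om" shows "real (card (X - sing Q)) \<le> 2 * V lf Q"
proof -
  let ?T = "{C \<in> cells Q. card C \<noteq> 1}"
  have "X - sing Q \<subseteq> \<Union>?T"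
  proof
    fix x assume x: "x \<in> X - sing Q"
    have "x \<in> cell Q x" "cell Q x \<in> cells Q" using x mem_cell[OF assms] cell_in_cells by auto
    moreover have "card (cell Q x) \<noteq> 1"
    proof
      assume "card (cell Q x) = 1"
      then have "cell Q x = {x}" using \<open>x \<in> cell Q x\<close> by (metis card_1_singletonE singletonD)
      then show False using x by (auto simp: sing_def)
    qed
    ultimately show "x \<in> \<Union>?T" by auto
  qed
  then have "card (X - sing Q) \<le> card (\<Union>?T)" using finite_in_cells finite_cells by (intro card_mono) auto
  also have "\<dots> \<le> (\<Sum>C\<in>?T. card C)" using finite_in_cells by (intro card_Union_le_sum_card)
  finally have "real (card (X - sing Q)) \<le> (\<Sum>C\<in>?T. real (card C))" by (simp only: of_nat_le_iff of_nat_sum[symmetric])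
  also have "\<dots> \<le> (\<Sum>C\<in>?T. 2 * lf (card C))"
  proof (rule sum_mono)
    fix C assume C: "C \<in> ?T"
    then have "C \<noteq> {}" "finite C" "card C \<noteq> 1" using cells_nonempty[OF assms] finite_in_cells by auto
    then have "2 \<le> card C" by (metis One_nat_def Suc_leI card_gt_0_iff le_neq_implies_less numeral_2_eq_2)
    then show "real (card C) \<le> 2 * lf (card C)" by (rule two_le_lf)
  qed
  also have "\<dots> \<le> (\<Sum>C\<in>cells Q. 2 * lf (card C))"
    by (intro sum_mono2) (auto simp: finite_cells lf_nonneg)
  finally show ?thesis by (simp add: V_def sum_distrib_left)
qed

lemma card_residue_full: "s < k \<Longrightarrow> card {t. t < k * l \<and> t mod k = s} = l"
proof -
  assume s: "s < k"
  have "{t. t < k * l \<and> t mod k = s} = (\<lambda>i. i * k + s) ` {..<l}"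
  proof (intro equalityI subsetI)
    fix t assume t: "t \<in> {t. t < k * l \<and> t mod k = s}"
    then have "t div k < l" using k2 by (simp add: div_less_iff_less_mult mult.commute)
    moreover have "t = t div k * k + s" using t div_mult_mod_eq[of t k] by simp
    ultimately show "t \<in> (\<lambda>i. i * k + s) ` {..<l}" by blast
  next
    fix t assume "t \<in> (\<lambda>i. i * k + s) ` {..<l}"
    then obtain i where i: "i < l" "t = i * k + s" by auto
    have "Suc i * k \<le> l * k" using i by (intro mult_le_mono1) simp
    then show "t \<in> {t. t < k * l \<and> t mod k = s}" using i s by (simp add: mult.commute)
  qed
  moreover have "inj_on (\<lambda>i. i * k + s) {..<l}" using k2 by (auto simp: inj_on_def)
  ultimately show ?thesis by (simp add: card_image)
qed

text \<open>Enumerating the nonsingleton cells first gives each colour at most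
  \<open>card (X - sing Q) div k + 1\<close> points there. By \<open>m\<close> this is less than
  \<open>l\<close>, so each colour also occurs on a singleton cell.\<close>

lemma balanced_colouring:
  assumes Q: "Q \<subseteq> Om" and m: "card (X - sing Q) div k + 1 < l"
  obtains \<phi> where "colouring \<phi>" "\<And>C. C \<in> cells Q \<Longrightarrow> (\<Sum>s<k. lf (card (C \<inter> cls \<phi> s))) = wbal (card C)"
    "\<And>s. s < k \<Longrightarrow> cls \<phi> s \<inter> sing Q \<noteq> {}"
proof -
  \<comment> \<open>The offset exceeds every least element of a cell: it moves singletons to the end
    and keeps the keys of different cells distinct.\<close>
  define key where "key x = Min (cell Q x) + (if x \<in> sing Q then k * l + 1 else 0)" for x
  obtain pos where pos: "bij_betw pos X {..<card X}" "\<And>v. \<exists>r. pos ` {x \<in> X. key x = v} = {r..<r + card {x \<in> X. key x = v}}"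
    "\<And>x y. x \<in> X \<Longrightarrow> y \<in> X \<Longrightarrow> key x < key y \<Longrightarrow> pos x < pos y"
    using contiguous_enumeration[OF finite_X, of key] by (elim exE conjE) blast
  define \<phi> where "\<phi> x = pos x mod k" for x
  have injX: "inj_on pos X" and imX: "pos ` X = {..<k * l}" using pos(1) card_X by (auto simp: bij_betw_def)
  have Minle: "Min (cell Q x) \<in> cell Q x" "Min (cell Q x) \<le> k * l" if "x \<in> X" for x
  proof -
    show "Min (cell Q x) \<in> cell Q x" using Min_in[OF finite_cell] mem_cell[OF Q that] by blast
    then show "Min (cell Q x) \<le> k * l" using cell_subset[of Q x] by (auto simp: X_def)
  qed
  have cnt: "card (Y \<inter> cls \<phi> s) = card {t \<in> pos ` Y. t mod k = s}" if "Y \<subseteq> X" for Y s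
  proof -
    have "bij_betw pos (Y \<inter> cls \<phi> s) {t \<in> pos ` Y. t mod k = s}"
    proof (rule bij_betw_imageI)
      show "inj_on pos (Y \<inter> cls \<phi> s)" using that by (intro inj_on_subset[OF injX]) auto
    qed (use that in \<open>auto simp: cls_def \<phi>_def\<close>)
    then show ?thesis by (rule bij_betw_same_card)
  qed
  have col: "colouring \<phi>"
    unfolding colouring_def
  proof (intro conjI ballI allI impI)
    fix s assume s: "s < k"
    have "{t \<in> pos ` X. t mod k = s} = {t. t < k * l \<and> t mod k = s}" using imX by auto
    then have "card (X \<inter> cls \<phi> s) = l" using cnt[of X s] card_residue_full[OF s] by simp
    moreover have "X \<inter> cls \<phi> s = cls \<phi> s" by (auto simp: cls_def)
    ultimately show "card (cls \<phi> s) = l" by simp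
  qed (use k2 in \<open>auto simp: \<phi>_def\<close>)
  have cellkey: "C = {y \<in> X. key y = key x}" if C: "C \<in> cells Q" "x \<in> C" for C x
  proof -
    have Cx: "C = cell Q x" "x \<in> X" using cells_eqI[OF Q C] in_cells_subset[OF C(1)] C(2) by auto
    have sng: "y \<in> sing Q \<longleftrightarrow> card (cell Q y) = 1" if "y \<in> X" for y
    proof
      assume "card (cell Q y) = 1"
      then have "cell Q y = {y}" using mem_cell[OF Q that] by (metis card_1_singletonE singletonD)
      then show "y \<in> sing Q" using that by (simp add: sing_def)
    qed (simp add: sing_def)
    show ?thesis
    proof (intro equalityI subsetI)
      fix y assume y: "y \<in> C"
      then have "y \<in> X" "cell Q y = cell Q x" using cell_eq[OF Q Cx(2), of y] Cx cell_subset by auto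
      then show "y \<in> {y \<in> X. key y = key x}" using sng[of x] sng[of y] Cx by (simp add: key_def)
    next
      fix y assume "y \<in> {y \<in> X. key y = key x}"
      then have y: "y \<in> X" "key y = key x" by auto
      have "Min (cell Q y) = Min (cell Q x)"
        using y(2) Minle(2)[OF y(1)] Minle(2)[OF Cx(2)] by (auto simp: key_def split: if_splits)
      then have "Min (cell Q x) \<in> cell Q y" using Minle(1)[OF y(1)] by simp
      then have "cell Q (Min (cell Q x)) = cell Q y" using cell_eq[OF Q y(1)] by simp
      moreover have "cell Q (Min (cell Q x)) = cell Q x" using cell_eq[OF Q Cx(2) Minle(1)[OF Cx(2)]] .
      ultimately show "y \<in> C" using mem_cell[OF Q y(1)] Cx by simp
    qed
  qed
  have bal: "(\<Sum>s<k. lf (card (C \<inter> cls \<phi> s))) = wbal (card C)" if C: "C \<in> cells Q" for C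
  proof -
    obtain x where x: "x \<in> C" using cells_nonempty[OF Q C] by auto
    obtain r where "pos ` C = {r..<r + card C}" using pos(2)[of "key x"] cellkey[OF C x] by auto
    then show ?thesis
      using sum_lf_interval(2)[of pos C r \<phi> 0] inj_on_subset[OF injX in_cells_subset[OF C]] in_cells_subset[OF C]
      by (simp add: \<phi>_def)
  qed
  have "cls \<phi> s \<inter> sing Q \<noteq> {}" if s: "s < k" for s
  proof
    assume emp: "cls \<phi> s \<inter> sing Q = {}"
    define M where "M = X - sing Q"
    have finM: "finite M" using finite_X by (simp add: M_def)
    have "pos x < card M" if x: "x \<in> M" for x
    proof (rule ccontr)
      assume "\<not> pos x < card M"
      then have ge: "card M \<le> pos x" by simp
      have xX: "x \<in> X" using x by (simp add: M_def)
      have "pos x < k * l" using imX xX by auto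
      have "{..<pos x} \<subseteq> pos ` (M - {x})"
      proof
        fix t assume t: "t \<in> {..<pos x}"
        then have "t \<in> pos ` X" using imX \<open>pos x < k * l\<close> by auto
        then obtain y where y: "y \<in> X" "pos y = t" by auto
        have "y \<in> M"
        proof (rule ccontr)
          assume "y \<notin> M"
          then have "key x < key y" using x y xX Minle(2)[OF xX] by (auto simp: key_def M_def)
          then show False using pos(3)[OF xX y(1)] y t by auto
        qed
        then show "t \<in> pos ` (M - {x})" using y t by auto
      qed
      then have "pos x \<le> card (pos ` (M - {x}))" using finM card_mono[of "pos ` (M - {x})" "{..<pos x}"] by simp
      also have "\<dots> \<le> card (M - {x})" using finM by (intro card_image_le) simp
      also have "\<dots> < card M" by (rule card_Diff1_less[OF finM x])
      finally show False using ge by simp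
    qed
    then have "{t \<in> pos ` M. t mod k = s} \<subseteq> {y. y < card M \<and> (0 + y) mod k = s}" by auto
    then have "card {t \<in> pos ` M. t mod k = s} \<le> card {y. y < card M \<and> (0 + y) mod k = s}"
      by (rule card_mono[rotated]) (rule finite_subset[of _ "{..<card M}"], auto)
    also have "\<dots> \<le> card M div k + 1" using card_residue_bounds(2)[of k s "card M" 0] s k2 by simp
    finally have "card (M \<inter> cls \<phi> s) < l" using cnt[of M s] m by (simp add: M_def)
    moreover have "M \<inter> cls \<phi> s = cls \<phi> s" using emp by (auto simp: M_def cls_def)
    ultimately show False using col s by (simp add: colouring_def)
  qed
  then show ?thesis using that col bal by blast
qed



lemma colouring_comp:
  assumes col: "colouring \<phi>" and g: "g permutes X"
  shows "colouring (\<phi> \<circ> g)" "card (C \<inter> cls (\<phi> \<circ> g) s) = card (g ` C \<inter> cls \<phi> s)"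
proof -
  have gX: "g x \<in> X \<longleftrightarrow> x \<in> X" for x by (rule permutes_in_image[OF g])
  have inj: "inj g" by (rule permutes_inj[OF g])
  have img: "g ` (C \<inter> cls (\<phi> \<circ> g) s) = g ` C \<inter> cls \<phi> s" for C s
    using gX inj by (auto simp: cls_def inj_def)
  show *: "card (C \<inter> cls (\<phi> \<circ> g) s) = card (g ` C \<inter> cls \<phi> s)" for C s
    using img[of C s] card_image[OF inj_on_subset[OF inj, of "C \<inter> cls (\<phi> \<circ> g) s"]] by simp
  have "card (cls (\<phi> \<circ> g) s) = card (cls \<phi> s)" for s
  proof -
    have "X \<inter> cls \<psi> s = cls \<psi> s" for \<psi> by (auto simp: cls_def)
    then show ?thesis using *[of X s] permutes_image[OF g] by simp
  qed
  then show "colouring (\<phi> \<circ> g)" using col gX by (auto simp: colouring_def)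
qed

lemma Pcol_stab:
  assumes col: "colouring \<phi>" and h: "h \<in> St {Pcol \<phi>}" and xy: "x \<in> X" "y \<in> X"
  shows "\<phi> x = \<phi> y \<longleftrightarrow> \<phi> (h x) = \<phi> (h y)"
proof -
  have P: "Pcol \<phi> \<in> Om" by (rule Pcol_in_Om[OF col])
  have sp: "same_part (Pcol \<phi>) z = cls \<phi> (\<phi> z)" if "z \<in> X" for z
    by (rule same_part_eq[OF P]) (use that col in \<open>auto simp: Pcol_def colouring_def cls_def\<close>)
  have hp: "h permutes X" using h by (simp add: St_iff)
  have hX: "h x \<in> X" "h y \<in> X" using permutes_in_image[OF hp] xy by auto
  have e: "h ` cls \<phi> (\<phi> x) = cls \<phi> (\<phi> (h x))"
    using St_same_part[OF h _ _ xy(1)] P sp[OF xy(1)] sp[OF hX(1)] by simp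
  have "y \<in> cls \<phi> (\<phi> x) \<longleftrightarrow> h y \<in> h ` cls \<phi> (\<phi> x)"
    using permutes_inj[OF hp] by (simp add: inj_image_mem_iff)
  then have "y \<in> cls \<phi> (\<phi> x) \<longleftrightarrow> h y \<in> cls \<phi> (\<phi> (h x))" by (simp only: e)
  then show ?thesis using xy hX by (auto simp: cls_def)
qed

text \<open>First moment over all permutations \<open>g\<close> of the singleton cells, applied to
  one balanced colouring. A part is good if it contains at least \<open>p\<close> singleton cells.
  Elements fixing all good parts are controlled by their action on the at most \<open>B\<close> bad
  parts of each partition: the first summand. An element moving a good part makes it disjoint from
  itself, and \<open>card_matching_permutations\<close> bounds how often it fixes the candidate: the
  second summand.\<close>

lemma random_refinement:
  assumes Q: "Q \<subseteq> Om" and finQ: "finite Q" and m: "card (X - sing Q) div k + 1 < l"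
    and bad: "\<And>P. P \<in> Q \<Longrightarrow> card {A \<in> P. card (A \<inter> sing Q) < p} \<le> B"
    and K: "\<And>d. d \<le> p \<Longrightarrow> d \<le> k \<Longrightarrow> (\<Prod>i<d. k - i) \<le> K" and p: "2 * p < card (sing Q)"
  shows "\<exists>b\<in>Om. real (card (St (insert b Q))) \<le> 2 powr V wbal Q * real B ^ (card Q * B) +
    real (card (St Q)) * (real K * real l ^ p / real (card (sing Q) - 2 * p) ^ p)"
proof -
  define R where "R = sing Q"
  define N where "N = card R"
  obtain \<phi> where col: "colouring \<phi>" and bal: "\<And>C. C \<in> cells Q \<Longrightarrow> (\<Sum>s<k. lf (card (C \<inter> cls \<phi> s))) = wbal (card C)"
    and single: "\<And>s. s < k \<Longrightarrow> cls \<phi> s \<inter> R \<noteq> {}"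
    using balanced_colouring[OF Q m] unfolding R_def by blast
  have RX: "R \<subseteq> X" and finR: "finite R" using sing_sub finite_sing by (auto simp: R_def)
  define G where "G = {g. g permutes R}"
  have finG: "finite G" and cG: "card G = fact N" using finR by (auto simp: G_def N_def finite_permutations card_permutations)
  define b where "b g = Pcol (\<phi> \<circ> g)" for g
  have gX: "g permutes X" if "g \<in> G" for g using that permutes_subset[OF _ RX] by (simp add: G_def)
  have colg: "colouring (\<phi> \<circ> g)" if "g \<in> G" for g by (rule colouring_comp(1)[OF col gX[OF that]])
  have bOm: "b g \<in> Om" if "g \<in> G" for g unfolding b_def by (rule Pcol_in_Om[OF colg[OF that]])
  \<comment> \<open>\<open>g\<close> only exchanges singleton cells, so all candidates refine
    \<open>Q\<close> equally evenly.\<close>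
  have VV: "V lf (insert (b g) Q) = V wbal Q" if g: "g \<in> G" for g
  proof -
    have gC: "g ` C = C \<or> card C = 1 \<and> card (g ` C) = 1" if C: "C \<in> cells Q" for C
    proof (cases "C \<inter> R = {}")
      case True
      have "g x = x" if "x \<in> C" for x using g True that permutes_not_in[of g R x] by (auto simp: G_def)
      then show ?thesis by (metis image_cong image_ident)
    next
      case False
      then obtain x where x: "x \<in> C" "cell Q x = {x}" by (auto simp: R_def sing_def)
      then have "C = {x}" using cells_eqI[OF Q C x(1)] by simp
      then show ?thesis by simp
    qed
    have one: "(\<Sum>s<k. lf (card (D \<inter> cls \<phi> s))) = 0" if D: "card D = 1" for D
    proof (rule sum.neutral, rule ballI)
      fix s
      have "card (D \<inter> cls \<phi> s) \<le> 1" using card_mono[of D "D \<inter> cls \<phi> s"] D by (metis Int_lower1 card.infinite zero_neq_one)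
      then show "lf (card (D \<inter> cls \<phi> s)) = 0" using lf_small by (metis le_SucE le_zero_eq One_nat_def)
    qed
    have "(\<Sum>s<k. lf (card (C \<inter> cls (\<phi> \<circ> g) s))) = wbal (card C)" if C: "C \<in> cells Q" for C
    proof -
      have "(\<Sum>s<k. lf (card (C \<inter> cls (\<phi> \<circ> g) s))) = (\<Sum>s<k. lf (card (g ` C \<inter> cls \<phi> s)))"
        by (simp only: colouring_comp(2)[OF col gX[OF g]])
      also have "\<dots> = wbal (card C)"
      proof (cases "g ` C = C")
        case True then show ?thesis using bal[OF C] by simp
      next
        case False
        then have "card C = 1" "card (g ` C) = 1" using gC[OF C] by auto
        then show ?thesis using one bal[OF C] by metis
      qed
      finally show ?thesis .
    qed
    then show ?thesis unfolding b_def
      by (subst V_insert_Pcol[OF Q colg[OF g]]) (auto simp: lf_small V_def)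
  qed
  define good where "good A \<longleftrightarrow> p \<le> card (A \<inter> R)" for A
  define T where "T = {h \<in> St Q. \<exists>P\<in>Q. \<exists>A\<in>P. good A \<and> h ` A \<noteq> A}"
  define L where "L g = {h \<in> St (insert (b g) Q). \<forall>P\<in>Q. \<forall>A\<in>P. good A \<longrightarrow> h ` A = A}" for g
  have finSt: "finite (St Q')" for Q' by (rule finite_perm_group[OF perm_group_St finite_X])
  have hR: "h ` R = R" if "h \<in> St Q" for h using St_sing[OF that Q] by (simp add: R_def)
  have hp: "h permutes X" if "h \<in> St Q'" for h Q' using that by (simp add: St_iff)
  have sub: "St (insert c Q) \<subseteq> St Q" for c by (auto simp: St_iff)
  have cardL: "real (card (L g)) \<le> 2 powr V wbal Q * real B ^ (card Q * B)" if g: "g \<in> G" for g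
  proof -
    define bd where "bd P = {A \<in> P. \<not> good A}" for P
    define I where "I = Sigma Q bd"
    have cbd: "card (bd P) \<le> B" "finite (bd P)" if "P \<in> Q" for P
      using bad[OF that] Q that OmD(4)[of P] by (auto simp: bd_def good_def R_def not_le)
    have finI: "finite I" unfolding I_def using finQ cbd by auto
    have "card I = (\<Sum>P\<in>Q. card (bd P))" unfolding I_def using finQ cbd by simp
    also have "\<dots> \<le> (\<Sum>P\<in>Q. B)" by (intro sum_mono cbd)
    finally have cI: "card I \<le> card Q * B" by simp
    let ?F = "Fx (insert (b g) Q)"
    have "card (L g) \<le> card ?F * card (Pi\<^sub>E I (\<lambda>(P, A). bd P))"
    proof (rule card_le_cosets[where f = "\<lambda>h. restrict (\<lambda>(P, A). h ` A) I"])
      show "finite (L g)" using finSt by (simp add: L_def)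
      show "finite ?F" by (rule finite_perm_group[OF perm_group_Fx finite_X])
      show "finite (Pi\<^sub>E I (\<lambda>(P, A). bd P))" using finI cbd by (intro finite_PiE) (auto simp: I_def)
      show "bij h" if "h \<in> L g" for h using that hp permutes_bij by (auto simp: L_def)
      show "(\<lambda>h. restrict (\<lambda>(P, A). h ` A) I) ` L g \<subseteq> Pi\<^sub>E I (\<lambda>(P, A). bd P)"
      proof (rule image_subsetI)
        fix h assume "h \<in> L g"
        then have h: "h \<in> St Q" using sub by (auto simp: L_def)
        have "h ` A \<in> bd P" if "P \<in> Q" "A \<in> bd P" for P A
        proof -
          have "h ` A \<inter> R = h ` (A \<inter> R)" using hR[OF h] permutes_inj[OF hp[OF h]] by (simp add: image_Int)
          then have "card (h ` A \<inter> R) = card (A \<inter> R)" using permutes_inj_on[OF hp[OF h]] by (simp add: card_image)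
          then show ?thesis using that St_image[OF h that(1)] by (auto simp: bd_def good_def)
        qed
        then show "restrict (\<lambda>(P, A). h ` A) I \<in> Pi\<^sub>E I (\<lambda>(P, A). bd P)" by (auto simp: I_def)
      qed
      fix h h' assume hh: "h \<in> L g" "h' \<in> L g" and eq: "restrict (\<lambda>(P, A). h ` A) I = restrict (\<lambda>(P, A). h' ` A) I"
      have hS: "h \<in> St (insert (b g) Q)" "h' \<in> St (insert (b g) Q)" using hh by (auto simp: L_def)
      define w where "w = inv h \<circ> h'"
      have wS: "w \<in> St (insert (b g) Q)" unfolding w_def
        by (rule perm_groupD(3)[OF perm_group_St perm_groupD(4)[OF perm_group_St hS(1)] hS(2)])
      have wQ: "w ` A = A" if PA: "P \<in> Q" "A \<in> P" for P A
      proof -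
        have "h' ` A = h ` A"
        proof (cases "good A")
          case True then show ?thesis using hh PA by (auto simp: L_def)
        next
          case False
          then have "(P, A) \<in> I" using PA by (auto simp: I_def bd_def)
          then show ?thesis using fun_cong[OF eq, of "(P, A)"] by simp
        qed
        then have "w ` A = inv h ` h ` A" by (simp only: w_def image_comp[symmetric])
        then show ?thesis using permutes_inj[OF hp[OF hS(1)]] by (simp add: image_inv_f_f)
      qed
      have wp: "w permutes X" by (rule hp[OF wS])
      \<comment> \<open>\<open>w\<close> fixes the singleton cells pointwise, and every class of the
        candidate contains one, so no class can move.\<close>
      have wR: "w x = x" if "x \<in> R" for x
      proof -
        have xX: "x \<in> X" and cx: "cell Q x = {x}" using that by (auto simp: R_def sing_def)
        have "w x \<in> cell Q x"
        proof -
          have "w x \<in> same_part P x" if "P \<in> Q" for P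
            using wQ[OF that] same_part_in[of P x] Q that xX by blast
          then show ?thesis using permutes_in_image[OF wp] xX by (simp add: cell_def)
        qed
        then show ?thesis using cx by simp
      qed
      have "w ` A = A" if A: "A \<in> b g" for A
      proof -
        obtain s where s: "s < k" "A = cls (\<phi> \<circ> g) s" using A by (auto simp: b_def Pcol_def)
        obtain y where y: "y \<in> cls \<phi> s" "y \<in> R" using single[OF s(1)] by auto
        have gp: "g permutes R" using g by (simp add: G_def)
        define x where "x = inv g y"
        have xR: "x \<in> R" unfolding x_def using permutes_in_image[OF permutes_inv[OF gp]] y by simp
        have "g x = y" unfolding x_def using permutes_inverses(1)[OF gp] by simp
        then have xA: "x \<in> A" using s y xR RX by (auto simp: cls_def)
        have "w ` A \<in> b g" using St_image[OF wS, of "b g"] A by simp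
        moreover have "x \<in> w ` A" using wR[OF xR] xA by force
        ultimately show ?thesis using OmD(7)[OF bOm[OF g]] A xA by blast
      qed
      then show "inv h \<circ> h' \<in> ?F" using wQ wp by (auto simp: Fx_def w_def)
    qed
    moreover have "card (Pi\<^sub>E I (\<lambda>(P, A). bd P)) \<le> B ^ (card Q * B)"
    proof -
      have "card (Pi\<^sub>E I (\<lambda>(P, A). bd P)) = (\<Prod>i\<in>I. card (case i of (P, A) \<Rightarrow> bd P))" by (rule card_PiE[OF finI])
      also have "\<dots> \<le> (\<Prod>i\<in>I. B)" by (intro prod_mono) (use cbd in \<open>auto simp: I_def\<close>)
      also have "\<dots> = B ^ card I" by simp
      also have "\<dots> \<le> B ^ (card Q * B)"
      \<comment> \<open>Here 0 ^ 0 = 1: without bad parts only the part-fixing group remains in the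
        first summand.\<close>
      proof (cases "B = 0")
        case True then show ?thesis using cI by simp
      next
        case False then show ?thesis using cI by (intro power_increasing) auto
      qed
      finally show ?thesis .
    qed
    ultimately have "card (L g) \<le> card ?F * B ^ (card Q * B)" by (meson le_trans mult_le_mono2)
    then have "real (card (L g)) \<le> real (card ?F) * real B ^ (card Q * B)" by (simp only: of_nat_mult[symmetric] of_nat_power[symmetric] of_nat_le_iff)
    moreover have "real (card ?F) = 2 powr V wbal Q" using card_Fx[of "insert (b g) Q"] VV[OF g] Q bOm[OF g] by simp
    ultimately show ?thesis by simp
  qed
  define \<Gamma> where "\<Gamma> = real K * real l ^ p / real (N - 2 * p) ^ p"
  have N2p: "0 < N - 2 * p" using p by (simp add: N_def R_def)
  have one: "real (card {g \<in> G. h \<in> St {b g}}) \<le> real (fact N) * \<Gamma>" if h: "h \<in> T" for h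
  proof -
    obtain P A where PA: "P \<in> Q" "A \<in> P" "good A" "h ` A \<noteq> A" and hS: "h \<in> St Q" using h by (auto simp: T_def)
    have POm: "P \<in> Om" using PA Q by auto
    obtain A' where A': "A' \<subseteq> A \<inter> R" "card A' = p" using PA(3) obtain_subset_with_card_n unfolding good_def by metis
    have inj: "inj h" by (rule permutes_inj[OF hp[OF hS]])
    have dis: "A \<inter> h ` A = {}" using OmD(7)[OF POm PA(2) St_image[OF hS PA(1,2)]] PA(4) by blast
    have "card {g. g permutes R \<and> (\<forall>x\<in>A'. \<forall>y\<in>A'. \<phi> (g x) = \<phi> (g y) \<longleftrightarrow> \<phi> (g (h x)) = \<phi> (g (h y)))} *
      (card R - 2 * card A') ^ card A' \<le> fact (card R) * K * l ^ card A'"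
    proof (rule card_matching_permutations)
      show "finite R" by (rule finR)
      show "A' \<subseteq> R" "h ` A' \<subseteq> R" using A' hR[OF hS] by auto
      show "inj_on h A'" using inj by (rule inj_on_subset) simp
      show "A' \<inter> h ` A' = {}" using dis A' by blast
      show "\<phi> x < k" if "x \<in> R" for x using col that RX by (auto simp: colouring_def)
      show "card {x \<in> R. \<phi> x = s} \<le> l" for s
      proof (cases "s < k")
        case True
        have "card {x \<in> R. \<phi> x = s} \<le> card (cls \<phi> s)" using RX finite_X by (intro card_mono) (auto simp: cls_def)
        then show ?thesis using True col by (simp add: colouring_def)
      next
        case False
        then have "{x \<in> R. \<phi> x = s} = {}" using col RX by (auto simp: colouring_def)
        then show ?thesis by (simp only: card.empty)
      qed
      show "(\<Prod>i<d. k - i) \<le> K" if "d \<le> card A'" "d \<le> k" for d using K that A' by simp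
    qed
    moreover have "{g \<in> G. h \<in> St {b g}} \<subseteq> {g. g permutes R \<and> (\<forall>x\<in>A'. \<forall>y\<in>A'. \<phi> (g x) = \<phi> (g y) \<longleftrightarrow> \<phi> (g (h x)) = \<phi> (g (h y)))}"
    proof
      fix g assume "g \<in> {g \<in> G. h \<in> St {b g}}"
      then have g: "g \<in> G" "h \<in> St {Pcol (\<phi> \<circ> g)}" by (auto simp: b_def)
      have "\<phi> (g x) = \<phi> (g y) \<longleftrightarrow> \<phi> (g (h x)) = \<phi> (g (h y))" if "x \<in> A'" "y \<in> A'" for x y
      proof -
        have "x \<in> X" "y \<in> X" using that A' RX by auto
        from Pcol_stab[OF colg[OF g(1)] g(2) this] show ?thesis by simp
      qed
      then show "g \<in> {g. g permutes R \<and> (\<forall>x\<in>A'. \<forall>y\<in>A'. \<phi> (g x) = \<phi> (g y) \<longleftrightarrow> \<phi> (g (h x)) = \<phi> (g (h y)))}" using g(1) by (simp add: G_def)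
    qed
    then have "card {g \<in> G. h \<in> St {b g}} \<le> card {g. g permutes R \<and> (\<forall>x\<in>A'. \<forall>y\<in>A'. \<phi> (g x) = \<phi> (g y) \<longleftrightarrow> \<phi> (g (h x)) = \<phi> (g (h y)))}"
      by (rule card_mono[rotated]) (rule finite_subset[OF _ finite_permutations[OF finR]], auto)
    ultimately have "card {g \<in> G. h \<in> St {b g}} * (N - 2 * p) ^ p \<le> fact N * K * l ^ p"
      using A' by (simp add: N_def) (meson le_trans mult_le_mono1)
    then have "real (card {g \<in> G. h \<in> St {b g}}) * real (N - 2 * p) ^ p \<le> real (fact N) * real K * real l ^ p"
      by (simp only: of_nat_mult[symmetric] of_nat_power[symmetric] of_nat_le_iff)
    then show ?thesis unfolding \<Gamma>_def using N2p by (simp add: pos_le_divide_eq mult.assoc)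
  qed
  have \<Gamma>0: "0 \<le> \<Gamma>" by (simp add: \<Gamma>_def)
  have finT: "finite T" using finSt by (simp add: T_def)
  have cT: "card T \<le> card (St Q)" by (rule card_mono[OF finSt]) (auto simp: T_def)
  \<comment> \<open>Otherwise the sum over \<open>G\<close> would exceed the value obtained by
    summing over \<open>T\<close> first.\<close>
  have "\<exists>g\<in>G. real (card {h \<in> T. h \<in> St {b g}}) \<le> real (card (St Q)) * \<Gamma>"
  proof (rule ccontr)
    assume "\<not> ?thesis"
    then have lt: "real (card (St Q)) * \<Gamma> < real (card {h \<in> T. h \<in> St {b g}})" if "g \<in> G" for g using that by force
    have "G \<noteq> {}" using cG by (metis card.empty fact_nonzero)
    then have "(\<Sum>g\<in>G. real (card (St Q)) * \<Gamma>) < (\<Sum>g\<in>G. real (card {h \<in> T. h \<in> St {b g}}))"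
      by (intro sum_strict_mono finG lt)
    also have "\<dots> = real (\<Sum>h\<in>T. card {g \<in> G. h \<in> St {b g}})"
      using sum_card_swap[OF finG finT, of "\<lambda>g h. h \<in> St {b g}"] by (simp only: of_nat_sum[symmetric])
    also have "\<dots> \<le> (\<Sum>h\<in>T. real (fact N) * \<Gamma>)" unfolding of_nat_sum by (intro sum_mono one)
    also have "\<dots> = real (card T) * (real (fact N) * \<Gamma>)" by simp
    also have "\<dots> \<le> real (card (St Q)) * (real (fact N) * \<Gamma>)" using cT \<Gamma>0 by (intro mult_right_mono) auto
    finally show False using cG by simp
  qed
  then obtain g where g: "g \<in> G" "real (card {h \<in> T. h \<in> St {b g}}) \<le> real (card (St Q)) * \<Gamma>" by blast
  have "St (insert (b g) Q) \<subseteq> L g \<union> {h \<in> T. h \<in> St {b g}}" by (auto simp: L_def T_def St_iff)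
  then have "card (St (insert (b g) Q)) \<le> card (L g) + card {h \<in> T. h \<in> St {b g}}"
    by (rule order_trans[OF card_mono card_Un_le, rotated]) (use finSt finT in \<open>auto simp: L_def\<close>)
  then have "real (card (St (insert (b g) Q))) \<le> real (card (L g)) + real (card {h \<in> T. h \<in> St {b g}})" by linarith
  also have "\<dots> \<le> 2 powr V wbal Q * real B ^ (card Q * B) + real (card (St Q)) * \<Gamma>"
    using cardL[OF g(1)] g(2) by linarith
  finally show ?thesis using bOm[OF g(1)] unfolding \<Gamma>_def N_def R_def by blast
qed

end

section \<open>Switching, faithfulness and the label bound\<close>

lemma transpose_image_fixed:
  assumes "a \<in> A \<longleftrightarrow> b \<in> A" shows "transpose a b ` A = A"
proof -
  have "transpose a b x \<in> A \<longleftrightarrow> x \<in> A" for x using assms by (auto simp: transpose_def)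
  then show ?thesis by (metis (no_types, lifting) image_iff subsetI subset_antisym transpose_involutory)
qed

lemma transpose_image_swap:
  assumes "a \<in> A" "b \<notin> A" shows "transpose a b ` A = insert b (A - {a})"
  using assms by (auto simp: transpose_def image_iff split: if_splits)

context kl_parts
begin

lemma Om_nonempty: "Om \<noteq> {}"
proof -
  have "colouring (\<lambda>x. (x - 1) mod k)"
    unfolding colouring_def
  proof (intro conjI ballI allI impI)
    fix s assume s: "s < k"
    have "bij_betw (\<lambda>x. x - 1) (cls (\<lambda>x. (x - 1) mod k) s) {t. t < k * l \<and> t mod k = s}"
    proof (rule bij_betw_byWitness[where f' = "\<lambda>t. t + 1"])
      show "(\<lambda>t. t + 1) ` {t. t < k * l \<and> t mod k = s} \<subseteq> cls (\<lambda>x. (x - 1) mod k) s"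
        by (auto simp: cls_def X_def)
    qed (auto simp: cls_def X_def)
    then show "card (cls (\<lambda>x. (x - 1) mod k) s) = l" using card_residue_full[OF s] bij_betw_same_card by fastforce
  qed (use k2 in auto)
  then show ?thesis using Pcol_in_Om by blast
qed

lemma part_act_transpose: assumes "a \<in> X" "b \<in> X" "P \<in> Om"
  shows "part_act (transpose a b) P \<in> Om" "part_act (transpose a b) (part_act (transpose a b) P) = P"
proof -
  show "part_act (transpose a b) P \<in> Om" using assms by (intro part_act_in_Om permutes_swap_id)
  show "part_act (transpose a b) (part_act (transpose a b) P) = P"
    by (simp add: part_act_comp[symmetric] part_act_id)
qed

text \<open>Switching: exchange \<open>y\<close> with a point \<open>w\<close> outside the common
  part of \<open>x\<close> and \<open>y\<close>. Then \<open>w\<close> is one of the l - 1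
  companions of \<open>x\<close>, and the same transposition undoes the exchange.\<close>

lemma card_fixed_together:
  assumes y: "y \<in> X" and x: "x \<in> X" and xy: "x \<noteq> y"
  shows "card {P \<in> Om. y \<in> same_part P x} * (k * l - l) \<le> card Om * (l - 1)"
proof -
  let ?F = "{P \<in> Om. y \<in> same_part P x}"
  let ?S = "Sigma ?F (\<lambda>P. X - same_part P x)"
  let ?T = "Sigma Om (\<lambda>P. same_part P x - {x})"
  have finpart: "finite (same_part P x)" "card (same_part P x) = l" "x \<in> same_part P x" "same_part P x \<subseteq> X" if "P \<in> Om" for P
    using OmD(3,5,6)[OF that] same_part_in[OF that x] by auto
  have "card ?S \<le> card ?T"
  proof (rule card_inj_on_le[where f = "\<lambda>(P, w). (part_act (transpose y w) P, w)"])
    show "finite ?T" using finite_Om finpart by auto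
    show "inj_on (\<lambda>(P, w). (part_act (transpose y w) P, w)) ?S"
    proof (rule inj_onI)
      fix a b assume ab: "a \<in> ?S" "b \<in> ?S"
        and eq: "(case a of (P, w) \<Rightarrow> (part_act (transpose y w) P, w)) = (case b of (P, w) \<Rightarrow> (part_act (transpose y w) P, w))"
      obtain P w P' w' where [simp]: "a = (P, w)" "b = (P', w')" by (metis surj_pair)
      have as: "P \<in> Om" "P' \<in> Om" "w \<in> X" "w' = w" "part_act (transpose y w) P = part_act (transpose y w) P'"
        using ab eq by auto
      have "P = P'" by (rule trans[OF part_act_transpose(2)[OF y as(3,1), symmetric]], subst as(5), rule part_act_transpose(2)[OF y as(3,2)])
      then show "a = b" using as by simp
    qed
    show "(\<lambda>(P, w). (part_act (transpose y w) P, w)) ` ?S \<subseteq> ?T"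
    proof (rule image_subsetI)
      fix a assume "a \<in> ?S"
      then obtain P w where a: "a = (P, w)" and as: "P \<in> Om" "y \<in> same_part P x" "w \<in> X" "w \<notin> same_part P x" by auto
      let ?P = "part_act (transpose y w) P"
      have P': "?P \<in> Om" by (rule part_act_transpose(1)[OF y as(3,1)])
      have "insert w (same_part P x - {y}) \<in> ?P"
        using same_part_in[OF as(1) x] transpose_image_swap[OF as(2,4)] unfolding part_act_def by (metis image_eqI)
      moreover have "x \<in> insert w (same_part P x - {y})" using finpart(3)[OF as(1)] xy by auto
      ultimately have "same_part ?P x = insert w (same_part P x - {y})" by (rule same_part_eq[OF P'])
      moreover have "w \<noteq> x" using as finpart(3)[OF as(1)] by auto
      ultimately show "(case a of (P, w) \<Rightarrow> (part_act (transpose y w) P, w)) \<in> ?T" using P' a by auto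
    qed
  qed
  moreover have "card ?S = (\<Sum>P\<in>?F. k * l - l)"
    using finite_Om finite_X finpart card_X by (simp add: card_Diff_subset)
  moreover have "card ?T = (\<Sum>P\<in>Om. l - 1)"
    using finite_Om finpart by simp
  ultimately show ?thesis by simp
qed

text \<open>Switching: exchange \<open>h x\<close> with a point \<open>w\<close> outside the part of
  \<open>x\<close> and its image. The part of \<open>x\<close> survives, so its image under
  \<open>h\<close> is known; the changed part, recognized by its other points, reveals
  \<open>w\<close>.\<close>

lemma card_fixed_apart:
  assumes h: "h permutes X" and x: "x \<in> X"
  shows "card {P \<in> Om. h x \<notin> same_part P x \<and> part_act h P = P} * (k * l - 2 * l) \<le> card Om"
proof -
  let ?y = "h x"
  let ?F = "{P \<in> Om. ?y \<notin> same_part P x \<and> part_act h P = P}"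
  let ?A = "\<lambda>P. same_part P x"
  let ?S = "Sigma ?F (\<lambda>P. X - (?A P \<union> h ` ?A P))"
  have y: "?y \<in> X" using permutes_in_image[OF h] x by simp
  have inj: "inj h" by (rule permutes_inj[OF h])
  have A: "?A P \<in> P" "x \<in> ?A P" "h ` ?A P \<in> P" "?A P \<inter> h ` ?A P = {}" "card (?A P) = l" "card (h ` ?A P) = l"
      "finite (?A P)" "?A P \<subseteq> X" "h ` ?A P \<subseteq> X" "?y \<in> h ` ?A P" if "P \<in> ?F" for P
  proof -
    have P: "P \<in> Om" "part_act h P = P" "?y \<notin> ?A P" using that by auto
    show 1: "?A P \<in> P" "x \<in> ?A P" using same_part_in[OF P(1) x] by auto
    show 2: "h ` ?A P \<in> P" using P(2) 1(1) unfolding part_act_def by blast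
    show 3: "?y \<in> h ` ?A P" using 1 by blast
    show "?A P \<inter> h ` ?A P = {}" using OmD(7)[OF P(1) 1(1) 2] P(3) 3 by blast
    show "card (?A P) = l" "card (h ` ?A P) = l" "finite (?A P)" "?A P \<subseteq> X" "h ` ?A P \<subseteq> X"
      using OmD(3,5,6)[OF P(1)] 1 2 by auto
  qed
  have new: "part_act (transpose ?y w) P \<in> Om" "?A (part_act (transpose ?y w) P) = ?A P"
      "insert w (h ` ?A P - {?y}) \<in> part_act (transpose ?y w) P" if "P \<in> ?F" "w \<in> X - (?A P \<union> h ` ?A P)" for P w
  proof -
    have P: "P \<in> Om" using that by auto
    show 1: "part_act (transpose ?y w) P \<in> Om" by (rule part_act_transpose(1)[OF y _ P]) (use that in auto)
    have "transpose ?y w ` ?A P = ?A P" by (rule transpose_image_fixed) (use that in auto)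
    then have "?A P \<in> part_act (transpose ?y w) P" using A(1)[OF that(1)] unfolding part_act_def by (metis image_eqI)
    then show "?A (part_act (transpose ?y w) P) = ?A P" by (rule same_part_eq[OF 1]) (rule A(2)[OF that(1)])
    have "transpose ?y w ` h ` ?A P = insert w (h ` ?A P - {?y})"
      by (rule transpose_image_swap) (use A(10)[OF that(1)] that in auto)
    then show "insert w (h ` ?A P - {?y}) \<in> part_act (transpose ?y w) P"
      using A(3)[OF that(1)] unfolding part_act_def by (metis image_eqI)
  qed
  have "card ?S \<le> card Om"
  proof (rule card_inj_on_le[where f = "\<lambda>(P, w). part_act (transpose ?y w) P"])
    show "finite Om" by (rule finite_Om)
    show "(\<lambda>(P, w). part_act (transpose ?y w) P) ` ?S \<subseteq> Om" using new(1) by auto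
    show "inj_on (\<lambda>(P, w). part_act (transpose ?y w) P) ?S"
    proof (rule inj_onI)
      fix a b assume ab: "a \<in> ?S" "b \<in> ?S" and eq: "(case a of (P, w) \<Rightarrow> part_act (transpose ?y w) P) = (case b of (P, w) \<Rightarrow> part_act (transpose ?y w) P)"
      obtain P w P' w' where [simp]: "a = (P, w)" "b = (P', w')" by (metis surj_pair)
      have 1: "P \<in> ?F" "w \<in> X - (?A P \<union> h ` ?A P)" and 2: "P' \<in> ?F" "w' \<in> X - (?A P' \<union> h ` ?A P')" using ab by auto
      have e: "part_act (transpose ?y w) P = part_act (transpose ?y w') P'" using eq by simp
      have AA: "?A P = ?A P'" using new(2)[OF 1] new(2)[OF 2] e by simp
      have "card (h ` ?A P - {?y}) = l - 1" using A(6,7,10)[OF 1(1)] by (simp add: card_Diff_singleton)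
      then have "h ` ?A P - {?y} \<noteq> {}" using l2 by (metis One_nat_def card.empty Suc_1 diff_is_0_eq not_less_eq_eq)
      then obtain z where z: "z \<in> h ` ?A P - {?y}" by blast
      have "insert w (h ` ?A P - {?y}) = insert w' (h ` ?A P' - {?y})"
        using OmD(7)[OF new(1)[OF 1] new(3)[OF 1], of "insert w' (h ` ?A P' - {?y})" z] new(3)[OF 2] e z AA by auto
      then have ww: "w = w'" using 1(2) 2(2) AA by auto
      have "w \<in> X" using 1 by simp
      have PP: "P \<in> Om" "P' \<in> Om" using 1 2 by auto
      have "P = P'" by (rule trans[OF part_act_transpose(2)[OF y \<open>w \<in> X\<close> PP(1), symmetric]], subst e, subst ww, rule part_act_transpose(2)[OF y _ PP(2)], use 2 in simp)
      then show "a = b" using ww by simp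
    qed
  qed
  moreover have "card ?S = (\<Sum>P\<in>?F. k * l - 2 * l)"
  proof -
    have "card (X - (?A P \<union> h ` ?A P)) = k * l - 2 * l" if "P \<in> ?F" for P
      using A[OF that] card_X by (simp add: card_Diff_subset card_Un_disjoint mult_2)
    moreover have "card ?S = (\<Sum>P\<in>?F. card (X - (?A P \<union> h ` ?A P)))"
      using finite_Om finite_X by (intro card_SigmaI) auto
    ultimately show ?thesis by simp
  qed
  ultimately show ?thesis by simp
qed

text \<open>The two switching bounds give a proportion of at most 1 / (k - 1) + 1 / (2 (k - 2)),
  which for k \<ge> 4 is at most 4 / (3k) + 1 / k < 5 / (2k).\<close>

lemma card_fixed_le:
  assumes h: "h permutes X" "h \<noteq> id" and k4: "4 \<le> k"
  shows "2 * real k * real (card {P \<in> Om. part_act h P = P}) \<le> 5 * real (card Om)"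
proof -
  obtain x where hx: "h x \<noteq> x" using h(2) by (auto simp: fun_eq_iff)
  then have x: "x \<in> X" using h(1) by (meson permutes_not_in)
  have y: "h x \<in> X" using permutes_in_image[OF h(1)] x by simp
  define om where "om = real (card Om)"
  define c1 where "c1 = card {P \<in> Om. h x \<in> same_part P x}"
  define c2 where "c2 = card {P \<in> Om. h x \<notin> same_part P x \<and> part_act h P = P}"
  have "card {P \<in> Om. part_act h P = P} \<le> card ({P \<in> Om. h x \<in> same_part P x} \<union> {P \<in> Om. h x \<notin> same_part P x \<and> part_act h P = P})"
    using finite_Om by (intro card_mono) auto
  also have "\<dots> \<le> c1 + c2" unfolding c1_def c2_def by (rule card_Un_le)
  finally have tot: "real (card {P \<in> Om. part_act h P = P}) \<le> real c1 + real c2" by linarith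
  have "c1 * ((k - 1) * l) \<le> card Om * l"
  proof -
    have "(k - 1) * l = k * l - l" by (simp add: diff_mult_distrib)
    then have "c1 * ((k - 1) * l) \<le> card Om * (l - 1)" using card_fixed_together[OF y x] hx by (simp add: c1_def)
    also have "\<dots> \<le> card Om * l" by simp
    finally show ?thesis .
  qed
  then have "c1 * (k - 1) \<le> card Om" using l2 by (simp add: mult.assoc[symmetric])
  then have "real (c1 * (k - 1)) \<le> om" unfolding om_def by (simp only: of_nat_le_iff)
  then have r1: "real c1 * (real k - 1) \<le> om" using k4 by (simp add: of_nat_diff)
  have "c2 * ((k - 2) * 2) \<le> c2 * ((k - 2) * l)" using l2 by simp
  also have "(k - 2) * l = k * l - 2 * l" by (simp add: diff_mult_distrib)
  also have "c2 * (k * l - 2 * l) \<le> card Om" using card_fixed_apart[OF h(1) x] by (simp add: c2_def)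
  finally have "real (c2 * ((k - 2) * 2)) \<le> om" unfolding om_def by (simp only: of_nat_le_iff)
  then have r2: "real c2 * (real k - 2) * 2 \<le> om" using k4 by (simp add: of_nat_diff mult.assoc)
  have "real c1 * (3 * real k) \<le> real c1 * (4 * (real k - 1))" using k4 by (intro mult_left_mono) auto
  then have s1: "3 * (real k * real c1) \<le> 4 * om" using r1 by (simp add: algebra_simps)
  have "real c2 * real k \<le> real c2 * (2 * (real k - 2))" using k4 by (intro mult_left_mono) auto
  then have s2: "real k * real c2 \<le> om" using r2 by (simp add: algebra_simps)
  have "real k * real (card {P \<in> Om. part_act h P = P}) \<le> real k * real c1 + real k * real c2"
    using mult_left_mono[OF tot, of "real k"] by (simp add: algebra_simps)
  moreover have "0 \<le> om" by (simp add: om_def)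
  ultimately show ?thesis using s1 s2 unfolding om_def by linarith
qed

text \<open>Averages over all partitions the number of nonidentity elements that fix the
  partition.\<close>

lemma good_point:
  assumes H: "perm_group X H" and k4: "4 \<le> k"
  shows "\<exists>b\<in>Om. 2 * real k * (real (card (pstab H part_act {b})) - 1) \<le> 5 * real (card H)"
proof (rule ccontr)
  assume "\<not> ?thesis"
  then have lt: "5 * real (card H) < 2 * real k * (real (card (pstab H part_act {b})) - 1)" if "b \<in> Om" for b using that by force
  have finH: "finite H" by (rule finite_perm_group[OF H finite_X])
  let ?T = "H - {id}"
  have eq: "real (card (pstab H part_act {b})) - 1 = real (card {h \<in> ?T. part_act h b = b})" for b
  proof -
    have "pstab H part_act {b} = insert id {h \<in> ?T. part_act h b = b}"
      using perm_groupD(1)[OF H] by (auto simp: pstab_def part_act_id)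
    then show ?thesis using finH by simp
  qed
  have "(\<Sum>b\<in>Om. 5 * real (card H)) < (\<Sum>b\<in>Om. 2 * real k * real (card {h \<in> ?T. part_act h b = b}))"
    by (rule sum_strict_mono[OF finite_Om Om_nonempty]) (use lt eq in simp)
  also have "\<dots> = 2 * real k * real (\<Sum>b\<in>Om. card {h \<in> ?T. part_act h b = b})" by (simp add: sum_distrib_left)
  also have "(\<Sum>b\<in>Om. card {h \<in> ?T. part_act h b = b}) = (\<Sum>h\<in>?T. card {b \<in> Om. part_act h b = b})"
    using finH by (intro sum_card_swap finite_Om) auto
  also have "2 * real k * real (\<Sum>h\<in>?T. card {b \<in> Om. part_act h b = b}) = (\<Sum>h\<in>?T. 2 * real k * real (card {b \<in> Om. part_act h b = b}))"
    by (simp add: sum_distrib_left)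
  also have "\<dots> \<le> (\<Sum>h\<in>?T. 5 * real (card Om))"
    by (intro sum_mono card_fixed_le) (use perm_groupD(2)[OF H] k4 in auto)
  also have "\<dots> \<le> real (card H) * (5 * real (card Om))"
  proof -
    have "real (card ?T) \<le> real (card H)" using finH by (simp add: card_mono)
    then show ?thesis using mult_right_mono[of "real (card ?T)" "real (card H)" "5 * real (card Om)"] by simp
  qed
  finally show False by simp
qed

text \<open>For k = l = 2 the Klein four-group acts trivially, hence \<open>4 < k * l\<close>.
  Otherwise take a partition separating \<open>x\<close> from \<open>h x\<close>; if
  \<open>h\<close> fixes it, one more exchange yields a partition that it cannot fix. The exchanged
  point comes from a third part, or for k = 2 from a third point of a part.\<close>

lemma faithful:
  assumes h: "h permutes X" "h \<noteq> id" and n4: "4 < k * l"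
  shows "\<exists>P\<in>Om. part_act h P \<noteq> P"
proof (rule ccontr)
  assume "\<not> ?thesis"
  then have all: "part_act h P = P" if "P \<in> Om" for P using that by auto
  obtain x where hx: "h x \<noteq> x" using h(2) by (auto simp: fun_eq_iff)
  then have x: "x \<in> X" using h(1) by (meson permutes_not_in)
  have y: "h x \<in> X" using permutes_in_image[OF h(1)] x by simp
  have himg: "h ` B \<in> P" if "P \<in> Om" "B \<in> P" for P B using all[OF that(1)] that(2) unfolding part_act_def by blast
  obtain P0 where P0: "P0 \<in> Om" using Om_nonempty by blast
  have "\<exists>P\<in>Om. h x \<notin> same_part P x"
  proof (cases "h x \<in> same_part P0 x")
    case True
    let ?A = "same_part P0 x"
    have A: "?A \<in> P0" "x \<in> ?A" using same_part_in[OF P0 x] by auto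
    have "card ?A < card X" using OmD(3)[OF P0 A(1)] card_X k2 l2 by simp
    then have "\<not> X \<subseteq> ?A" using card_mono[OF OmD(5)[OF P0 A(1)]] by (meson not_le)
    then obtain w where w: "w \<in> X" "w \<notin> ?A" by blast
    let ?P = "part_act (transpose (h x) w) P0"
    have P': "?P \<in> Om" by (rule part_act_transpose(1)[OF y w(1) P0])
    have "insert w (?A - {h x}) \<in> ?P"
      using A(1) transpose_image_swap[OF True w(2)] unfolding part_act_def by (metis image_eqI)
    then have "same_part ?P x = insert w (?A - {h x})" by (rule same_part_eq[OF P']) (use A(2) hx in auto)
    moreover have "w \<noteq> h x" using True w by auto
    ultimately show ?thesis using P' by auto
  qed (use P0 in auto)
  then obtain P where P: "P \<in> Om" "h x \<notin> same_part P x" by blast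
  let ?A = "same_part P x"
  have A: "?A \<in> P" "x \<in> ?A" "card ?A = l" "finite ?A" using same_part_in[OF P(1) x] OmD(3,5)[OF P(1)] by auto
  have hA: "h ` ?A \<in> P" "h x \<in> h ` ?A" using himg[OF P(1) A(1)] A(2) by auto
  have disA: "?A \<inter> h ` ?A = {}" using OmD(7)[OF P(1) A(1) hA(1)] P(2) hA(2) by blast
  have "card (?A - {x}) = l - 1" using A by (simp add: card_Diff_singleton)
  then have "?A - {x} \<noteq> {}" using l2 by (metis One_nat_def card.empty Suc_1 diff_is_0_eq not_less_eq_eq)
  then obtain z where z: "z \<in> ?A" "z \<noteq> x" by blast
  have inj: "inj h" by (rule permutes_inj[OF h(1)])
  show False
  proof (cases "k = 2")
    case False
    have "card (?A \<union> h ` ?A) \<le> l + l" using card_Un_le[of ?A "h ` ?A"] A(3) OmD(3)[OF P(1) hA(1)] by simp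
    also have "\<dots> < card X" using False k2 l2 by (simp add: card_X mult_2[symmetric])
    finally have lt: "card (?A \<union> h ` ?A) < card X" .
    have "finite (?A \<union> h ` ?A)" using A(4) by simp
    then have "\<not> X \<subseteq> ?A \<union> h ` ?A" using card_mono[of "?A \<union> h ` ?A" X] lt by linarith
    then obtain w where w: "w \<in> X" "w \<notin> ?A" "w \<notin> h ` ?A" by blast
    let ?P = "part_act (transpose (h x) w) P"
    have P': "?P \<in> Om" by (rule part_act_transpose(1)[OF y w(1) P(1)])
    have "transpose (h x) w ` ?A = ?A" by (rule transpose_image_fixed) (use P(2) w in auto)
    then have "?A \<in> ?P" using A(1) unfolding part_act_def by (metis image_eqI)
    then have 1: "h ` ?A \<in> ?P" by (rule himg[OF P'])
    have 2: "insert w (h ` ?A - {h x}) \<in> ?P"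
      using hA(1) transpose_image_swap[OF hA(2) w(3)] unfolding part_act_def by (metis image_eqI)
    have "h z \<in> h ` ?A" "h z \<in> insert w (h ` ?A - {h x})" using z inj by (auto simp: inj_eq)
    then have "h ` ?A = insert w (h ` ?A - {h x})" using OmD(7)[OF P' 1 2] by blast
    then show False using w by blast
  next
    case True
    then have l3: "3 \<le> l" using n4 by simp
    have "card (?A - {x, z}) = l - 2" using A z by (simp add: card_Diff_subset)
    then have "?A - {x, z} \<noteq> {}" using l3 by (metis card.empty diff_is_0_eq not_less_eq_eq numeral_2_eq_2 numeral_3_eq_3)
    then obtain w where w: "w \<in> ?A" "w \<noteq> x" "w \<noteq> z" by blast
    have wX: "w \<in> X" using OmD(6)[OF P(1) A(1)] w by auto
    let ?P = "part_act (transpose w (h x)) P"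
    have P': "?P \<in> Om" by (rule part_act_transpose(1)[OF wX y P(1)])
    let ?A' = "insert (h x) (?A - {w})"
    have A': "?A' \<in> ?P" using A(1) transpose_image_swap[OF w(1) P(2)] unfolding part_act_def by (metis image_eqI)
    have "h ` ?A' \<in> ?P" by (rule himg[OF P' A'])
    moreover have "h x \<in> h ` ?A'" using A(2) w by auto
    ultimately have "h ` ?A' = ?A'" using OmD(7)[OF P' A', of "h ` ?A'" "h x"] by blast
    moreover have "h z \<in> h ` ?A'" using z w by blast
    ultimately have "h z \<in> ?A'" by simp
    moreover have "h z \<in> h ` ?A" using z by blast
    ultimately have "h z = h x" using disA by blast
    then show False using z inj by (simp add: inj_eq)
  qed
qed

text \<open>Points with equal labels may be transposed freely. If two points \<open>y\<close>,
  \<open>z\<close> lie outside a transversal \<open>T\<close> of the labels, the product of two such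
  transpositions is even and not the identity (a 3-cycle if \<open>y' = z'\<close>). A single
  transposition is odd, hence the summand 1.\<close>

lemma base_label_bound:
  assumes B: "B \<subseteq> Om" "finite B" and triv: "pstab (Alt (k * l)) part_act B = {id}"
  shows "k * l \<le> k ^ card B + 1"
proof (rule ccontr)
  assume "\<not> ?thesis"
  then have big: "k ^ card B + 2 \<le> card X" by (simp add: card_X)
  define lab where "lab x = restrict (\<lambda>P. same_part P x) B" for x
  have "lab ` X \<subseteq> Pi\<^sub>E B (\<lambda>P. P)" using same_part_in B(1) by (auto simp: lab_def)
  moreover have "finite (Pi\<^sub>E B (\<lambda>P. P))" using B OmD(4) by (intro finite_PiE) auto
  ultimately have "card (lab ` X) \<le> card (Pi\<^sub>E B (\<lambda>P. P))" by (intro card_mono)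
  also have "\<dots> = (\<Prod>P\<in>B. card P)" by (rule card_PiE[OF B(2)])
  also have "\<dots> = k ^ card B" using B(1) OmD(2) by (subst prod.cong[OF refl, of B card "\<lambda>_. k"]) auto
  finally have small: "card (lab ` X) \<le> k ^ card B" .
  obtain T where T: "T \<subseteq> X" "inj_on lab T" "lab ` X = lab ` T" using subset_image_inj[of "lab ` X" lab X] by auto
  have finT: "finite T" using T(1) finite_X finite_subset by blast
  have "card T \<le> k ^ card B" using small T by (simp add: card_image)
  then have c2: "2 \<le> card (X - T)" using big T(1) finT by (simp add: card_Diff_subset)
  then obtain y z where yz: "y \<in> X - T" "z \<in> X - T" "y \<noteq> z"
    by (metis card_le_Suc0_iff_eq finite_Diff finite_X not_less_eq_eq numeral_2_eq_2)
  obtain y' where y': "y' \<in> T" "lab y' = lab y" using T(3) yz(1) by (metis DiffD1 imageE imageI)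
  obtain z' where z': "z' \<in> T" "lab z' = lab z" using T(3) yz(2) by (metis DiffD1 imageE imageI)
  have ne: "y \<noteq> y'" "z \<noteq> z'" "z' \<noteq> y" using yz y' z' by auto
  define q where "q = transpose y y' \<circ> transpose z z'"
  have tp: "transpose a b permutes X" if "a \<in> X" "b \<in> X" for a b using that by (rule permutes_swap_id)
  have qX: "q permutes X" unfolding q_def by (intro permutes_compose tp) (use yz y' z' T in auto)
  have "evenperm q" unfolding q_def using ne by (subst evenperm_comp) (auto simp: permutation_swap_id evenperm_swap)
  moreover have fixp: "transpose a b ` A = A" if ab: "a \<in> X" "b \<in> X" "lab a = lab b" and PA: "P \<in> B" "A \<in> P" for a b P A
  proof (rule transpose_image_fixed)
    have PO: "P \<in> Om" using PA B by auto
    have "same_part P a = same_part P b" using fun_cong[OF ab(3), of P] PA by (simp add: lab_def)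
    then show "a \<in> A \<longleftrightarrow> b \<in> A" using same_part_eq[OF PO PA(2)] same_part_in[OF PO] ab(1,2) by metis
  qed
  have "part_act q P = P" if "P \<in> B" for P
  proof -
    have "q ` A = A" if "A \<in> P" for A
    proof -
      have "transpose y y' ` A = A" "transpose z z' ` A = A"
        by (rule fixp[OF _ _ _ \<open>P \<in> B\<close> that]; use yz y' z' T(1) in auto)+
      then show ?thesis unfolding q_def image_comp[symmetric] by (simp only:)
    qed
    then show ?thesis by (simp add: part_act_def)
  qed
  ultimately have "q \<in> pstab (Alt (k * l)) part_act B" using qX by (auto simp: pstab_def Alt_def X_def)
  then have "q = id" using triv by simp
  then have "transpose y y' (transpose z z' z) = z" unfolding q_def by (metis comp_apply id_apply)
  then show False using ne yz by (auto simp: transpose_def split: if_splits)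
qed

end

section \<open>Greedy runs\<close>

text \<open>3^5 = 243 < 256 = 2^8.\<close>

lemma log2_3_le: "log 2 3 \<le> (8 / 5 :: real)"
proof -
  have "5 * log 2 3 = log 2 ((3::real) ^ 5)" by (subst log_nat_power) simp_all
  also have "\<dots> \<le> log 2 (2 ^ 8)" by (intro log2_mono) auto
  also have "log 2 ((2::real) ^ 8) = 8" by (subst log_nat_power) simp_all
  finally show ?thesis by simp
qed

section \<open>Alternating versus symmetric stabilizers\<close>

context kl_parts
begin

lemma perm_group_Alt: "perm_group X (Alt (k * l))"
proof -
  have per: "permutation p" if "p permutes X" for p using that finite_X permutation_permutes by blast
  show ?thesis unfolding perm_group_def Alt_def X_def[symmetric]
    using per by (auto simp: permutes_id permutes_compose permutes_inv evenperm_comp evenperm_inv evenperm_id)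
qed

lemma card_St_le_Alt: "card (St Q) \<le> 2 * card (pstab (Alt (k * l)) part_act Q)"
proof -
  let ?E = "pstab (Alt (k * l)) part_act Q"
  have E: "?E = {p \<in> St Q. evenperm p}" by (auto simp: pstab_def Alt_def Sym_def)
  have fin: "finite (St Q)" by (rule finite_perm_group[OF perm_group_St finite_X])
  have per: "permutation p" if "p \<in> St Q" for p using that finite_X permutation_permutes by (auto simp: St_iff)
  show ?thesis
  proof (cases "\<exists>q\<in>St Q. \<not> evenperm q")
    case False
    then have "?E = St Q" using E by auto
    then show ?thesis by simp
  next
    case True
    then obtain q where q: "q \<in> St Q" "\<not> evenperm q" by blast
    have "card {p \<in> St Q. \<not> evenperm p} \<le> card ?E"
    proof (rule card_inj_on_le[where f = "\<lambda>p. q \<circ> p"])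
      show "inj_on (\<lambda>p. q \<circ> p) {p \<in> St Q. \<not> evenperm p}"
      proof (rule inj_onI)
        fix a b assume "q \<circ> a = q \<circ> b"
        then have "q (a x) = q (b x)" for x by (metis comp_apply)
        then show "a = b" using perm_groupD(5)[OF perm_group_St q(1)] by (auto simp: fun_eq_iff bij_is_inj inj_eq)
      qed
      show "(\<lambda>p. q \<circ> p) ` {p \<in> St Q. \<not> evenperm p} \<subseteq> ?E"
      proof (rule image_subsetI)
        fix p assume p: "p \<in> {p \<in> St Q. \<not> evenperm p}"
        have "q \<circ> p \<in> St Q" by (rule perm_groupD(3)[OF perm_group_St q(1)]) (use p in simp)
        moreover have "evenperm (q \<circ> p)" using evenperm_comp[OF per[OF q(1)] per[of p]] p q by simp
        ultimately show "q \<circ> p \<in> ?E" using E by simp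
      qed
      show "finite ?E" using fin E by simp
    qed
    moreover have "St Q = ?E \<union> {p \<in> St Q. \<not> evenperm p}" using E by auto
    then have "card (St Q) \<le> card ?E + card {p \<in> St Q. \<not> evenperm p}" using card_Un_le by metis
    ultimately show ?thesis by simp
  qed
qed

end

text \<open>Describes any initial segment of a greedy run: the last stabilizer may be nontrivial.
  This lets \<open>greedy_base_exists\<close> extend a run by one point.\<close>

locale greedy_run = kl_parts +
  fixes G :: "(nat \<Rightarrow> nat) set" and bs :: "nat set set list"
  assumes n4: "4 < k * l" and G: "G = Alt (k * l) \<or> G = Sym (k * l)"
    and greedy: "\<And>i. i < length bs \<Longrightarrow> pstab G part_act (set (take i bs)) \<noteq> {id} \<and> bs ! i \<in> Om \<and>
      (\<forall>y\<in>Om. card (orbit_of (pstab G part_act (set (take i bs))) part_act y)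
        \<le> card (orbit_of (pstab G part_act (set (take i bs))) part_act (bs ! i)))"
begin

definition Q :: "nat \<Rightarrow> nat set set set" where "Q i = set (take i bs)"
definition H :: "nat \<Rightarrow> (nat \<Rightarrow> nat) set" where "H i = pstab G part_act (Q i)"

lemma perm_group_G: "perm_group X G" using G perm_group_Alt perm_group_Sym by auto
lemma perm_group_H: "perm_group X (H i)" unfolding H_def by (rule perm_group_pstab[OF perm_group_G])
lemma card_H_pos: "0 < card (H i)" by (rule card_perm_group_pos[OF perm_group_H finite_X])
lemma finite_H: "finite (H i)" by (rule finite_perm_group[OF perm_group_H finite_X])

lemma Q_Suc: "i < length bs \<Longrightarrow> Q (Suc i) = insert (bs ! i) (Q i)"
  by (simp add: Q_def take_Suc_conv_app_nth)

lemma bs_in: "i < length bs \<Longrightarrow> bs ! i \<in> Om" using greedy by blast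

lemma Q_sub: "Q i \<subseteq> Om"
proof
  fix P assume "P \<in> Q i"
  then obtain j where "j < length bs" "P = bs ! j" by (auto simp: Q_def in_set_conv_nth)
  then show "P \<in> Om" using bs_in by simp
qed

lemma finite_Q: "finite (Q i)" by (simp add: Q_def)
lemma card_Q: "card (Q i) \<le> i" unfolding Q_def using card_length[of "take i bs"] by simp

lemma first_in_Q: "1 \<le> i \<Longrightarrow> 0 < length bs \<Longrightarrow> bs ! 0 \<in> Q i"
  unfolding Q_def by (cases bs; cases i) auto

lemma Q_1: "0 < length bs \<Longrightarrow> Q 1 = {bs ! 0}" unfolding Q_def by (cases bs) auto

lemma H_Suc: "i < length bs \<Longrightarrow> H (Suc i) = pstab (H i) part_act {bs ! i}"
  unfolding H_def by (simp only: Q_Suc) (rule pstab_insert)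

lemma H_step: assumes "i < length bs" "b \<in> Om" shows "card (H (Suc i)) \<le> card (pstab G part_act (insert b (Q i)))"
proof -
  have "card (pstab (H i) part_act {bs ! i}) \<le> card (pstab (H i) part_act {b})"
    by (rule stabilizer_antimono_orbit[OF perm_group_H]) (use greedy[OF assms(1)] assms(2) in \<open>simp add: H_def Q_def\<close>)
  then show ?thesis using H_Suc[OF assms(1)] pstab_insert[of G b "Q i"] by (simp add: H_def)
qed

lemma pstab_G_sub: "pstab G part_act R \<subseteq> St R" using G by (auto simp: pstab_def Alt_def Sym_def)

lemma finite_St: "finite (St R)" by (rule finite_perm_group[OF perm_group_St finite_X])
lemma card_St_pos: "0 < card (St R)" by (rule card_perm_group_pos[OF perm_group_St finite_X])

lemma card_pstab_le: "card (pstab G part_act R) \<le> card (St R)" by (rule card_mono[OF finite_St pstab_G_sub])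

lemma card_H_le: "card (H i) \<le> card (St (Q i))" unfolding H_def by (rule card_pstab_le)

lemma card_St_le_H: "card (St (Q i)) \<le> 2 * card (H i)"
  using G card_St_le_Alt[of "Q i"] by (auto simp: H_def)

text \<open>The greedy comparison takes place in \<open>G\<close>; restating it for stabilizers in
  the symmetric group costs their index, at most 2.\<close>

lemma St_step: assumes "i < length bs" "b \<in> Om" shows "card (St (Q (Suc i))) \<le> 2 * card (St (insert b (Q i)))"
  using card_St_le_H[of "Suc i"] H_step[OF assms] card_pstab_le[of "insert b (Q i)"] by linarith

lemma H_nontrivial: assumes "i < length bs" shows "2 \<le> card (H i)"
  using greedy[OF assms] perm_group_eq_id[OF perm_group_H finite_X, of i] by (force simp: H_def Q_def)

text \<open>Faithfulness provides an orbit of length at least 2. So runs are finite, and a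
  stabilizer of bounded order dies within a bounded number of steps.\<close>

lemma H_half: assumes i: "i < length bs" shows "2 * card (H (Suc i)) \<le> card (H i)"
proof -
  obtain h where h: "h \<in> H i" "h \<noteq> id"
    using greedy[OF i] perm_groupD(1)[OF perm_group_H, of i] by (force simp: H_def Q_def)
  obtain P where P: "P \<in> Om" "part_act h P \<noteq> P" using faithful[OF perm_groupD(2)[OF perm_group_H h(1)] h(2) n4] by blast
  have fin: "finite (orbit_of (H i) part_act P)" using finite_H by (simp add: orbit_of_def)
  have "part_act h P \<in> orbit_of (H i) part_act P" "P \<in> orbit_of (H i) part_act P"
    using h(1) perm_groupD(1)[OF perm_group_H, of i] unfolding orbit_of_def by (auto intro: exI[of _ id] simp: part_act_id)
  then have "card {part_act h P, P} \<le> card (orbit_of (H i) part_act P)" using fin by (intro card_mono) auto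
  then have "2 \<le> card (orbit_of (H i) part_act P)" using P(2) by simp
  also have "\<dots> \<le> card (orbit_of (H i) part_act (bs ! i))" using greedy[OF i] P(1) by (simp add: H_def Q_def)
  finally have "2 * card (pstab (H i) part_act {bs ! i}) \<le> card (orbit_of (H i) part_act (bs ! i)) * card (pstab (H i) part_act {bs ! i})"
    by simp
  then show ?thesis using orbit_stabilizer[OF perm_group_H] H_Suc[OF i] by simp
qed

text \<open>The chosen orbit has length \<open>M\<close> with |H i| \<le> M^b, where b =
  \<open>card B\<close>, and |H i| = M |H (i + 1)|. Eliminating \<open>M\<close> bounds |H (i + 1)|
  by |H i|^(1 - 1/b), written here without roots.\<close>

lemma H_base_step:
  assumes B: "finite B" "pstab G part_act B = {id}" "B \<subseteq> Om" and i: "i < length bs"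
  shows "card (H (Suc i)) ^ card B * card (H i) \<le> card (H i) ^ card B"
proof -
  define M where "M = card (orbit_of (H i) part_act (bs ! i))"
  have "pstab (H i) part_act B \<subseteq> pstab G part_act B" by (auto simp: pstab_def H_def)
  then have "card (H i) \<le> M ^ card B"
    using B greedy[OF i] unfolding M_def by (intro card_le_orbit_power[OF perm_group_H B(1)]) (auto simp: H_def Q_def)
  moreover have "card (H i) = M * card (H (Suc i))"
    using orbit_stabilizer[OF perm_group_H, of i "bs ! i"] H_Suc[OF i] by (simp add: M_def)
  ultimately show ?thesis by (metis mult.commute mult_le_mono2 power_mult_distrib)
qed

text \<open>The factor \<open>11\<close> enters here: \<open>11 b\<close> greedy steps raise the order of the stabilizer to a power
  below \<open>e\<close> to the minus \<open>11\<close>, which is enough to make it trivial unless the group is huge.\<close>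

lemma not_small:
  assumes B: "finite B" "pstab G part_act B = {id}" "B \<subseteq> Om" and b: "0 < card B"
    and len: "11 * card B < length bs" and j: "2 * j \<le> 3 * card B" and X: "log 2 (card (H j)) \<le> 12900"
  shows False
proof -
  define b' where "b' = card B"
  define c where "c = 1 - 1 / real b'"
  have b1: "1 \<le> b'" using b by (simp add: b'_def)
  have c0: "0 \<le> c" using b1 by (simp add: c_def)
  have step: "log 2 (card (H (Suc i))) \<le> c * log 2 (card (H i))" if i: "i < length bs" for i
  proof -
    have pos: "0 < real (card (H i))" "0 < real (card (H (Suc i)))" using card_H_pos by auto
    have "real (card (H (Suc i)) ^ b' * card (H i)) \<le> real (card (H i) ^ b')"
      using H_base_step[OF B i] unfolding b'_def by (simp only: of_nat_le_iff)
    then have "log 2 (real (card (H (Suc i))) ^ b' * real (card (H i))) \<le> log 2 (real (card (H i)) ^ b')"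
      using pos by (intro log2_mono) auto
    then have "real b' * log 2 (card (H (Suc i))) + log 2 (card (H i)) \<le> real b' * log 2 (card (H i))"
      using pos by (simp add: log_mult_pos log_nat_power)
    then show ?thesis using b1 by (simp add: c_def field_simps)
  qed
  have iter: "log 2 (card (H (j + i))) \<le> c ^ i * 12900" if "j + i \<le> length bs" for i
    using that
  proof (induction i)
    case 0 then show ?case using X by simp
  next
    case (Suc i)
    have "log 2 (card (H (j + Suc i))) \<le> c * log 2 (card (H (j + i)))" using step[of "j + i"] Suc.prems by simp
    also have "\<dots> \<le> c * (c ^ i * 12900)" using Suc c0 by (intro mult_left_mono) auto
    finally show ?case by simp
  qed
  define i where "i = 11 * b' - j"
  have ji: "j + i = 11 * b'" using j by (simp add: i_def b'_def)
  have "2 \<le> card (H (11 * b'))" by (rule H_nontrivial) (use len in \<open>simp add: b'_def\<close>)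
  then have "log 2 2 \<le> log 2 (card (H (11 * b')))" by (intro log2_mono) auto
  then have "1 \<le> log 2 (card (H (j + i)))" by (simp add: ji)
  also have "\<dots> \<le> c ^ i * 12900" by (rule iter) (use ji len in \<open>simp add: b'_def\<close>)
  also have "c ^ i \<le> exp (- (real i / real b'))"
  proof -
    have "c \<le> exp (- (1 / real b'))" using exp_ge_add_one_self[of "- (1 / real b')"] by (simp add: c_def)
    then have "c ^ i \<le> exp (- (1 / real b')) ^ i" using c0 by (intro power_mono)
    also have "\<dots> = exp (- (real i / real b'))" by (simp add: exp_of_nat_mult[symmetric])
    finally show ?thesis .
  qed
  also have "exp (- (real i / real b')) \<le> exp (- (19 / 2))"
  proof -
    have "real i = 11 * real b' - real j" using ji by linarith
    moreover have "2 * real j \<le> 3 * real b'" using j unfolding b'_def by linarith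
    ultimately have "19 / 2 * real b' \<le> real i" by linarith
    then show ?thesis using b1 by (simp add: field_simps)
  qed
  finally have "1 \<le> exp (- (19 / 2)) * (12900 :: real)" by simp
  then have "exp (19 / 2 :: real) \<le> 12900" by (simp add: exp_minus field_simps)
  \<comment> \<open>A rational certificate for 12900 < e^(19/2): 1 + 1/8 + 1/128 = 145/128, and 76/8
    = 19/2.\<close>
  moreover have "(145 / 128 :: real) ^ 76 \<le> exp (1 / 8) ^ 76"
  proof (rule power_mono)
    have "1 + (1 / 8 :: real) + (1 / 8)\<^sup>2 / 2 \<le> exp (1 / 8)" by (rule exp_lower_Taylor_quadratic) simp
    then show "145 / 128 \<le> exp (1 / 8 :: real)" by (simp add: power2_eq_square)
  qed simp
  moreover have "exp (1 / 8 :: real) ^ 76 = exp (19 / 2)" by (simp add: exp_of_nat_mult[symmetric])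
  moreover have "(12900 :: real) < (145 / 128) ^ 76" by (simp add: power_divide)
  ultimately show False by linarith
qed

text \<open>The deficit of a step: the whole stabilizer after it, against the smallest conceivable
  part-fixing group. It thus also charges for elements that permute parts.\<close>

definition \<delta> :: "nat \<Rightarrow> real" where "\<delta> j = log 2 (card (St (Q (Suc j)))) - V wbal (Q j)"

text \<open>At \<open>j0\<close> the potential \<open>V (U S)\<close> vanishes, since cells have at
  most l \<le> k^S points. Each step lowers the index of \<open>U\<close> by one and adds at most
  twice its deficit; after \<open>S\<close> steps \<open>U 0\<close> dominates
  \<open>wbal\<close>.\<close>

lemma window:
  assumes S: "l \<le> k ^ S" and j0: "1 \<le> j0" and len: "j0 + S < length bs"
  shows "log 2 (card (St (Q (Suc (j0 + S))))) \<le> \<delta> (j0 + S) + 2 * (\<Sum>j=j0..<j0 + S. \<delta> j)"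
proof -
  have "V (U (S - i)) (Q (j0 + i)) \<le> 2 * (\<Sum>j=j0..<j0 + i. \<delta> j)" if "i \<le> S" for i
    using that
  proof (induction i)
    case 0
    have "bs ! 0 \<in> Q j0" by (rule first_in_Q[OF j0]) (use len in linarith)
    then have "card C \<le> l" if "C \<in> cells (Q j0)" for C using card_cell_le[OF _ Q_sub that] by blast
    then have "V (U S) (Q j0) = 0" unfolding V_def using S by (intro sum.neutral) (auto intro!: U_eq_0 intro: order_trans)
    then show ?case by simp
  next
    case (Suc i)
    have lt: "j0 + i < length bs" using Suc.prems len by simp
    have "V (U (S - Suc i)) (Q (Suc (j0 + i))) \<le> V (U (Suc (S - Suc i))) (Q (j0 + i)) + 2 * (V lf (Q (Suc (j0 + i))) - V wbal (Q (j0 + i)))"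
      unfolding Q_Suc[OF lt] by (rule V_U_step[OF Q_sub bs_in[OF lt]])
    moreover have "Suc (S - Suc i) = S - i" using Suc.prems by simp
    moreover have "V lf (Q (Suc (j0 + i))) \<le> log 2 (card (St (Q (Suc (j0 + i)))))" by (rule log_card_St_ge[OF Q_sub])
    ultimately show ?case using Suc by (simp add: \<delta>_def algebra_simps)
  qed
  from this[of S] have "V (U 0) (Q (j0 + S)) \<le> 2 * (\<Sum>j=j0..<j0 + S. \<delta> j)" by simp
  moreover have "V wbal (Q (j0 + S)) \<le> V (U 0) (Q (j0 + S))" by (rule V_mono) (rule wbal_le_U0)
  ultimately show ?thesis by (simp add: \<delta>_def)
qed

text \<open>With one earlier partition the stabilizer of the dense candidate is at most k^2 times
  its part-fixing group. The k^2 gives \<open>2 * log 2 k\<close>, the alternating group gives 1,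
  and the defects give \<open>8 / 5 * real k\<close>.\<close>

lemma \<delta>_1_le:
  assumes lk: "k \<le> l" and len: "1 < length bs"
  shows "\<delta> 1 \<le> 2 * log 2 k + (1 + 8 / 5 * real k)"
proof -
  have Q1: "Q 1 = {bs ! 0}" by (rule Q_1) (use len in linarith)
  have P: "bs ! 0 \<in> Om" by (rule bs_in) (use len in linarith)
  obtain b where b: "b \<in> Om" "V lf (insert b (Q 1)) \<le> V wbal (Q 1) + real k * log 2 3"
      "card (St {bs ! 0, b}) \<le> k\<^sup>2 * card (Fx {bs ! 0, b})"
    using dense_candidate[of "bs ! 0" "Q 1", OF _ Q_sub lk] Q1 by auto
  have ins: "insert b (Q 1) = {bs ! 0, b}" using Q1 by auto
  have "card (St (Q (Suc 1))) \<le> 2 * (k\<^sup>2 * card (Fx (insert b (Q 1))))"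
    using St_step[OF len b(1)] b(3) unfolding ins by linarith
  then have "real (card (St (Q (Suc 1)))) \<le> real (2 * (k\<^sup>2 * card (Fx (insert b (Q 1)))))" by (simp only: of_nat_le_iff)
  also have "\<dots> = 2 * (real k ^ 2 * 2 powr V lf (insert b (Q 1)))" using card_Fx[of "insert b (Q 1)"] b(1) Q_sub by simp
  finally have "log 2 (card (St (Q (Suc 1)))) \<le> log 2 (2 * (real k ^ 2 * 2 powr V lf (insert b (Q 1))))"
    using card_St_pos by (intro log2_mono) auto
  also have "\<dots> = 1 + (2 * log 2 k + V lf (insert b (Q 1)))" using k2 by (simp add: log_mult_pos log_nat_power)
  finally have "\<delta> 1 \<le> 1 + 2 * log 2 k + real k * log 2 3" using b(2) by (simp add: \<delta>_def)
  moreover have "real k * log 2 3 \<le> real k * (8 / 5)" by (intro mult_left_mono log2_3_le) simp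
  ultimately show ?thesis by simp
qed

text \<open>The dense candidate meets the old part-fixing group only in the new one, so the index of
  the part-fixing group in the stabilizer does not grow. The candidate inherits the previous deficit
  and adds the cost of its defects, plus 1 for parity.\<close>

lemma \<delta>_Suc_le:
  assumes lk: "k \<le> l" and j: "1 \<le> j" and len: "Suc j < length bs"
  shows "\<delta> (Suc j) \<le> \<delta> j + (1 + 8 / 5 * real k)"
proof -
  have jl: "j < length bs" using len by simp
  have PQ: "bs ! 0 \<in> Q (Suc j)" by (rule first_in_Q) (use len in auto)
  obtain b where b: "b \<in> Om" "V lf (insert b (Q (Suc j))) \<le> V wbal (Q (Suc j)) + real k * log 2 3"
      "Fx (Q (Suc j)) \<inter> St {b} \<subseteq> Fx (insert b (Q (Suc j)))"
    using dense_candidate[OF PQ Q_sub lk] by blast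
  let ?Q = "Q (Suc j)"
  have sub: "insert b ?Q \<subseteq> Om" using b(1) Q_sub by simp
  have "card (St (insert b ?Q)) * card (Fx ?Q) \<le> card (St (insert b ?Q) \<inter> Fx ?Q) * card (St ?Q)"
    by (rule card_mult_le_card_Int[OF perm_group_St perm_group_Fx perm_group_St finite_X _ Fx_subset_St]) (auto simp: St_iff)
  also have "\<dots> \<le> card (Fx (insert b ?Q)) * card (St ?Q)"
  proof (rule mult_le_mono1, rule card_mono)
    show "finite (Fx (insert b ?Q))" by (rule finite_perm_group[OF perm_group_Fx finite_X])
    show "St (insert b ?Q) \<inter> Fx ?Q \<subseteq> Fx (insert b ?Q)" using b(3) by (auto simp: St_iff)
  qed
  finally have "real (card (St (insert b ?Q)) * card (Fx ?Q)) \<le> real (card (Fx (insert b ?Q)) * card (St ?Q))" by (simp only: of_nat_le_iff)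
  then have "real (card (St (insert b ?Q))) * 2 powr V lf ?Q \<le> 2 powr V lf (insert b ?Q) * real (card (St ?Q))"
    using card_Fx[OF sub] card_Fx[OF Q_sub] by simp
  then have "log 2 (real (card (St (insert b ?Q))) * 2 powr V lf ?Q) \<le> log 2 (2 powr V lf (insert b ?Q) * real (card (St ?Q)))"
    using card_St_pos by (intro log2_mono mult_pos_pos) auto
  then have 1: "log 2 (card (St (insert b ?Q))) + V lf ?Q \<le> V lf (insert b ?Q) + log 2 (card (St ?Q))"
    using card_St_pos by (simp add: log_mult_pos)
  have "real (card (St (Q (Suc (Suc j))))) \<le> real (2 * card (St (insert b ?Q)))"
    using St_step[OF len b(1)] by (simp only: of_nat_le_iff)
  then have "log 2 (card (St (Q (Suc (Suc j))))) \<le> log 2 (2 * real (card (St (insert b ?Q))))"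
    using card_St_pos by (intro log2_mono) auto
  also have "\<dots> = 1 + log 2 (card (St (insert b ?Q)))" using card_St_pos by (simp add: log_mult_pos)
  finally have 2: "log 2 (card (St (Q (Suc (Suc j))))) \<le> 1 + log 2 (card (St (insert b ?Q)))" .
  have 3: "V wbal (Q j) \<le> V lf ?Q" using V_wbal_le[OF Q_sub bs_in[OF jl]] Q_Suc[OF jl] by simp
  have "real k * log 2 3 \<le> real k * (8 / 5)" by (intro mult_left_mono log2_3_le) simp
  then show ?thesis using 1 2 3 b(2) by (simp add: \<delta>_def)
qed

lemma \<delta>_le:
  assumes lk: "k \<le> l" and j: "1 \<le> j" "j < length bs"
  shows "\<delta> j \<le> 2 * log 2 k + real j * (1 + 8 / 5 * real k)"
  using j
proof (induction j rule: dec_induct)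
  case base then show ?case using \<delta>_1_le[OF lk] by simp
next
  case (step n)
  have "\<delta> (Suc n) \<le> \<delta> n + (1 + 8 / 5 * real k)" by (rule \<delta>_Suc_le[OF lk]) (use step in auto)
  moreover have "\<delta> n \<le> 2 * log 2 k + real n * (1 + 8 / 5 * real k)" using step by simp
  moreover have "real (Suc n) * (1 + 8 / 5 * real k) = real n * (1 + 8 / 5 * real k) + (1 + 8 / 5 * real k)"
    by (simp only: of_nat_Suc distrib_right mult_1 add.commute)
  ultimately show ?case by linarith
qed

text \<open>\<open>window\<close> from position 1 with deficits linear in j: the coefficients add up
  to 2 (1 + ... + S) + (S + 1) = (S + 1)^2.\<close>

lemma log_St_window:
  assumes lk: "k \<le> l" and S: "l \<le> k ^ S" and len: "S + 1 < length bs"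
  shows "log 2 (card (St (Q (S + 2)))) \<le> real (4 * S + 2) * log 2 k + (real S + 1)\<^sup>2 * (1 + 8 / 5 * real k)"
proof -
  define a where "a = 2 * log 2 k"
  define c where "c = 1 + 8 / 5 * real k"
  have "log 2 (card (St (Q (Suc (1 + S))))) \<le> \<delta> (1 + S) + 2 * (\<Sum>j=1..<1 + S. \<delta> j)"
    by (rule window[OF S]) (use len in auto)
  also have "\<dots> \<le> (a + real (1 + S) * c) + 2 * (\<Sum>j=1..<1 + S. a + real j * c)"
    unfolding a_def c_def by (intro add_mono mult_left_mono sum_mono \<delta>_le[OF lk]) (use len in auto)
  also have "(\<Sum>j=1..<1 + S. a + real j * c) = real S * a + (real S * (real S + 1) / 2) * c"
    by (induction S) (auto simp: algebra_simps field_simps)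
  also have "(a + real (1 + S) * c) + 2 * (real S * a + (real S * (real S + 1) / 2) * c) = (2 * real S + 1) * a + (real S + 1)\<^sup>2 * c"
    by (simp add: power2_eq_square field_simps)
  also have "(2 * real S + 1) * a = real (4 * S + 2) * log 2 k" by (simp add: a_def algebra_simps)
  finally show ?thesis by (simp add: c_def)
qed

end

section \<open>Bounding the length of a greedy run\<close>

text \<open>The tangent of log2 at \<open>a\<close>, its slope 1 / (a ln 2) rounded up to 2 /
  a.\<close>

lemma log2_le_linear: assumes "0 < a" "a \<le> x" shows "log 2 x \<le> log 2 a + 2 * (x / a - 1)"
proof -
  have "exp (1 / 2 :: real) ^ 2 \<le> 2 ^ 2" using exp_le by (simp add: exp_of_nat_mult[symmetric])
  then have "exp (1 / 2 :: real) \<le> 2" by (rule power2_le_imp_le) simp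
  then have "ln (exp (1 / 2)) \<le> ln (2 :: real)" by (subst ln_le_cancel_iff) auto
  then have ln2: "1 / 2 \<le> ln (2 :: real)" by (simp only: ln_exp)
  have "ln (x / a) \<le> x / a - 1" using assms by (intro ln_le_minus_one) simp
  then have "ln x \<le> ln a + (x / a - 1)" using assms by (simp add: ln_div)
  then have "log 2 x \<le> (ln a + (x / a - 1)) / ln 2" unfolding log_def by (intro divide_right_mono) auto
  also have "\<dots> = log 2 a + (x / a - 1) / ln 2" by (simp add: log_def add_divide_distrib)
  also have "(x / a - 1) / ln 2 \<le> (x / a - 1) / (1 / 2)"
    using assms ln2 by (intro divide_left_mono) auto
  finally show ?thesis by (simp add: mult.commute)
qed

lemma log2_le_850: assumes "850 \<le> (x::real)" shows "log 2 x \<le> x / 85"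
proof -
  have "log 2 (850::real) \<le> log 2 (2 ^ 10)" by (intro log2_mono) auto
  also have "log 2 ((2::real) ^ 10) = 10" by (subst log_nat_power) simp_all
  finally have "log 2 (850::real) \<le> 10" .
  moreover have "log 2 x \<le> log 2 850 + 2 * (x / 850 - 1)" using log2_le_linear[of 850 x] assms by simp
  moreover have "10 + 2 * (x / 850 - 1) \<le> x / 85" using assms by (simp add: field_simps)
  ultimately show ?thesis by linarith
qed

text \<open>This precision is what \<open>medium_l_refinement\<close> needs: 2/5 times 25/36 is
  5/18, still below 9/32.\<close>

lemma ln2_le: "ln (2 :: real) \<le> 25 / 36"
proof -
  have "2 \<le> (1 + 25 / 288 + (25 / 288)\<^sup>2 / 2 :: real) ^ 8" by (simp add: power2_eq_square power_divide)
  also have "\<dots> \<le> exp (25 / 288) ^ 8" by (intro power_mono exp_lower_Taylor_quadratic) auto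
  also have "\<dots> = exp (25 / 36)" by (simp add: exp_of_nat_mult[symmetric])
  finally have "ln 2 \<le> ln (exp (25 / 36 :: real))" by (subst ln_le_cancel_iff) auto
  then show ?thesis by simp
qed

lemma log2_nat_le: "1 \<le> k \<Longrightarrow> log 2 (real k) \<le> real k"
proof -
  assume k: "1 \<le> k"
  have "real k \<le> 2 ^ k" using less_exp[of k] by (metis of_nat_less_iff of_nat_power less_imp_le of_nat_numeral)
  then have "log 2 (real k) \<le> log 2 (2 ^ k)" using k by (intro log2_mono) auto
  then show ?thesis by (simp add: log_nat_power)
qed

text \<open>155339 is the largest integer whose product with 103 stays below 4000^2, as
  \<open>tower_ge\<close> requires.\<close>

lemma power2_ge_sextic: "((s::nat) + 5) ^ 6 \<le> 155339 * 2 ^ s"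
proof -
  have step: "((s::nat) + 6) ^ 6 \<le> 2 * (s + 5) ^ 6" if "4 \<le> s" for s
  proof -
    have "9 * (s + 6) \<le> 10 * (s + 5)" using that by simp
    then have "(9 * (s + 6)) ^ 6 \<le> (10 * (s + 5)) ^ 6" by (rule power_mono) simp
    then have "531441 * (s + 6) ^ 6 \<le> 1000000 * (s + 5) ^ 6" by (simp only: power_mult_distrib) simp
    then show ?thesis by linarith
  qed
  show ?thesis
  proof (cases "s \<le> 4")
    case True
    then consider "s = 0" | "s = 1" | "s = 2" | "s = 3" | "s = 4" by linarith
    then show ?thesis by cases simp_all
  next
    case False
    have "4 \<le> s \<Longrightarrow> (s + 5) ^ 6 \<le> 155339 * 2 ^ s"
    proof (induction s rule: dec_induct)
      case base then show ?case by simp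
    next
      case (step n)
      have "(Suc n + 5) ^ 6 = (n + 6) ^ 6" by (simp add: add.commute)
      also have "\<dots> \<le> 2 * (n + 5) ^ 6" by (rule \<open>\<And>s. 4 \<le> s \<Longrightarrow> (s + 6) ^ 6 \<le> 2 * (s + 5) ^ 6\<close>) (use step in simp)
      also have "\<dots> \<le> 2 * (155339 * 2 ^ n)" using step by simp
      finally show ?case by simp
    qed
    then show ?thesis using False by simp
  qed
qed

text \<open>With T = (S + 1)^2 the last hypothesis gives k^2 T^2 \<ge> 4000^2. Since k^(S-2) \<ge>
  k^2 2^(S-4), it suffices that 103 T^3 \<le> 4000^2 2^(S-4).\<close>

lemma tower_ge:
  assumes "4 \<le> S" "2 \<le> k" "4000 < k * (S + 1)\<^sup>2"
  shows "103 * (S + 1)\<^sup>2 \<le> k ^ (S - 2)"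
proof -
  obtain s where s: "S = s + 4" using assms(1) by (metis add.commute le_Suc_ex)
  define T where "T = (S + 1)\<^sup>2"
  have T0: "0 < T" by (simp add: T_def)
  have "k\<^sup>2 * 2 ^ s \<le> k\<^sup>2 * k ^ s" using assms(2) by (simp add: power_mono)
  also have "\<dots> = k ^ (S - 2)" by (simp add: s power_add[symmetric])
  finally have 1: "k\<^sup>2 * 2 ^ s \<le> k ^ (S - 2)" .
  have "4000 * 4000 \<le> (k * T) * (k * T)" using assms(3) unfolding T_def[symmetric] by (intro mult_le_mono) auto
  then have 2: "16000000 \<le> k\<^sup>2 * T\<^sup>2" by (simp add: power2_eq_square ac_simps)
  have "S + 1 = s + 5" by (simp add: s)
  then have "103 * T * T\<^sup>2 = 103 * (s + 5) ^ 6" by (simp only: T_def) (simp only: mult.assoc power_mult[symmetric] power_add[symmetric], simp)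
  also have "\<dots> \<le> 103 * (155339 * 2 ^ s)" using power2_ge_sextic[of s] by simp
  also have "\<dots> \<le> 16000000 * 2 ^ s" by simp
  also have "\<dots> \<le> (k\<^sup>2 * T\<^sup>2) * 2 ^ s" using 2 by simp
  also have "\<dots> = (k\<^sup>2 * 2 ^ s) * T\<^sup>2" by simp
  also have "\<dots> \<le> k ^ (S - 2) * T\<^sup>2" using 1 by simp
  finally show ?thesis using T0 by (simp add: T_def)
qed

section \<open>Random refinements in two ranges of the parameters\<close>

context kl_parts
begin

lemma St_insert_int: "card (St (insert b Q)) \<le> card (St Q)"
  by (rule card_mono[OF finite_perm_group[OF perm_group_St finite_X]]) (auto simp: St_iff)

lemma card_sing: "card (sing Q) = k * l - card (X - sing Q)"
  using card_Diff_subset[OF finite_sing sing_sub, of Q] card_mono[OF finite_X sing_sub, of Q] card_X by simp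

text \<open>At most 2E \<le> l / 2 points lie outside singleton cells, so with p = l div 8 no part
  is bad. The denominator of the matching bound is at least kl - l/2 - l/4, which turns the bound
  into |St Q| k^k (k - 3/4)^(-p). \<open>N2\<close> makes this less than 1, by log2 (k - 3/4) \<ge>
  (log2 k) / 4 and p > l / 8 - 1.\<close>

lemma large_l_refinement:
  assumes Q: "Q \<subseteq> Om" "finite Q" and E: "log 2 (card (St Q)) \<le> E" and lE: "4 * E \<le> real l"
    and N2: "E + log 2 k * real k < log 2 k * (real l / 32 - 1 / 4)"
  shows "\<exists>b\<in>Om. real (card (St (insert b Q))) < 2 powr V wbal Q + 1"
proof -
  define m where "m = card (X - sing Q)"
  define p where "p = l div 8"
  have St1: "1 \<le> real (card (St Q))" using card_perm_group_pos[OF perm_group_St finite_X, of Q] by linarith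
  have E0: "0 \<le> E" using E St1 by (meson order_trans zero_le_log_cancel_iff one_less_numeral_iff semiring_norm(76) less_le_trans zero_less_one)
  have lk: "0 < log 2 (real k)" using k2 by simp
  have lbig: "real l > 32 * real k"
  proof -
    have "log 2 k * real k < log 2 k * (real l / 32 - 1 / 4)" using N2 E0 by linarith
    then have "real k < real l / 32 - 1 / 4" using lk by (simp add: mult_less_cancel_left_pos)
    then show ?thesis by linarith
  qed
  have k2': "2 \<le> real k" using k2 by simp
  have "real m \<le> 2 * V lf Q" unfolding m_def by (rule card_nonsing_le[OF Q(1)])
  also have "\<dots> \<le> 2 * E" using log_card_St_ge[OF Q(1)] E by linarith
  finally have m: "real m \<le> real l / 2" using lE by linarith
  have p: "real p \<le> real l / 8" "real l / 8 - 1 < real p" unfolding p_def by linarith+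
  have ml: "m \<le> k * l"
    unfolding m_def using card_mono[OF finite_X, of "X - sing Q"] card_X by simp
  have R: "real (card (sing Q)) = real k * real l - real m"
    using card_sing[of Q] ml unfolding m_def by (simp add: of_nat_diff)
  have kl2: "2 * real l \<le> real k * real l" using k2' by (intro mult_right_mono) auto
  have p2: "2 * p < card (sing Q)"
  proof -
    have "2 * real p < real (card (sing Q))" using R kl2 m p lbig k2' by linarith
    then show ?thesis by linarith
  qed
  obtain b where b: "b \<in> Om" "real (card (St (insert b Q))) \<le> 2 powr V wbal Q * real 0 ^ (card Q * 0) +
      real (card (St Q)) * (real (k ^ k) * real l ^ p / real (card (sing Q) - 2 * p) ^ p)"
  proof (rule bexE[OF random_refinement[OF Q]])
    have "real (m div k) \<le> real m / real k" by (rule of_nat_div_le_of_nat)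
    also have "\<dots> \<le> real m / 2" using k2' by (intro divide_left_mono) auto
    finally have "real (m div k) + 1 < real l" using m lbig k2' by linarith
    then show "card (X - sing Q) div k + 1 < l" unfolding m_def by linarith
    show "card {A \<in> P. card (A \<inter> sing Q) < p} \<le> 0" if "P \<in> Q" for P
    proof -
      have PO: "P \<in> Om" using Q that by auto
      have "\<not> card (A \<inter> sing Q) < p" if A: "A \<in> P" for A
      proof -
        have "A \<subseteq> (A \<inter> sing Q) \<union> (X - sing Q)" using OmD(6)[OF PO A] by auto
        then have "card A \<le> card ((A \<inter> sing Q) \<union> (X - sing Q))" using finite_X finite_sing by (intro card_mono) auto
        also have "\<dots> \<le> card (A \<inter> sing Q) + m" unfolding m_def by (rule card_Un_le)
        finally have "real l \<le> real (card (A \<inter> sing Q)) + real m" using OmD(3)[OF PO A] by linarith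
        then show ?thesis using m p lbig k2' by linarith
      qed
      then have "{A \<in> P. card (A \<inter> sing Q) < p} = {}" by blast
      then show ?thesis by (simp only: card.empty)
    qed
    show "(\<Prod>i<d. k - i) \<le> k ^ k" if "d \<le> p" "d \<le> k" for d
    proof -
      have "(\<Prod>i<d. k - i) \<le> (\<Prod>i<d. k)" by (intro prod_mono) auto
      also have "\<dots> \<le> k ^ k" using that k2 by (simp add: power_increasing)
      finally show ?thesis .
    qed
    show "2 * p < card (sing Q)" by (rule p2)
  qed (use that in blast)
  have "real (card (St Q)) * (real (k ^ k) * real l ^ p / real (card (sing Q) - 2 * p) ^ p) < 1"
  proof -
    have d: "real (card (sing Q) - 2 * p) = real (card (sing Q)) - 2 * real p" using p2 by (simp add: of_nat_diff)
    have "(real k - 3 / 4) * real l \<le> real (card (sing Q) - 2 * p)"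
      unfolding d R using m p by (simp add: algebra_simps)
    then have "real l / real (card (sing Q) - 2 * p) \<le> real l / ((real k - 3 / 4) * real l)"
      using k2' l2 p2 by (intro divide_left_mono mult_pos_pos) auto
    also have "\<dots> = 1 / (real k - 3 / 4)" using l2 by simp
    finally have "(real l / real (card (sing Q) - 2 * p)) ^ p \<le> (1 / (real k - 3 / 4)) ^ p" by (intro power_mono) auto
    then have 1: "real (k ^ k) * real l ^ p / real (card (sing Q) - 2 * p) ^ p \<le> real k ^ k * (1 / (real k - 3 / 4)) ^ p"
      by (simp add: power_divide mult_left_mono times_divide_eq_right[symmetric] del: times_divide_eq_right)
    have k34: "log 2 k / 4 \<le> log 2 (real k - 3 / 4)"
    proof -
      \<comment> \<open>Already true at k = 2, where (5/4)^4 > 2.\<close>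
      have "real k \<le> (real k - 3 / 4) ^ 4"
      proof -
        define y where "y = real k - 3 / 4"
        have y: "5 / 4 \<le> y" using k2' by (simp add: y_def)
        have "(5 / 4) ^ 3 \<le> y ^ 3" using y by (intro power_mono) auto
        then have "y * (125 / 64) \<le> y * y ^ 3" using y by (intro mult_left_mono) (auto simp: power3_eq_cube)
        moreover have "y * y ^ 3 = y ^ 4" by (simp add: power_numeral_reduce)
        moreover have "y + 3 / 4 \<le> y * (125 / 64)" using y by linarith
        moreover have "real k = y + 3 / 4" by (simp add: y_def)
        ultimately have "real k \<le> y ^ 4" by linarith
        then show ?thesis by (simp add: y_def)
      qed
      then have "log 2 k \<le> log 2 ((real k - 3 / 4) ^ 4)" using k2' by (intro log2_mono) auto
      then show ?thesis using k2' by (simp add: log_nat_power)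
    qed
    have "log 2 (real k ^ k * (1 / (real k - 3 / 4)) ^ p) = real k * log 2 k - real p * log 2 (real k - 3 / 4)"
      using k2' by (simp add: log_mult_pos log_nat_power log_divide_pos)
    also have "\<dots> \<le> real k * log 2 k - real p * (log 2 k / 4)"
      using k34 by (intro diff_left_mono mult_left_mono) auto
    also have "\<dots> \<le> real k * log 2 k - (real l / 8 - 1) * (log 2 k / 4)"
      using p(2) lk by (intro diff_left_mono mult_right_mono) auto
    finally have 2: "log 2 (real k ^ k * (1 / (real k - 3 / 4)) ^ p) \<le> real k * log 2 k - (real l / 8 - 1) * (log 2 k / 4)" .
    have pos: "0 < real k ^ k * (1 / (real k - 3 / 4)) ^ p" using k2' by (intro mult_pos_pos zero_less_power) auto
    have "log 2 (real (card (St Q)) * (real k ^ k * (1 / (real k - 3 / 4)) ^ p)) =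
        log 2 (card (St Q)) + log 2 (real k ^ k * (1 / (real k - 3 / 4)) ^ p)"
      using pos St1 by (intro log_mult_pos) auto
    also have "\<dots> \<le> E + (real k * log 2 k - (real l / 8 - 1) * (log 2 k / 4))" using E 2 by linarith
    also have "\<dots> < 0" using N2 by (simp add: algebra_simps)
    finally have "real (card (St Q)) * (real k ^ k * (1 / (real k - 3 / 4)) ^ p) < 1"
      using pos St1 by (subst (asm) log_less_zero_cancel_iff) auto
    moreover have "real (card (St Q)) * (real (k ^ k) * real l ^ p / real (card (sing Q) - 2 * p) ^ p) \<le>
        real (card (St Q)) * (real k ^ k * (1 / (real k - 3 / 4)) ^ p)"
      using 1 by (intro mult_left_mono) auto
    ultimately show ?thesis by linarith
  qed
  then show ?thesis using b by (intro bexI[OF _ b(1)]) simp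
qed

text \<open>Cells have at most \<open>k\<close> points, so an even refinement has a trivial
  part-fixing group. For l near k the count k^k of renamings is too lossy; the falling factorial
  with p about 3k/4 makes the ratio about the product of the 1 - i/k, that is exp (-9k/32), below
  2^(-2k/5). A bad part contains at least k/4 - 1 of the at most 2E points outside singleton cells,
  whence the condition on \<open>B\<close>.\<close>

lemma medium_l_refinement:
  assumes Q: "Q \<subseteq> Om" "finite Q" and E: "log 2 (card (St Q)) \<le> E" and small: "E \<le> 321 / 100 * real k"
    and k: "3900 \<le> k" "k \<le> l + 1" and cell: "\<And>C. C \<in> cells Q \<Longrightarrow> card C \<le> k"
    and B: "2 * E < (real B + 1) * (real k / 4 - 1)"
  shows "\<exists>b\<in>Om. real (card (St (insert b Q))) \<le> real B ^ (card Q * B) + 2 powr (E - 2 / 5 * real k)"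
proof -
  define m where "m = card (X - sing Q)"
  define p where "p = 3 * k div 4"
  have "real m \<le> 2 * V lf Q" unfolding m_def by (rule card_nonsing_le[OF Q(1)])
  also have "\<dots> \<le> 2 * E" using log_card_St_ge[OF Q(1)] E by linarith
  finally have m: "real m \<le> 2 * E" .
  have kr: "3900 \<le> real k" "real k \<le> real l + 1" using k by linarith+
  have p: "real p \<le> 3 / 4 * real k" "3 / 4 * real k - 3 / 4 \<le> real p" unfolding p_def by linarith+
  have pk: "p \<le> k" using p(1) kr by linarith
  have ml: "m \<le> k * l"
    unfolding m_def using card_mono[OF finite_X, of "X - sing Q"] card_X by simp
  have R: "real (card (sing Q)) = real k * real l - real m"
    using card_sing[of Q] ml unfolding m_def by (simp add: of_nat_diff)
  have kl2: "3899 * real k \<le> real k * real l" using kr by (simp add: mult.commute[of "real k"] mult_right_mono)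
  have p2: "2 * p < card (sing Q)"
  proof -
    have "2 * real p < real (card (sing Q))" using R kl2 m p small kr by linarith
    then show ?thesis by linarith
  qed
  define K where "K = (\<Prod>i<p. k - i)"
  have V0: "V wbal Q = 0" unfolding V_def by (intro sum.neutral ballI wbal_eq_0 cell)
  obtain b where b: "b \<in> Om" "real (card (St (insert b Q))) \<le> 2 powr V wbal Q * real B ^ (card Q * B) +
      real (card (St Q)) * (real K * real l ^ p / real (card (sing Q) - 2 * p) ^ p)"
  proof (rule bexE[OF random_refinement[OF Q]])
    have "real (m div k) \<le> real m / real k" by (rule of_nat_div_le_of_nat)
    also have "\<dots> \<le> 7" using m small kr by (simp add: pos_divide_le_eq)
    finally have "real (m div k) + 1 < real l" using kr by linarith
    then show "card (X - sing Q) div k + 1 < l" unfolding m_def by linarith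
    show "card {A \<in> P. card (A \<inter> sing Q) < p} \<le> B" if "P \<in> Q" for P
    proof -
      have PO: "P \<in> Om" using Q that by auto
      let ?bad = "{A \<in> P. card (A \<inter> sing Q) < p}"
      have "real k / 4 - 1 \<le> real (card ((X - sing Q) \<inter> A))" if A: "A \<in> ?bad" for A
      proof -
        have "A = (A \<inter> sing Q) \<union> ((X - sing Q) \<inter> A)" using A OmD(6)[OF PO] by auto
        then have "card A \<le> card (A \<inter> sing Q) + card ((X - sing Q) \<inter> A)" using card_Un_le by metis
        then have "real l \<le> real (card (A \<inter> sing Q)) + real (card ((X - sing Q) \<inter> A))" using A OmD(3)[OF PO, of A] by simp
        moreover have "real (card (A \<inter> sing Q)) \<le> real p" using A by simp
        ultimately show ?thesis using p kr by linarith
      qed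
      then have "(\<Sum>A\<in>?bad. real k / 4 - 1) \<le> (\<Sum>A\<in>?bad. real (card ((X - sing Q) \<inter> A)))" by (rule sum_mono)
      also have "\<dots> \<le> (\<Sum>A\<in>P. real (card ((X - sing Q) \<inter> A)))" using OmD(4)[OF PO] by (intro sum_mono2) auto
      also have "\<dots> = real m" unfolding m_def of_nat_sum[symmetric] using sum_card_Int_parts[OF PO, of "X - sing Q"] by simp
      finally have "real (card ?bad) * (real k / 4 - 1) \<le> real m" by simp
      then have "real (card ?bad) * (real k / 4 - 1) < (real B + 1) * (real k / 4 - 1)" using m B by linarith
      then have "real (card ?bad) < real B + 1" using kr by (simp add: mult_less_cancel_right_pos)
      then show ?thesis by linarith
    qed
    show "(\<Prod>i<d. k - i) \<le> K" if "d \<le> p" "d \<le> k" for d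
      unfolding K_def using that pk by (intro dvd_imp_le prod_dvd_prod_subset prod_pos) auto
    show "2 * p < card (sing Q)" by (rule p2)
  qed (use that in blast)
  have "real K * real l ^ p / real (card (sing Q) - 2 * p) ^ p \<le> 2 powr (- (2 / 5 * real k))"
  proof -
    define D where "D = real (card (sing Q) - 2 * p)"
    have l8: "0 < real l - 8" using kr by linarith
    \<comment> \<open>2E + 2p \<le> 6.42 k + 1.5 k < 8k.\<close>
    have D: "real k * (real l - 8) \<le> D"
    proof -
      have "D = real (card (sing Q)) - 2 * real p" unfolding D_def using p2 by (simp add: of_nat_diff)
      then show ?thesis using R m p small kr by (simp add: algebra_simps)
    qed
    have D0: "0 < real k * (real l - 8)" using kr l8 by (intro mult_pos_pos) auto
    have each: "real (k - i) * (real l / D) \<le> exp (- (real i / real k) + 8 / (real l - 8))" if i: "i < p" for i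
    proof -
      have "real l / D \<le> real l / (real k * (real l - 8))" using D D0 by (intro divide_left_mono) (auto intro: mult_pos_pos)
      then have "real (k - i) * (real l / D) \<le> real (k - i) * (real l / (real k * (real l - 8)))" by (intro mult_left_mono) auto
      also have "\<dots> = (real k - real i) * (real l / (real k * (real l - 8)))" using i pk by (simp add: of_nat_diff)
      also have "(real k - real i) * (real l / (real k * (real l - 8))) = (1 + - (real i / real k)) * (1 + 8 / (real l - 8))"
        using kr l8 by (simp add: field_simps)
      also have "\<dots> \<le> exp (- (real i / real k)) * exp (8 / (real l - 8))"
        using l8 i pk by (intro mult_mono exp_ge_add_one_self) auto
      finally show ?thesis by (simp only: exp_add)
    qed
    have "real K * real l ^ p / D ^ p = (\<Prod>i<p. real (k - i)) * (\<Prod>i<p. real l / D)"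
      by (simp add: K_def power_divide)
    also have "\<dots> = (\<Prod>i<p. real (k - i) * (real l / D))" by (simp only: prod.distrib)
    also have "\<dots> \<le> (\<Prod>i<p. exp (- (real i / real k) + 8 / (real l - 8)))"
    proof (rule prod_mono)
      fix i assume "i \<in> {..<p}"
      then show "0 \<le> real (k - i) * (real l / D) \<and> real (k - i) * (real l / D) \<le> exp (- (real i / real k) + 8 / (real l - 8))"
        using each[of i] D D0 by simp
    qed
    also have "\<dots> = exp (\<Sum>i<p. - (real i / real k) + 8 / (real l - 8))" by (simp only: exp_sum finite_lessThan)
    also have "(\<Sum>i<p. - (real i / real k) + 8 / (real l - 8)) = real p * (8 / (real l - 8)) - real p * (real p - 1) / 2 / real k"
    proof -
      have 1: "(\<Sum>i<q. real i) = real q * (real q - 1) / 2" for q by (induction q) (auto simp: field_simps)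
      have "(\<Sum>i<p. - (real i / real k)) = - ((\<Sum>i<p. real i) / real k)" by (simp add: sum_negf sum_divide_distrib)
      then have "(\<Sum>i<p. - (real i / real k)) = - (real p * (real p - 1) / 2 / real k)" by (simp only: 1)
      then show ?thesis unfolding sum.distrib by (simp only: sum_constant card_lessThan)
    qed
    also have "\<dots> \<le> - (2 / 5 * real k) * ln 2"
    proof -
      have "real p * (8 / (real l - 8)) \<le> 7" using p kr l8 by (simp add: pos_divide_le_eq)
      moreover have "7 + 2 / 5 * real k * ln 2 \<le> real p * (real p - 1) / 2 / real k"
      proof -
        have "2 / 5 * real k * ln 2 \<le> 2 / 5 * real k * (25 / 36)" using ln2_le by (intro mult_left_mono) auto
        moreover have "(7 + 2 / 5 * real k * (25 / 36)) * (2 * real k) \<le> (3 / 4 * real k - 3 / 4) * (3 / 4 * real k - 3 / 4 - 1)"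
        proof -
          have "3900 * real k \<le> real k * real k" using kr by (intro mult_right_mono) auto
          then show ?thesis by (simp add: algebra_simps)
        qed
        moreover have "(3 / 4 * real k - 3 / 4) * (3 / 4 * real k - 3 / 4 - 1) \<le> real p * (real p - 1)"
          using p kr by (intro mult_mono) auto
        ultimately have "(7 + 2 / 5 * real k * ln 2) * (2 * real k) \<le> real p * (real p - 1)"
          using kr mult_right_mono[of "7 + 2 / 5 * real k * ln 2" "7 + 2 / 5 * real k * (25 / 36)" "2 * real k"] by linarith
        then show ?thesis using kr by (simp add: pos_le_divide_eq mult.assoc)
      qed
      ultimately show ?thesis by simp
    qed
    finally show ?thesis by (simp add: D_def powr_def)
  qed
  then have "real (card (St Q)) * (real K * real l ^ p / real (card (sing Q) - 2 * p) ^ p) \<le> 2 powr E * 2 powr (- (2 / 5 * real k))"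
  proof (intro mult_mono)
    have "0 < real (card (St Q))" using card_perm_group_pos[OF perm_group_St finite_X, of Q] by simp
    then show "real (card (St Q)) \<le> 2 powr E" using E by (simp add: log_le_iff)
  qed auto
  also have "\<dots> = 2 powr (E - 2 / 5 * real k)" by (simp add: powr_add[symmetric])
  finally show ?thesis using b V0 by (intro bexI[OF _ b(1)]) simp
qed

end

lemma log2_le_of_le_power: assumes "1 \<le> k" "k \<le> 2 ^ n" shows "log 2 (real k) \<le> real n"
proof -
  have "real k \<le> 2 ^ n" using assms(2) by (metis of_nat_le_iff of_nat_numeral of_nat_power)
  then have "log 2 (real k) \<le> log 2 (2 ^ n)" using assms(1) by (intro log2_mono) auto
  then show ?thesis by (simp add: log_nat_power)
qed

lemma le_log2_of_power_le: assumes "2 ^ n \<le> k" shows "real n \<le> log 2 (real k)"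
proof -
  have "2 ^ n \<le> real k" using assms by (metis of_nat_le_iff of_nat_numeral of_nat_power)
  then have "log 2 (2 ^ n) \<le> log 2 (real k)" by (intro log2_mono) auto
  then show ?thesis by (simp add: log_nat_power)
qed

lemma log2_card_le: "0 < c \<Longrightarrow> real c \<le> 2 powr x \<Longrightarrow> log 2 (real c) \<le> x"
  by (simp add: log_le_iff)

section \<open>Contradiction from a run longer than eleven times a base\<close>

locale long_run = greedy_run +
  fixes B :: "nat set set set"
  assumes finB: "finite B" and BOm: "B \<subseteq> Om" and Btriv: "pstab G part_act B = {id}"
    and len: "11 * card B < length bs"
begin

lemma base_bound: "l \<le> k ^ (card B - 1)" "2 \<le> card B"
proof -
  have "pstab (Alt (k * l)) part_act B \<subseteq> pstab G part_act B" using G by (auto simp: pstab_def Alt_def Sym_def)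
  moreover have "id \<in> pstab (Alt (k * l)) part_act B"
    by (rule perm_groupD(1)[OF perm_group_pstab[OF perm_group_Alt]])
  ultimately have "pstab (Alt (k * l)) part_act B = {id}" using Btriv by auto
  then have kl: "k * l \<le> k ^ card B + 1" by (rule base_label_bound[OF BOm finB])
  have b1: "1 \<le> card B"
  proof (rule ccontr)
    assume "\<not> 1 \<le> card B"
    then have "card B = 0" by simp
    then have "k * l \<le> 2" using kl by simp
    then show False using n4 by simp
  qed
  then have "k ^ card B = k * k ^ (card B - 1)" by (metis Suc_pred' less_eq_Suc_le One_nat_def power_Suc)
  \<comment> \<open>The summand 1 of the label bound is absorbed because k \<ge> 2.\<close>
  then have "k * l < k * (k ^ (card B - 1) + 1)" using kl k2 by simp
  then have "l < k ^ (card B - 1) + 1" by (simp only: mult_less_cancel1)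
  then show 1: "l \<le> k ^ (card B - 1)" by simp
  show "2 \<le> card B"
  proof (rule ccontr)
    assume "\<not> 2 \<le> card B"
    then have "card B = 1" using b1 by simp
    then show False using 1 l2 by simp
  qed
qed

lemma length_ge: "22 < length bs" using base_bound(2) len by simp

lemma small_absurd: assumes "2 * j \<le> 3 * card B" "log 2 (card (St (Q j))) \<le> 12900" shows False
proof (rule not_small[OF finB Btriv BOm _ len assms(1)])
  show "0 < card B" using base_bound(2) by simp
  have "log 2 (card (H j)) \<le> log 2 (card (St (Q j)))" using card_H_le[of j] card_H_pos[of j] by (intro log2_mono) auto
  then show "log 2 (card (H j)) \<le> 12900" using assms(2) by linarith
qed

lemma log_St_step:
  assumes "i < length bs" "b \<in> Om" "real (card (St (insert b (Q i)))) \<le> 2 powr x"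
  shows "log 2 (card (St (Q (Suc i)))) \<le> 1 + x"
proof -
  have "real (card (St (Q (Suc i)))) \<le> real (2 * card (St (insert b (Q i))))"
    using St_step[OF assms(1,2)] by (simp only: of_nat_le_iff)
  also have "\<dots> \<le> 2 * 2 powr x" using assms(3) by simp
  also have "\<dots> = 2 powr (1 + x)" by (simp add: powr_add)
  finally show ?thesis by (rule log2_card_le[OF card_St_pos])
qed

lemma St_antimono: assumes "i < length bs" shows "log 2 (card (St (Q (Suc i)))) \<le> log 2 (card (St (Q i)))"
proof -
  have "card (St (Q (Suc i))) \<le> card (St (Q i))" unfolding Q_Suc[OF assms] by (rule St_insert_int)
  then show ?thesis using card_St_pos by (intro log2_mono) auto
qed

text \<open>From order at most k^2 after two steps, the fixed-point bound 5 / (2k) leads to at most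
  1 + 5k/2 and then to at most 7 elements; two halvings finish. The number 275/40 = 55/8 comes from
  5 + 25k/2 \<le> 55k/4 for k \<ge> 4.\<close>

lemma sparse_absurd: assumes lk: "l + 2 \<le> k" shows False
proof -
  have k4: "4 \<le> k" using lk l2 by simp
  have k0: "0 < real k" using k4 by simp
  have Q1: "Q 1 = {bs ! 0}" by (rule Q_1) (use length_ge in linarith)
  have P: "bs ! 0 \<in> Om" by (rule bs_in) (use length_ge in linarith)
  obtain b where b: "b \<in> Om" "card (St {bs ! 0, b}) \<le> k\<^sup>2" using sparse_candidate[OF P lk] by blast
  have "card (H (Suc 1)) \<le> card (pstab G part_act (insert b (Q 1)))" by (rule H_step[OF _ b(1)]) (use length_ge in linarith)
  also have "\<dots> \<le> card (St (insert b (Q 1)))" by (rule card_pstab_le)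
  also have "\<dots> \<le> k\<^sup>2" using b(2) Q1 by (simp add: insert_commute)
  finally have H2: "real (card (H 2)) \<le> real k * real k"
    by (simp add: numeral_2_eq_2 power2_eq_square del: of_nat_mult flip: of_nat_mult)
  have step: "2 * real k * (real (card (H (Suc i))) - 1) \<le> 5 * real (card (H i))" if i: "i < length bs" for i
  proof -
    obtain c where c: "c \<in> Om" "2 * real k * (real (card (pstab (H i) part_act {c})) - 1) \<le> 5 * real (card (H i))"
      using good_point[OF perm_group_H k4] by blast
    have "card (H (Suc i)) \<le> card (pstab (H i) part_act {c})"
      using H_step[OF i c(1)] pstab_insert[of G c "Q i"] by (simp add: H_def)
    then have "2 * real k * (real (card (H (Suc i))) - 1) \<le> 2 * real k * (real (card (pstab (H i) part_act {c})) - 1)"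
      by (intro mult_left_mono) auto
    then show ?thesis using c(2) by linarith
  qed
  have "2 * real k * (real (card (H 3)) - 1) \<le> 5 * (real k * real k)"
    using step[of 2] H2 length_ge by (simp add: numeral_3_eq_3 numeral_2_eq_2)
  then have "real k * (2 * (real (card (H 3)) - 1)) \<le> real k * (5 * real k)" by (simp add: algebra_simps)
  then have H3: "2 * (real (card (H 3)) - 1) \<le> 5 * real k" using k0 by (simp only: mult_le_cancel_left_pos)
  have "2 * real k * (real (card (H 4)) - 1) \<le> 5 * real (card (H 3))" using step[of 3] length_ge by simp
  also have "\<dots> \<le> 5 * (1 + 5 / 2 * real k)" using H3 by simp
  also have "\<dots> \<le> 2 * real k * (275 / 40)" using k4 by simp
  finally have "real (card (H 4)) - 1 \<le> 275 / 40" using k0 by (simp only: mult_le_cancel_left_pos mult_pos_pos zero_less_numeral)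
  then have H4: "card (H 4) \<le> 7" by linarith
  have "2 * card (H (Suc 4)) \<le> card (H 4)" "2 * card (H (Suc 5)) \<le> card (H 5)"
    by (rule H_half; use length_ge in linarith)+
  then have "card (H 6) < 2" using H4 by simp
  then show False using H_nontrivial[of 6] length_ge by simp
qed

text \<open>Eight random refinements lower \<open>log 2 |St|\<close> from \<open>3.21 k\<close> to \<open>0.37 k\<close>.  Then fewer than three parts per partition
  can be short of singleton cells, and after one more step none.\<close>

lemma medium_absurd:
  assumes k: "3900 \<le> k" "k \<le> l + 1" and cell: "\<And>C. C \<in> cells (Q 3) \<Longrightarrow> card C \<le> k"
    and E: "log 2 (card (St (Q 3))) \<le> 321 / 100 * real k"
  shows False
proof -
  have kr: "3900 \<le> real k" using k by simp
  have cellj: "card C \<le> k" if j: "3 \<le> j" and C: "C \<in> cells (Q j)" for j C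
  proof -
    have "Q 3 \<subseteq> Q j" unfolding Q_def by (rule set_take_subset_set_take[OF j])
    then obtain D where D: "D \<in> cells (Q 3)" "C \<subseteq> D" using cells_mono_subset[OF _ Q_sub C] by blast
    then show ?thesis using cell[OF D(1)] card_mono[OF finite_in_cells[OF D(1)] D(2)] by linarith
  qed
  have step: "\<exists>b\<in>Om. real (card (St (insert b (Q j)))) \<le> real c ^ (j * c) + 2 powr (x - 2 / 5 * real k)"
    if j: "3 \<le> j" and x: "log 2 (card (St (Q j))) \<le> x" "x \<le> 321 / 100 * real k" and c: "2 * x < (real c + 1) * (real k / 4 - 1)" for j x c
  proof -
    obtain b where b: "b \<in> Om" "real (card (St (insert b (Q j)))) \<le> real c ^ (card (Q j) * c) + 2 powr (x - 2 / 5 * real k)"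
      using medium_l_refinement[OF Q_sub finite_Q x k cellj[OF j] c] by blast
    have "real c ^ (card (Q j) * c) \<le> real c ^ (j * c)"
    proof (cases "c = 0")
      case False
      then show ?thesis using card_Q[of j] by (intro power_increasing mult_le_mono1) auto
    qed simp
    then show ?thesis using b by (intro bexI[OF _ b(1)]) linarith
  qed
  \<comment> \<open>The decrement 0.39 k instead of 0.4 k absorbs an added constant 2. The floor
    0.37 k dominates the bad-part term, since 25^250 < 2^1250 and 0.36 k \<ge> 1404.\<close>
  define e where "e i = max (37 / 100 * real k) (321 / 100 * real k - 39 / 100 * real k * real i)" for i
  have e: "e i \<le> 321 / 100 * real k" for i
    unfolding e_def using kr by (intro max.boundedI) auto
  have "log 2 (card (St (Q (3 + i)))) \<le> e i" if "i \<le> 8" for i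
    using that
  proof (induction i)
    case 0 then show ?case using E by (simp add: e_def)
  next
    case (Suc i)
    have IH: "log 2 (card (St (Q (3 + i)))) \<le> e i" using Suc by simp
    \<comment> \<open>25 bad parts per partition suffice: 6.42 k < 26 (k/4 - 1).\<close>
    obtain b where b: "b \<in> Om" "real (card (St (insert b (Q (3 + i))))) \<le> real 25 ^ ((3 + i) * 25) + 2 powr (e i - 2 / 5 * real k)"
      using step[OF _ IH e, of 25] e[of i] kr by auto
    have "real 25 ^ ((3 + i) * 25) \<le> real 25 ^ 250" using Suc.prems by (intro power_increasing) auto
    also have "\<dots> \<le> 32 ^ 250" by (intro power_mono) auto
    also have "(32::real) ^ 250 = (2 ^ 5) ^ 250" by simp
    also have "\<dots> = 2 powr real (5 * 250)" by (subst powr_realpow) (auto simp: power_mult)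
    also have "\<dots> \<le> 2 powr (36 / 100 * real k)" using kr by (intro powr_mono) auto
    finally have 1: "real 25 ^ ((3 + i) * 25) \<le> 2 powr (36 / 100 * real k)" .
    define y where "y = max (36 / 100 * real k) (e i - 2 / 5 * real k)"
    have "2 powr (36 / 100 * real k) \<le> 2 powr y" "2 powr (e i - 2 / 5 * real k) \<le> 2 powr y"
      unfolding y_def by (intro powr_mono; simp)+
    then have "real (card (St (insert b (Q (3 + i))))) \<le> 2 * 2 powr y" using b(2) 1 by linarith
    also have "\<dots> = 2 powr (1 + y)" by (simp add: powr_add)
    finally have y1: "real (card (St (insert b (Q (3 + i))))) \<le> 2 powr (1 + y)" .
    have "log 2 (card (St (Q (Suc (3 + i))))) \<le> 1 + (1 + y)"
      by (rule log_St_step[OF _ b(1) y1]) (use length_ge Suc.prems in linarith)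
    also have "\<dots> \<le> e (Suc i)"
    proof -
      have "2 + 36 / 100 * real k \<le> 37 / 100 * real k" using kr by linarith
      moreover have "2 + (e i - 2 / 5 * real k) \<le> max (37 / 100 * real k) (321 / 100 * real k - 39 / 100 * real k * real (Suc i))"
      proof -
        have R: "321 / 100 * real k - 39 / 100 * real k * real (Suc i) = (321 / 100 * real k - 39 / 100 * real k * real i) - 39 / 100 * real k"
          by (simp add: field_simps)
        have "e i = 37 / 100 * real k \<or> e i = 321 / 100 * real k - 39 / 100 * real k * real i" by (simp add: e_def max_def)
        then show ?thesis unfolding R le_max_iff_disj using kr by linarith
      qed
      moreover have "37 / 100 * real k \<le> e (Suc i)" by (simp only: e_def max.cobounded1)
      moreover have "y = 36 / 100 * real k \<or> y = e i - 2 / 5 * real k" by (simp add: y_def max_def)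
      ultimately show ?thesis unfolding e_def[of "Suc i"] by linarith
    qed
    finally show ?case by simp
  qed
  from this[of 8] have 11: "log 2 (card (St (Q 11))) \<le> 37 / 100 * real k" by (simp add: e_def)
  \<comment> \<open>Now 0.74 k < 3 (k/4 - 1), so each partition has at most 2 bad parts.\<close>
  obtain b where b: "b \<in> Om" "real (card (St (insert b (Q 11)))) \<le> real 2 ^ (11 * 2) + 2 powr (37 / 100 * real k - 2 / 5 * real k)"
    using step[OF _ 11, of 2] kr by auto
  have "2 powr (37 / 100 * real k - 2 / 5 * real k) \<le> 2 powr 0" using kr by (intro powr_mono) auto
  then have "real (card (St (insert b (Q 11)))) \<le> 2 ^ 23" using b(2) by simp
  also have "(2::real) ^ 23 = 2 powr 23" using powr_realpow[of 2 23] by simp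
  finally have b23: "real (card (St (insert b (Q 11)))) \<le> 2 powr 23" .
  have "log 2 (card (St (Q (Suc 11)))) \<le> 1 + 23" by (rule log_St_step[OF _ b(1) b23]) (use length_ge in linarith)
  then have 12: "log 2 (card (St (Q 12))) \<le> 24" by simp
  \<comment> \<open>48 < k/4 - 1, so no bad part is left.\<close>
  obtain b' where b': "b' \<in> Om" "real (card (St (insert b' (Q 12)))) \<le> real 0 ^ (12 * 0) + 2 powr (24 - 2 / 5 * real k)"
    using step[OF _ 12, of 0] kr by auto
  have "2 powr (24 - 2 / 5 * real k) < 2 powr 0" using kr by (intro powr_less_mono) auto
  then have "card (St (insert b' (Q 12))) < 2" using b'(2) by simp
  moreover have "card (H (Suc 12)) \<le> card (pstab G part_act (insert b' (Q 12)))" by (rule H_step[OF _ b'(1)]) (use length_ge in linarith)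
  moreover have "card (pstab G part_act (insert b' (Q 12))) \<le> card (St (insert b' (Q 12)))" by (rule card_pstab_le)
  ultimately show False using H_nontrivial[of "Suc 12"] length_ge by linarith
qed

text \<open>For k < 3900 the explicit bound is below 12900; for larger k the logarithm is about k,
  well under the entry bound of \<open>medium_absurd\<close>.\<close>

lemma critical_absurd: assumes lk: "l + 1 = k" shows False
proof -
  have Q1: "Q 1 = {bs ! 0}" by (rule Q_1) (use length_ge in linarith)
  have P: "bs ! 0 \<in> Om" by (rule bs_in) (use length_ge in linarith)
  obtain b where b: "b \<in> Om" "card (St {bs ! 0, b}) \<le> k\<^sup>2 * 2 ^ k" using critical_candidate[OF P lk] by blast
  have "real (card (St (insert b (Q 1)))) \<le> real (k\<^sup>2 * 2 ^ k)" using b(2) Q1 by (simp only: of_nat_le_iff insert_commute)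
  also have "\<dots> = 2 powr (2 * log 2 k + real k)"
  proof -
    have "2 powr (2 * log 2 k) = (2 powr log 2 k) powr 2" by (simp add: powr_powr mult.commute)
    also have "\<dots> = real k ^ 2" using k2 by simp
    finally show ?thesis by (simp add: powr_add powr_realpow)
  qed
  finally have St1: "real (card (St (insert b (Q 1)))) \<le> 2 powr (2 * log 2 k + real k)" .
  have "log 2 (card (St (Q (Suc 1)))) \<le> 1 + (2 * log 2 k + real k)" by (rule log_St_step[OF _ b(1) St1]) (use length_ge in linarith)
  moreover have "log 2 (card (St (Q (Suc 2)))) \<le> log 2 (card (St (Q 2)))" by (rule St_antimono) (use length_ge in linarith)
  ultimately have 3: "log 2 (card (St (Q 3))) \<le> 1 + (2 * log 2 k + real k)" by (simp add: numeral_3_eq_3 numeral_2_eq_2)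
  show False
  proof (cases "k < 3900")
    case True
    then have "log 2 (real k) \<le> 12" using log2_le_of_le_power[of k 12] k2 by simp
    then have "log 2 (card (St (Q 3))) \<le> 12900" using 3 True by linarith
    then show False by (rule small_absurd[rotated]) (use base_bound(2) in simp)
  next
    case False
    then have kr: "3900 \<le> real k" by simp
    show False
    proof (rule medium_absurd)
      show "3900 \<le> k" "k \<le> l + 1" using False lk by auto
      show "card C \<le> k" if "C \<in> cells (Q 3)" for C
        using card_cell_le[OF first_in_Q[of 3] Q_sub that] length_ge lk by force
      show "log 2 (card (St (Q 3))) \<le> 321 / 100 * real k" using 3 log2_le_850[of "real k"] kr by linarith
    qed
  qed
qed

text \<open>A cell with more than \<open>k\<close> points would by itself produce a deficit above
  the bound on \<open>\<delta> 1\<close>, because the even size l div k \<le> 90 is far below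
  k.\<close>

lemma cells_le_k:
  assumes k: "850 \<le> k" "k \<le> l" "l \<le> 90 * k" and C: "C0 \<in> cells (Q 2)"
  shows "card C0 \<le> k"
proof (rule ccontr)
  assume big: "\<not> card C0 \<le> k"
  define q where "q = l div k"
  have k0: "0 < k" using k by simp
  have "l < k * 91" using k by linarith
  then have q: "q \<le> 90" unfolding q_def using k0 by (simp add: less_mult_imp_div_less mult.commute less_Suc_eq_le[symmetric])
  \<comment> \<open>The height of the convex function \<open>lf\<close> over its tangent at
    \<open>q\<close>. Summed over a splitting it is the deficit against \<open>wbal\<close>.\<close>
  define e where "e a = lf a - lf q - (real a - real q) * log 2 (1 + real q)" for a
  have e_pos: "0 \<le> e a" for a
    using concave_tangent[of "\<lambda>y. - log 2 (1 + real y)" a q] by (simp add: e_def lf_def sum_negf)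
  have l1: "1 < length bs" "0 < length bs" using length_ge by linarith+
  let ?P = "bs ! 1"
  have P: "?P \<in> Om" by (rule bs_in[OF l1(1)])
  have Q2: "Q 2 = insert ?P (Q 1)" using Q_Suc[OF l1(1)] by (simp add: numeral_2_eq_2)
  have cl: "card C = l" if C1: "C \<in> cells (Q 1)" for C
  proof -
    obtain x where x: "x \<in> X" "C = cell (Q 1) x" using C1 unfolding cells_def by blast
    have b0: "bs ! 0 \<in> Om" by (rule bs_in[OF l1(2)])
    have "C = same_part (bs ! 0) x" using x Q_1[OF l1(2)] OmD(6)[OF b0] same_part_in[OF b0 x(1)] by (auto simp: cell_def)
    then show ?thesis using OmD(3)[OF b0] same_part_in[OF b0 x(1)] by simp
  qed
  have sum_e: "(\<Sum>A\<in>?P. e (card (C \<inter> A))) = (\<Sum>A\<in>?P. lf (card (C \<inter> A))) - wbal l" if C: "C \<in> cells (Q 1)" for C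
  proof -
    have "(\<Sum>A\<in>?P. e (card (C \<inter> A))) = (\<Sum>A\<in>?P. lf (card (C \<inter> A))) - real k * lf q - (real (\<Sum>A\<in>?P. card (C \<inter> A)) - real k * real q) * log 2 (1 + real q)"
      unfolding e_def using OmD(2)[OF P] by (simp add: sum_subtractf sum_distrib_right[symmetric])
    also have "(\<Sum>A\<in>?P. card (C \<inter> A)) = l" using sum_card_Int_parts[OF P in_cells_subset[OF C]] cl[OF C] by simp
    also have "real l - real k * real q = real (l mod k)"
    proof -
      have "real l = real (k * q + l mod k)" unfolding q_def by simp
      then show ?thesis by simp
    qed
    also have "(\<Sum>A\<in>?P. lf (card (C \<inter> A))) - real k * lf q - real (l mod k) * log 2 (1 + real q) = (\<Sum>A\<in>?P. lf (card (C \<inter> A))) - wbal l"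
      using sum_div_blocks[of k "l mod k" "\<lambda>y. log 2 (1 + real y)" q] k0
      by (simp add: wbal_def lf_def q_def less_imp_le)
    finally show ?thesis .
  qed
  have total: "V lf (Q 2) - V wbal (Q 1) = (\<Sum>C\<in>cells (Q 1). \<Sum>A\<in>?P. e (card (C \<inter> A)))"
  proof -
    have "V lf (Q 2) = (\<Sum>C\<in>cells (Q 1). \<Sum>A\<in>?P. lf (card (C \<inter> A)))"
      unfolding Q2 by (rule V_insert[OF Q_sub P]) (simp add: lf_small)
    moreover have "V wbal (Q 1) = (\<Sum>C\<in>cells (Q 1). wbal l)" unfolding V_def by (intro sum.cong) (simp_all add: cl)
    moreover have "(\<Sum>C\<in>cells (Q 1). \<Sum>A\<in>?P. e (card (C \<inter> A))) = (\<Sum>C\<in>cells (Q 1). (\<Sum>A\<in>?P. lf (card (C \<inter> A))) - wbal l)"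
      by (rule sum.cong[OF refl sum_e])
    ultimately show ?thesis by (simp only: sum_subtractf)
  qed
  obtain x where x: "x \<in> X" "C0 = cell (Q 1) x \<inter> same_part ?P x" using C unfolding Q2 by (auto simp: cells_def cell_insert)
  have "e (card C0) \<le> (\<Sum>A\<in>?P. e (card (cell (Q 1) x \<inter> A)))"
    unfolding x(2) using OmD(4)[OF P] same_part_in[OF P x(1)] e_pos by (intro member_le_sum) auto
  also have "\<dots> \<le> (\<Sum>C\<in>cells (Q 1). \<Sum>A\<in>?P. e (card (C \<inter> A)))"
    by (rule member_le_sum[of _ _ "\<lambda>C. \<Sum>A\<in>?P. e (card (C \<inter> A))"]) (use cell_in_cells[OF x(1)] finite_cells e_pos in \<open>auto intro: sum_nonneg\<close>)
  also have "\<dots> \<le> \<delta> 1" using total log_card_St_ge[OF Q_sub, of "Suc 1"] by (simp add: \<delta>_def numeral_2_eq_2)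
  also have "\<dots> \<le> 2 * log 2 k + (1 + 8 / 5 * real k)" by (rule \<delta>_1_le[OF k(2) l1(1)])
  finally have up: "e (card C0) \<le> 2 * log 2 k + (1 + 8 / 5 * real k)" .
  have qk: "q \<le> k" using q k by simp
  \<comment> \<open>e (card C0) \<ge> e k \<ge> log2 k! - k log2 (1 + q). With k! \<ge> (k/3)^k and
    1 + q \<le> 91 this is at least k log2 (k / 273).\<close>
  have "real k * log 2 (real k / 273) \<le> e (card C0)"
  proof -
    have split: "(\<Sum>y<a. \<gamma> y) = (\<Sum>y<d. \<gamma> y) + (\<Sum>y=d..<a. \<gamma> y)" if "d \<le> a" for a d and \<gamma> :: "nat \<Rightarrow> real"
      using sum.atLeastLessThan_concat[of 0 d a \<gamma>] that by (simp add: lessThan_atLeast0)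
    let ?g = "\<lambda>y. log 2 (1 + real y) - log 2 (1 + real q)"
    have "lf q \<le> real q * log 2 (1 + real q)"
    proof -
      have "lf q \<le> (\<Sum>y<q. log 2 (1 + real q))" unfolding lf_def by (intro sum_mono log2_mono) auto
      then show ?thesis by simp
    qed
    then have a: "lf k - real k * log 2 (1 + real q) \<le> e k" by (simp add: e_def algebra_simps)
    have "lf (card C0) = lf k + (\<Sum>y=k..<card C0. log 2 (1 + real y))" unfolding lf_def using big by (intro split) simp
    moreover have "(\<Sum>y=k..<card C0. log 2 (1 + real q)) \<le> (\<Sum>y=k..<card C0. log 2 (1 + real y))" using qk by (intro sum_mono log2_mono) auto
    ultimately have b: "e k \<le> e (card C0)" using big by (simp add: e_def of_nat_diff algebra_simps)
    have "real k ^ k / fact k \<le> exp (real k)"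
    proof -
      have "(\<Sum>n\<in>{k}. real k ^ n /\<^sub>R fact n) \<le> exp (real k)"
        unfolding exp_def by (rule sum_le_suminf[OF summable_exp_generic]) auto
      then show ?thesis by (simp add: divide_inverse mult.commute)
    qed
    also have "exp (real k) = exp 1 ^ k" by (simp add: exp_of_nat_mult[symmetric])
    also have "\<dots> \<le> 3 ^ k" using exp_le by (intro power_mono) auto
    finally have "real k ^ k \<le> 3 ^ k * fact k" by (simp add: pos_divide_le_eq)
    then have "log 2 (real k ^ k) \<le> log 2 (3 ^ k * fact k)" using k0 by (intro log2_mono) auto
    then have c: "real k * log 2 k \<le> real k * log 2 3 + lf k" using k0 by (simp add: log_mult_pos log_nat_power lf_eq)
    have "real k * log 2 (1 + real q) \<le> real k * log 2 91" using q by (intro mult_left_mono log2_mono) auto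
    moreover have "log 2 (real k / 273) = log 2 k - (log 2 3 + log 2 91)"
      using k0 log_mult_pos[of 3 91 2] by (simp add: log_divide_pos)
    then have "real k * log 2 (real k / 273) = real k * log 2 k - real k * log 2 3 - real k * log 2 91"
      by (simp only: right_diff_distrib distrib_left diff_diff_eq)
    ultimately show ?thesis using a b c by linarith
  qed
  \<comment> \<open>850 / 273 > 3.11 and 3.11^100 > 2^163. The value 1.63 exceeds 8/5 + 2/85 +
    1/850, which bounds \<open>\<delta> 1\<close> divided by k.\<close>
  moreover have "163 / 100 \<le> log 2 (real k / 273)"
  proof -
    have "163 = log 2 ((2::real) ^ 163)" by (subst log_nat_power) simp_all
    also have "\<dots> \<le> log 2 ((311 / 100) ^ 100)" by (intro log2_mono) (simp_all add: power_divide)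
    also have "\<dots> = 100 * log 2 (311 / 100 :: real)" by (subst log_nat_power) simp_all
    also have "\<dots> \<le> 100 * log 2 (real k / 273)" using k(1) by (intro mult_left_mono log2_mono) auto
    finally show ?thesis by simp
  qed
  then have "real k * (163 / 100) \<le> real k * log 2 (real k / 273)" by (intro mult_left_mono) auto
  moreover have "log 2 k \<le> real k / 85" using log2_le_850[of "real k"] k(1) by simp
  ultimately show False using up k(1) by simp
qed

text \<open>An even refinement of the cells of \<open>Q 2\<close> is trivial, so the deficit of the
  next step is the whole logarithm, about 3.2 k.\<close>

lemma dense_medium_absurd: assumes k: "850 \<le> k" "k \<le> l" "l \<le> 90 * k" shows False
proof -
  have kr: "850 \<le> real k" using k by simp
  have l2': "Suc 1 < length bs" "2 < length bs" using length_ge by linarith+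
  have V0: "V wbal (Q 2) = 0" unfolding V_def by (intro sum.neutral ballI wbal_eq_0 cells_le_k[OF k])
  have "log 2 (card (St (Q 3))) = \<delta> 2" using V0 by (simp add: \<delta>_def numeral_3_eq_3)
  also have "\<dots> \<le> 2 * log 2 k + real 2 * (1 + 8 / 5 * real k)" by (rule \<delta>_le[OF k(2) _ l2'(2)]) simp
  finally have 3: "log 2 (card (St (Q 3))) \<le> 2 * log 2 k + (2 + 16 / 5 * real k)" by simp
  show False
  proof (cases "k < 3900")
    case True
    then have "log 2 (real k) \<le> 12" using log2_le_of_le_power[of k 12] k by simp
    then have "log 2 (card (St (Q 3))) \<le> 12900" using 3 True by linarith
    then show False by (rule small_absurd[rotated]) (use base_bound(2) in simp)
  next
    case False
    then have kr': "3900 \<le> real k" by simp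
    show False
    proof (rule medium_absurd)
      show "3900 \<le> k" "k \<le> l + 1" using False k by auto
      show "card C \<le> k" if C: "C \<in> cells (Q 3)" for C
      proof -
        have "Q 2 \<subseteq> Q 3" unfolding Q_def by (rule set_take_subset_set_take) simp
        then obtain D where D: "D \<in> cells (Q 2)" "C \<subseteq> D" using cells_mono_subset[OF _ Q_sub C] by blast
        then show ?thesis using cells_le_k[OF k D(1)] card_mono[OF finite_in_cells[OF D(1)] D(2)] by linarith
      qed
      \<comment> \<open>\<open>log2_le_850\<close> is too weak here: 2k / 85 exceeds k / 100, the
        room between 16/5 and 321/100.\<close>
      have "log 2 (real k) \<le> 12 + 2 * (real k / 4096 - 1) \<or> real k \<le> 4096"
      proof (cases "real k \<le> 4096")
        case False
        then have "log 2 (real k) \<le> log 2 4096 + 2 * (real k / 4096 - 1)" by (intro log2_le_linear) auto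
        moreover have "log 2 (4096::real) = 12"
        proof -
          have "(4096::real) = 2 ^ 12" by simp
          then show ?thesis by (simp only: log_nat_power[of 2 2 12]) simp
        qed
        ultimately show ?thesis by simp
      qed simp
      then have "2 * log 2 (real k) + 2 \<le> real k / 100"
      proof
        assume "log 2 (real k) \<le> 12 + 2 * (real k / 4096 - 1)"
        then show ?thesis using kr' by (simp add: field_simps)
      next
        assume "real k \<le> 4096"
        then have "k \<le> 2 ^ 12" by simp
        then have "log 2 (real k) \<le> 12" using log2_le_of_le_power[of k 12] k by simp
        then show ?thesis using kr' by simp
      qed
      then show "log 2 (card (St (Q 3))) \<le> 321 / 100 * real k" using 3 by linarith
    qed
  qed
qed

text \<open>Random candidates bound every deficit from step S + 2 on by 2, so a second window of
  length S leaves at most 2^(4S+2) elements after 2S + 3 steps. Halving ends the run after 6S + 5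
  steps, fewer than 11 (S + 1).\<close>

lemma large_absurd:
  assumes S: "l \<le> k ^ S" "S + 1 \<le> card B" "1 \<le> S" and E: "log 2 (card (St (Q (S + 2)))) \<le> E" and lE: "4 * E \<le> real l"
    and N2: "E + log 2 k * real k < log 2 k * (real l / 32 - 1 / 4)"
  shows False
proof -
  have len': "11 * S + 11 < length bs" using len S(2) by linarith
  have mono: "log 2 (card (St (Q j))) \<le> E" if "S + 2 \<le> j" "j \<le> length bs" for j
    using that
  proof (induction j rule: dec_induct)
    case base show ?case by (rule E)
  next
    case (step n)
    then show ?case using St_antimono[of n] by simp
  qed
  have d: "\<delta> j \<le> 2" if j: "S + 2 \<le> j" "j < length bs" for j
  proof -
    obtain b where b: "b \<in> Om" "real (card (St (insert b (Q j)))) < 2 powr V wbal (Q j) + 1"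
      using large_l_refinement[OF Q_sub finite_Q mono[OF j(1) less_imp_le[OF j(2)]] lE N2] by blast
    have "1 \<le> 2 powr V wbal (Q j)" unfolding V_def by (intro ge_one_powr_ge_zero sum_nonneg wbal_nonneg) auto
    then have "real (card (St (insert b (Q j)))) \<le> 2 * 2 powr V wbal (Q j)" using b(2) by linarith
    also have "\<dots> = 2 powr (1 + V wbal (Q j))" by (simp add: powr_add)
    finally have "log 2 (card (St (Q (Suc j)))) \<le> 1 + (1 + V wbal (Q j))" by (rule log_St_step[OF j(2) b(1)])
    then show ?thesis by (simp add: \<delta>_def)
  qed
  define t where "t = 2 * S + 3"
  have t: "S + 2 + S < length bs" "Suc (S + 2 + S) = t" using len' by (auto simp: t_def)
  have "log 2 (card (St (Q t))) \<le> \<delta> (S + 2 + S) + 2 * (\<Sum>j=S + 2..<S + 2 + S. \<delta> j)"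
    using window[OF S(1) _ t(1)] t(2) by simp
  moreover have "\<delta> (S + 2 + S) \<le> 2" by (rule d) (use t(1) in auto)
  moreover have "(\<Sum>j=S + 2..<S + 2 + S. \<delta> j) \<le> (\<Sum>j=S + 2..<S + 2 + S. 2)"
    by (intro sum_mono d) (use t(1) in auto)
  ultimately have "log 2 (card (St (Q t))) \<le> real (4 * S + 2)" by simp
  moreover have "log 2 (card (H t)) \<le> log 2 (card (St (Q t)))" using card_H_le[of t] card_H_pos[of t] by (intro log2_mono) auto
  ultimately have "log 2 (card (H t)) \<le> real (4 * S + 2)" by linarith
  then have "real (card (H t)) \<le> 2 powr real (4 * S + 2)" using card_H_pos[of t] by (simp add: log_le_iff)
  moreover have "2 powr real (4 * S + 2) = real (2 ^ (4 * S + 2))" by (subst powr_realpow) simp_all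
  ultimately have "real (card (H t)) \<le> real (2 ^ (4 * S + 2))" by (simp only:)
  then have Ht: "card (H t) \<le> 2 ^ (4 * S + 2)" by (simp only: of_nat_le_iff)
  have halve: "card (H (t + i)) * 2 ^ i \<le> card (H t)" if "t + i \<le> length bs" for i
    using that
  proof (induction i)
    case (Suc i)
    have "card (H (t + Suc i)) * 2 ^ Suc i = (2 * card (H (Suc (t + i)))) * 2 ^ i" by simp
    also have "\<dots> \<le> card (H (t + i)) * 2 ^ i" using H_half[of "t + i"] Suc.prems by (intro mult_le_mono1) simp
    also have "\<dots> \<le> card (H t)" using Suc by simp
    finally show ?case .
  qed simp
  have "t + (4 * S + 2) \<le> length bs" using len' by (simp add: t_def)
  then have "card (H (t + (4 * S + 2))) * 2 ^ (4 * S + 2) \<le> 1 * 2 ^ (4 * S + 2)"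
    using order_trans[OF halve Ht] by (simp only: mult_1)
  then have "card (H (t + (4 * S + 2))) \<le> 1" by (rule mult_right_le_imp_le) simp
  then show False using H_nontrivial[of "t + (4 * S + 2)"] len' by (simp add: t_def)
qed

text \<open>\<open>S\<close> is least with l \<le> k^S, so S \<le> b - 1 for b =
  \<open>card B\<close>, and k^(S-1) < l. \<open>trick\<close> settles small \<open>E\<close>, and
  \<open>easy\<close> the case where l dominates E. For S = 1, and for S = 2 with l \<le> 90 k,
  neither need apply; \<open>dense_medium_absurd\<close> fills this gap.\<close>

lemma dense_absurd: assumes lk: "k \<le> l" shows False
proof -
  define S where "S = (LEAST s. l \<le> k ^ s)"
  have S1: "l \<le> k ^ S" unfolding S_def by (rule LeastI[of _ "card B - 1"]) (rule base_bound(1))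
  have Sb: "S + 1 \<le> card B"
  proof -
    have "S \<le> card B - 1" unfolding S_def by (rule Least_le) (rule base_bound(1))
    then show ?thesis using base_bound(2) by simp
  qed
  have Spos: "1 \<le> S"
  proof (rule ccontr)
    assume "\<not> 1 \<le> S"
    then have "S = 0" by simp
    then have "l \<le> 1" using S1 by simp
    then show False using l2 by simp
  qed
  have lS: "k ^ (S - 1) < l"
  proof (rule ccontr)
    assume "\<not> k ^ (S - 1) < l"
    then have "S \<le> S - 1" unfolding S_def[of ] by (intro Least_le) (simp add: S_def)
    then show False using Spos by simp
  qed
  define r where "r = log 2 (real k)"
  have r1: "1 \<le> r" unfolding r_def using le_log2_of_power_le[of 1 k] k2 by simp
  have rk: "r \<le> real k" unfolding r_def using log2_nat_le[of k] k2 by simp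
  have k2': "2 \<le> real k" using k2 by simp
  define E where "E = real (4 * S + 2) * r + (real S + 1)\<^sup>2 * (1 + 8 / 5 * real k)"
  have Elog: "log 2 (card (St (Q (S + 2)))) \<le> E"
    unfolding E_def r_def by (rule log_St_window[OF lk S1]) (use Sb len in linarith)
  have trick: False if "E \<le> 12900"
  proof (rule small_absurd)
    \<comment> \<open>From 1 \<le> S \<le> b - 1, with b = \<open>card B\<close>: S + 2 \<le> 3b /
      2, the number of preliminary steps allowed in \<open>not_small\<close>.\<close>
    have "3 * (S + 1) \<le> 3 * card B" using Sb by (rule mult_le_mono2)
    then show "2 * (S + 2) \<le> 3 * card B" using Spos by simp
    show "log 2 (card (St (Q (S + 2)))) \<le> 12900" using Elog that by linarith
  qed
  have easy: False if "4 * E \<le> real l" "E + r * real k < r * (real l / 32 - 1 / 4)"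
    using large_absurd[OF S1 Sb Spos Elog that(1)] that(2) unfolding r_def by blast
  consider "S = 1" | "S = 2" | "3 \<le> S" using Spos by linarith
  then show False
  proof cases
    case 1
    then have l: "l = k" using S1 lk by simp
    show False
    proof (cases "850 \<le> k")
      case True then show False using dense_medium_absurd[OF True lk] l by simp
    next
      case False
      then have "r \<le> 10" unfolding r_def using log2_le_of_le_power[of k 10] k2 by simp
      then have "E \<le> 12900" unfolding E_def using 1 False by (simp add: power2_eq_square)
      then show False by (rule trick)
    qed
  next
    case 2
    show False
    proof (cases "850 \<le> k")
      case True
      show False
      proof (cases "l \<le> 90 * k")
        case True' : True then show False using dense_medium_absurd[OF True lk] by simp
      next
        case False
        then have l: "90 * real k < real l" by linarith
        have r9: "9 \<le> r" unfolding r_def using le_log2_of_power_le[of 9 k] True by simp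
        have rs: "r \<le> real k / 85" unfolding r_def using log2_le_850[of "real k"] True by simp
        have E: "E = 10 * r + 9 * (1 + 8 / 5 * real k)" unfolding E_def using 2 by (simp add: power2_eq_square)
        have kr: "850 \<le> real k" using True by simp
        show False
        proof (rule easy)
          show "4 * E \<le> real l" unfolding E using l rs kr by simp
          \<comment> \<open>Trading the terms without \<open>r\<close> for multiples of
            \<open>r\<close>, by r \<ge> 9, lets the target inequality be divided by
            \<open>r\<close>.\<close>
          have "9 + 72 / 5 * real k \<le> r * (1 + 8 / 5 * real k)"
            using mult_right_mono[OF r9, of "1 + 8 / 5 * real k"] by simp
          moreover have "r * (10 + (1 + 8 / 5 * real k) + real k) < r * (real l / 32 - 1 / 4)"
            using r1 l kr by (intro mult_strict_left_mono) auto
          ultimately show "E + r * real k < r * (real l / 32 - 1 / 4)" unfolding E by (simp add: algebra_simps)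
        qed
      qed
    next
      case False
      then have "r \<le> 10" unfolding r_def using log2_le_of_le_power[of k 10] k2 by simp
      then have "E \<le> 12900" unfolding E_def using 2 False by (simp add: power2_eq_square)
      then show False by (rule trick)
    qed
  next
    case 3
    define T where "T = (real S + 1)\<^sup>2"
    have T16: "16 \<le> T"
    proof -
      have "(4::real)\<^sup>2 \<le> (real S + 1)\<^sup>2" using 3 by (intro power_mono) auto
      then show ?thesis by (simp add: T_def)
    qed
    have ST: "real (4 * S + 2) \<le> T"
    proof -
      have "3 * real S \<le> real S * real S" using 3 by (intro mult_right_mono) auto
      moreover have "T = real S * real S + 2 * real S + 1" by (simp add: T_def power2_eq_square algebra_simps)
      moreover have "real (4 * S + 2) = 4 * real S + 2" "3 \<le> real S" using 3 by simp_all
      ultimately show ?thesis by linarith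
    qed
    have E1: "E \<le> T * r + T * (1 + 8 / 5 * real k)"
      unfolding E_def T_def[symmetric] using ST r1 by (intro add_right_mono mult_right_mono) auto
    show False
    proof (cases "k * (S + 1)\<^sup>2 \<le> 4000")
      case True
      then have "real (k * (S + 1)\<^sup>2) \<le> real 4000" by (simp only: of_nat_le_iff)
      then have kT: "real k * T \<le> 4000" by (simp add: T_def add.commute)
      have "T * r \<le> T * real k" using rk T16 by (intro mult_left_mono) auto
      moreover have "2 * T \<le> real k * T" using k2' T16 by (intro mult_right_mono) auto
      moreover have "T * (1 + 8 / 5 * real k) = T + 8 / 5 * (real k * T)" by (simp add: algebra_simps)
      \<comment> \<open>The three contributions are at most kT, kT / 2 and 8/5 kT: together 3.1 kT,
        at most 12400.\<close>
      ultimately have "E \<le> 12900" using E1 kT by (simp add: mult.commute)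
      then show False by (rule trick)
    next
      case False
      then have kT: "4000 < k * (S + 1)\<^sup>2" by simp
      show False
      proof (cases "S = 3")
        case True
        then have k250: "250 < k" using kT by simp
        then have kr: "250 < real k" by simp
        have l: "real k * real k < real l"
        proof -
          have "k * k < l" using lS True by (simp add: power2_eq_square)
          then show ?thesis by (metis of_nat_less_iff of_nat_mult)
        qed
        have kk: "250 * real k \<le> real k * real k" using kr by (intro mult_right_mono) auto
        have r7: "7 \<le> r" unfolding r_def using le_log2_of_power_le[of 7 k] k250 by simp
        have E: "E = 14 * r + 16 * (1 + 8 / 5 * real k)" unfolding E_def using True by (simp add: power2_eq_square)
        show False
        proof (rule easy)
          have "4 * E = 56 * r + 64 + 512 / 5 * real k" unfolding E by simp
          then show "4 * E \<le> real l" using l kk rk kr by linarith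
          have "7 * (16 / 7 + 128 / 35 * real k) \<le> r * (16 / 7 + 128 / 35 * real k)"
            using r7 by (intro mult_right_mono) auto
          moreover have "r * (14 + (16 / 7 + 128 / 35 * real k) + real k) < r * (real l / 32 - 1 / 4)"
            using r1 l kk kr by (intro mult_strict_left_mono; linarith)
          ultimately show "E + r * real k < r * (real l / 32 - 1 / 4)" unfolding E by (simp add: algebra_simps)
        qed
      next
        case False
        then have S4: "4 \<le> S" using 3 by simp
        have T25: "25 \<le> T"
        proof -
          have "(5::real)\<^sup>2 \<le> (real S + 1)\<^sup>2" using S4 by (intro power_mono) auto
          then show ?thesis by (simp add: T_def)
        qed
        have "k * (103 * (S + 1)\<^sup>2) \<le> k * k ^ (S - 2)" using tower_ge[OF S4 k2 kT] by simp
        also have "k * k ^ (S - 2) = k ^ (S - 1)"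
        proof -
          have "S - 1 = Suc (S - 2)" using S4 by simp
          then show ?thesis by (simp only: power_Suc)
        qed
        also have "\<dots> < l" by (rule lS)
        finally have "real (k * (103 * (S + 1)\<^sup>2)) < real l" by (simp only: of_nat_less_iff)
        then have l: "103 * (real k * T) < real l" by (simp add: T_def algebra_simps)
        have kT25: "25 * real k \<le> real k * T" using T25 by (simp add: mult.commute[of "real k"] mult_right_mono)
        have "T * r \<le> real k * T" using rk T25 by (simp add: mult.commute[of _ T] mult_left_mono)
        moreover have "2 * T \<le> real k * T" using k2' T25 by (intro mult_right_mono) auto
        moreover have "T * (1 + 8 / 5 * real k) = T + 8 / 5 * (real k * T)" by (simp add: algebra_simps)
        ultimately have E3: "E \<le> 31 / 10 * (real k * T)" using E1 by simp
        show False
        proof (rule easy)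
          show "4 * E \<le> real l" using E3 l kT25 k2' by linarith
          have E0: "0 \<le> E" unfolding E_def using r1 by (intro add_nonneg_nonneg mult_nonneg_nonneg) auto
          have "E \<le> r * E" using mult_right_mono[OF r1 E0] by simp
          moreover have "r * (E + real k) < r * (real l / 32 - 1 / 4)"
            using r1 E3 l kT25 k2' by (intro mult_strict_left_mono; linarith)
          ultimately show "E + r * real k < r * (real l / 32 - 1 / 4)" by (simp add: algebra_simps)
        qed
      qed
    qed
  qed
qed

lemma long_run_absurd: False
  using sparse_absurd critical_absurd dense_absurd by linarith

end

section \<open>Existence of complete greedy runs and conclusion\<close>

context kl_parts
begin

lemma greedy_prefix_length:
  assumes "greedy_run k l G bs" shows "length bs < card G"
proof -
  interpret greedy_run k l G bs by (rule assms)
  have "card (H i) + i \<le> card (H 0)" if "i \<le> length bs" for i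
    using that
  proof (induction i)
    case (Suc i)
    then show ?case using H_half[of i] card_H_pos[of "Suc i"] by simp
  qed simp
  from this[of "length bs"] have "card (H (length bs)) + length bs \<le> card (H 0)" by simp
  moreover have "H 0 = G" by (auto simp: H_def Q_def pstab_def)
  ultimately show ?thesis using card_H_pos[of "length bs"] by simp
qed

lemma greedy_run_iff:
  assumes "4 < k * l" "G = Alt (k * l) \<or> G = Sym (k * l)"
  shows "greedy_base G part_act Om bs \<longleftrightarrow> greedy_run k l G bs \<and> pstab G part_act (set bs) = {id}"
  using assms kl_parts_axioms unfolding greedy_base_def greedy_run_def greedy_run_axioms_def by auto

text \<open>A run of greatest length exists by \<open>greedy_prefix_length\<close>. Were its
  stabilizer nontrivial, a point in a largest orbit would extend it.\<close>

lemma greedy_base_exists: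
  assumes n4: "4 < k * l" and G: "G = Alt (k * l) \<or> G = Sym (k * l)"
  shows "\<exists>bs. greedy_base G part_act Om bs"
proof -
  let ?P = "\<lambda>bs. greedy_run k l G bs"
  have nil: "?P []" using n4 G kl_parts_axioms by (simp add: greedy_run_def greedy_run_axioms_def)
  have "\<forall>cs. ?P cs \<longrightarrow> length cs < card G" by (intro allI impI) (rule greedy_prefix_length)
  from ex_has_greatest_nat[of ?P, OF nil this] obtain bs
    where bs: "?P bs" and max: "\<And>cs. ?P cs \<Longrightarrow> length cs \<le> length bs" by blast
  interpret greedy_run k l G bs by (rule bs)
  have "pstab G part_act (set bs) = {id}"
  proof (rule ccontr)
    assume nt: "pstab G part_act (set bs) \<noteq> {id}"
    let ?S = "(\<lambda>y. card (orbit_of (pstab G part_act (set bs)) part_act y)) ` Om"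
    have "Max ?S \<in> ?S" using finite_Om Om_nonempty by (intro Max_in) auto
    then obtain y where y: "y \<in> Om" "Max ?S = card (orbit_of (pstab G part_act (set bs)) part_act y)" by auto
    have ymax: "card (orbit_of (pstab G part_act (set bs)) part_act z) \<le> card (orbit_of (pstab G part_act (set bs)) part_act y)"
      if "z \<in> Om" for z unfolding y(2)[symmetric] using finite_Om that by (intro Max_ge) auto
    have "?P (bs @ [y])"
      unfolding greedy_run_def greedy_run_axioms_def
    proof (intro conjI allI impI)
      show "kl_parts k l" by (rule kl_parts_axioms)
      show "4 < k * l" "G = Alt (k * l) \<or> G = Sym (k * l)" by (rule n4, rule G)
      fix i assume i: "i < length (bs @ [y])"
      show "pstab G part_act (set (take i (bs @ [y]))) \<noteq> {id}"
        using i greedy[of i] nt by (cases "i < length bs") (auto simp: less_Suc_eq)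
      show "(bs @ [y]) ! i \<in> Om"
        using i greedy[of i] y(1) by (cases "i < length bs") (auto simp: less_Suc_eq nth_append)
      show "\<forall>z\<in>Om. card (orbit_of (pstab G part_act (set (take i (bs @ [y])))) part_act z)
          \<le> card (orbit_of (pstab G part_act (set (take i (bs @ [y])))) part_act ((bs @ [y]) ! i))"
        using i greedy[of i] ymax by (cases "i < length bs") (auto simp: less_Suc_eq nth_append)
    qed
    then show False using max[of "bs @ [y]"] by simp
  qed
  then show ?thesis using bs greedy_run_iff[OF n4 G] by blast
qed

lemma greedy_base_length:
  assumes n4: "4 < k * l" and G: "G = Alt (k * l) \<or> G = Sym (k * l)" and bs: "greedy_base G part_act Om bs"
    and B: "finite B" "is_base G part_act Om B"
  shows "length bs \<le> 11 * card B"
proof (rule ccontr)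
  assume "\<not> ?thesis"
  then have "long_run k l G bs B"
    using bs B greedy_run_iff[OF n4 G] by (simp add: long_run_def long_run_axioms_def is_base_def)
  then show False by (rule long_run.long_run_absurd)
qed

end

theorem theorem3p18:
  fixes k l :: nat and G :: "(nat \<Rightarrow> nat) set"
  assumes "k \<ge> 2" and "l \<ge> 2" and "k * l > 4"
    and "G = Alt (k * l) \<or> G = Sym (k * l)"
  shows "greedy_num G part_act (Pi_kl k l) \<le> 11 * base_size G part_act (Pi_kl k l)"
proof -
  interpret kl_parts k l by unfold_locales (use assms in auto)
  note n4 = assms(3) and G = assms(4)
  \<comment> \<open>One complete run shows that a base exists, so that \<open>LEAST\<close> in
    \<open>base_size\<close> is attained, and that the set under \<open>Max\<close> in
    \<open>greedy_num\<close> is nonempty.\<close>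
  obtain cs where cs: "greedy_base G part_act Om cs" using greedy_base_exists[OF n4 G] by blast
  have "is_base G part_act Om (set cs)"
    using cs by (auto simp: is_base_def greedy_base_def in_set_conv_nth)
  then have ex: "\<exists>n B. finite B \<and> is_base G part_act Om B \<and> card B = n" by blast
  obtain B where B: "finite B" "is_base G part_act Om B" "card B = base_size G part_act Om"
    using LeastI_ex[OF ex] unfolding base_size_def by blast
  have le: "length bs \<le> 11 * base_size G part_act Om" if "greedy_base G part_act Om bs" for bs
    using greedy_base_length[OF n4 G that B(1,2)] B(3) by simp
  let ?L = "{length bs | bs. greedy_base G part_act Om bs}"
  have "finite ?L" by (rule finite_subset[of _ "{..11 * base_size G part_act Om}"]) (use le in auto)
  moreover have "?L \<noteq> {}" using cs by blast
  ultimately have "Max ?L \<in> ?L" by (rule Max_in)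
  then show ?thesis unfolding greedy_num_def using le by auto
qed

end
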